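(* Let $\mathcal{H}$ be the holomorphic rank 2 Pfaffian system on $SL(2,\mathbb{C})\times\mathbb{CP}^1$ generated, in homogeneous coordinates $[p,q]$ on $\mathbb{CP}^1$, by $pq\,\alpha^2-q^2\alpha^1$, $pq\,\alpha^3+p^2\alpha^1$, $q^2\alpha^3+p^2\alpha^2$. Then $\mathcal{H}$ is $SL(2,\mathbb{C})$-equivariantly equivalent to the jet space of holomorphic immersions $(J^2_0(\mathbb{CP}^1,\mathbb{CP}^1),\mathcal{C})$, where $SL(2,\mathbb{C})$ acts on $J^2_0(\mathbb{CP}^1,\mathbb{CP}^1)$ by the prolongation $\rho$ of the action $(z,w)\cdot A=\big(z,\frac{aw+c}{bw+d}\big)$. In particular, the map $\Psi:SL(2,\mathbb{C})\times\mathbb{CP}^1\to J^2_0(\mathbb{CP}^1,\mathbb{CP}^1)$ given by $$\Psi(A,[p,q])=\rho\big(([p,q]A^{-1},[p,q]A^{-1},1,0),\,A\big)$$ is an $SL(2,\mathbb{C})$-equivariant local diffeomorphism, and $\Psi^*\mathcal{C}=\mathcal{H}$.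
   Context: For $A=\begin{bmatrix}a&b\\c&d\end{bmatrix}\in SL(2,\mathbb{C})$, the holomorphic left-invariant 1-forms $\alpha^i$ are defined by $A^{-1}dA=\begin{bmatrix}\alpha^1&\alpha^2\\ \alpha^3&-\alpha^1\end{bmatrix}$. A holomorphic Pfaffian system is the differential ideal generated by holomorphic sections of a holomorphic subbundle of $T^*_{1,0}$. $SL(2,\mathbb{C})$ acts on $SL(2,\mathbb{C})\times\mathbb{CP}^1$ by the diagonal right action $(A,[p,q])\cdot C=(AC,[p,q]C)$, where $[p,q]C$ is row vector times matrix; $\mathcal{H}$ is invariant under this action. $J^2(\mathbb{CP}^1,\mathbb{CP}^1)$ is the complex 4-manifold of 2-jets of holomorphic maps $\mathbb{CP}^1\to\mathbb{CP}^1$, with standard local coordinates $(z,w,w_z,w_{zz})$, and $J^2_0(\mathbb{CP}^1,\mathbb{CP}^1)$ is the subset of 2-jets of immersions ($w_z\neq0$). The contact system $\mathcal{C}$ is the rank 2 holomorphic Pfaffian system generated locally by $dw-w_z\,dz$ and $dw_z-w_{zz}\,dz$. The prolonged action $\rho$ of $SL(2,\mathbb{C})$ on 2-jets is given locally by $$\rho\big((z,w,w_z,w_{zz}),A\big)=\Big(z,\ \tfrac{aw+c}{bw+d},\ \tfrac{w_z}{(bw+d)^2},\ \tfrac{w_{zz}}{(bw+d)^2}-\tfrac{2b\,w_z^2}{(bw+d)^3}\Big).$$ The point $([p,q]A^{-1},[p,q]A^{-1},1,0)$ of $J^2_0(\mathbb{CP}^1,\mathbb{CP}^1)$ is the 2-jet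 at $[p,q]A^{-1}$ of the identity map of $\mathbb{CP}^1$. *)

theory Defs
  imports "HOL-Analysis.Analysis" "HOL-Complex_Analysis.Cauchy_Integral_Formula"
begin

section \<open>Holomorphic maps and differential forms on open subsets of complex n-space\<close>

text \<open>Covectors of type (1,0) are written as rows \<open>g\<close>, acting on \<open>h\<close> by \<open>\<Sum>i. g $ i * h $ i\<close>.
  Both notions of holomorphy are meant for open sets \<open>S\<close>.\<close>

definition holomorphic_fun_on :: "(complex^'n \<Rightarrow> complex) \<Rightarrow> (complex^'n) set \<Rightarrow> bool" where
  "holomorphic_fun_on f S \<longleftrightarrow>
    (\<forall>x\<in>S. \<exists>g::complex^'n. (f has_derivative (\<lambda>h. \<Sum>i\<in>UNIV. g $ i * h $ i)) (at x))"

definition holomorphic_map_on :: "(complex^'n \<Rightarrow> complex^'m) \<Rightarrow> (complex^'n) set \<Rightarrow> bool" where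
  "holomorphic_map_on F S \<longleftrightarrow> (\<forall>i. holomorphic_fun_on (\<lambda>x. F x $ i) S)"

definition cgradient :: "(complex^'n \<Rightarrow> complex) \<Rightarrow> complex^'n \<Rightarrow> complex^'n" where
  "cgradient f x = (\<chi> i. frechet_derivative f (at x) (axis i 1))"

definition cjacobian :: "(complex^'n \<Rightarrow> complex^'m) \<Rightarrow> complex^'n \<Rightarrow> complex^'n^'m" where
  "cjacobian F x = (\<chi> i. cgradient (\<lambda>y. F y $ i) x)"

text \<open>A (mixed degree) form \<open>\<omega> = \<Sum>I. \<omega>_I dx^I\<close> is given by its coefficients, where for
  \<open>I = {i1 < ... < ik}\<close> the monomial \<open>dx^I\<close> is \<open>dx^i1 \<and> ... \<and> dx^ik\<close>. Forms on an open set \<open>V\<close> are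
  normalised to vanish outside \<open>V\<close>.\<close>

type_synonym 'n form = "(complex, 'n) vec \<Rightarrow> 'n set \<Rightarrow> complex"

definition holomorphic_forms :: "((complex, 'n) vec) set \<Rightarrow> ('n::finite) form set" where
  "holomorphic_forms V =
    {\<omega>. (\<forall>I. holomorphic_fun_on (\<lambda>x. \<omega> x I) V) \<and> (\<forall>x I. x \<notin> V \<longrightarrow> \<omega> x I = 0)}"

definition form_add :: "'n form \<Rightarrow> 'n form \<Rightarrow> ('n::finite) form" where
  "form_add \<omega> \<eta> = (\<lambda>x I. \<omega> x I + \<eta> x I)"

definition wedge :: "'n form \<Rightarrow> 'n form \<Rightarrow> ('n::{finite,linorder}) form" where
  "wedge \<omega> \<eta> = (\<lambda>x K. \<Sum>I\<in>Pow K.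
      (-1) ^ card {(i, j). i \<in> I \<and> j \<in> K - I \<and> j < i} * \<omega> x I * \<eta> x (K - I))"

definition ext_d :: "((complex, 'n) vec) set \<Rightarrow> 'n form \<Rightarrow> ('n::{finite,linorder}) form" where
  "ext_d V \<omega> = (\<lambda>x K. if x \<in> V
      then \<Sum>i\<in>K. (-1) ^ card {j\<in>K. j < i} * cgradient (\<lambda>y. \<omega> y (K - {i})) x $ i
      else 0)"

definition one_form :: "((complex, 'n) vec) set \<Rightarrow> ((complex, 'n) vec \<Rightarrow> (complex, 'n) vec) \<Rightarrow> ('n::finite) form" where
  "one_form V \<theta> = (\<lambda>x I. if x \<in> V then \<Sum>i\<in>UNIV. if I = {i} then \<theta> x $ i else 0 else 0)"

inductive_set differential_ideal ::
    "((complex, 'n) vec) set \<Rightarrow> ('n::{finite,linorder}) form set \<Rightarrow> 'n form set"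
  for V :: "((complex, 'n) vec) set" and S :: "'n form set" where
  gen: "\<omega> \<in> S \<Longrightarrow> \<omega> \<in> differential_ideal V S"
| zero: "(\<lambda>x I. 0) \<in> differential_ideal V S"
| add: "\<omega> \<in> differential_ideal V S \<Longrightarrow> \<eta> \<in> differential_ideal V S \<Longrightarrow>
    form_add \<omega> \<eta> \<in> differential_ideal V S"
| wedge_left: "\<omega> \<in> differential_ideal V S \<Longrightarrow> \<beta> \<in> holomorphic_forms V \<Longrightarrow>
    wedge \<beta> \<omega> \<in> differential_ideal V S"
| wedge_right: "\<omega> \<in> differential_ideal V S \<Longrightarrow> \<beta> \<in> holomorphic_forms V \<Longrightarrow>
    wedge \<omega> \<beta> \<in> differential_ideal V S"
| deriv: "\<omega> \<in> differential_ideal V S \<Longrightarrow> ext_d V \<omega> \<in> differential_ideal V S"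


section \<open>Complex manifolds and Pfaffian systems\<close>

type_synonym ('m, 'e) chart = "'m set \<times> ('m \<Rightarrow> 'e)"

definition chart_inv :: "('m, 'e) chart \<Rightarrow> 'e \<Rightarrow> 'm" where
  "chart_inv \<kappa> = inv_into (fst \<kappa>) (snd \<kappa>)"

definition local_rep ::
    "('m, 'e) chart \<Rightarrow> ('k, 'f) chart \<Rightarrow> ('m \<Rightarrow> 'k) \<Rightarrow> 'e \<Rightarrow> 'f" where
  "local_rep \<kappa> \<kappa>' F = snd \<kappa>' \<circ> F \<circ> chart_inv \<kappa>"

definition carrier_of :: "('m, 'e) chart set \<Rightarrow> 'm set" where
  "carrier_of \<A> = \<Union> (fst ` \<A>)"

definition open_in :: "('m, 'e::topological_space) chart set \<Rightarrow> 'm set \<Rightarrow> bool" where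
  "open_in \<A> M \<longleftrightarrow> M \<subseteq> carrier_of \<A> \<and> (\<forall>\<kappa>\<in>\<A>. open (snd \<kappa> ` (M \<inter> fst \<kappa>)))"

definition complex_manifold :: "('m, complex^'n) chart set \<Rightarrow> bool" where
  "complex_manifold \<A> \<longleftrightarrow>
    (\<forall>\<kappa>\<in>\<A>. inj_on (snd \<kappa>) (fst \<kappa>)) \<and>
    (\<forall>\<kappa>\<in>\<A>. \<forall>\<kappa>'\<in>\<A>. open (snd \<kappa> ` (fst \<kappa> \<inter> fst \<kappa>')) \<and>
        holomorphic_map_on (local_rep \<kappa> \<kappa>' id) (snd \<kappa> ` (fst \<kappa> \<inter> fst \<kappa>'))) \<and>
    (\<exists>\<B>\<subseteq>\<A>. countable \<B> \<and> carrier_of \<B> = carrier_of \<A>) \<and>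
    (\<forall>x\<in>carrier_of \<A>. \<forall>y\<in>carrier_of \<A>. x \<noteq> y \<longrightarrow>
        (\<exists>M N. open_in \<A> M \<and> open_in \<A> N \<and> x \<in> M \<and> y \<in> N \<and> M \<inter> N = {}))"

definition manifold_holomorphic_on ::
    "('m, complex^'n) chart set \<Rightarrow> ('k, complex^'l) chart set \<Rightarrow> ('m \<Rightarrow> 'k) \<Rightarrow> 'm set \<Rightarrow> bool" where
  "manifold_holomorphic_on \<A> \<B> F M \<longleftrightarrow>
    (\<forall>x\<in>M. \<forall>\<kappa>\<in>\<A>. \<forall>\<kappa>'\<in>\<B>. x \<in> fst \<kappa> \<and> F x \<in> fst \<kappa>' \<longrightarrow>
      (\<exists>V. open V \<and> snd \<kappa> x \<in> V \<and> V \<subseteq> snd \<kappa> ` fst \<kappa> \<and>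
        (\<forall>u\<in>V. F (chart_inv \<kappa> u) \<in> fst \<kappa>') \<and> holomorphic_map_on (local_rep \<kappa> \<kappa>' F) V))"

definition local_biholomorphism ::
    "('m, complex^'n) chart set \<Rightarrow> ('k, complex^'l) chart set \<Rightarrow> ('m \<Rightarrow> 'k) \<Rightarrow> bool" where
  "local_biholomorphism \<A> \<B> F \<longleftrightarrow>
    F ` carrier_of \<A> \<subseteq> carrier_of \<B> \<and>
    (\<forall>x\<in>carrier_of \<A>. \<exists>M N. open_in \<A> M \<and> open_in \<B> N \<and> x \<in> M \<and> bij_betw F M N \<and>
        manifold_holomorphic_on \<A> \<B> F M \<and> manifold_holomorphic_on \<B> \<A> (inv_into M F) N)"

text \<open>A subbundle of the (1,0)-cotangent bundle is given by its fibres, written in each chart of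
  the atlas with respect to the coordinate coframe of that chart.\<close>

type_synonym ('m, 'n) cotangent_subbundle =
  "('m, complex^'n) chart \<Rightarrow> 'm \<Rightarrow> (complex^'n) set"

definition holomorphic_subbundle ::
    "('m, complex^'n) chart set \<Rightarrow> nat \<Rightarrow> ('m, 'n) cotangent_subbundle \<Rightarrow> bool" where
  "holomorphic_subbundle \<A> r E \<longleftrightarrow>
    (\<forall>\<kappa>\<in>\<A>. \<forall>x\<in>fst \<kappa>. \<exists>V \<theta>. open V \<and> snd \<kappa> x \<in> V \<and> V \<subseteq> snd \<kappa> ` fst \<kappa> \<and>
        (\<forall>i<r. holomorphic_map_on (\<theta> i) V) \<and>
        (\<forall>u\<in>V. E \<kappa> (chart_inv \<kappa> u) = vec.span ((\<lambda>i. \<theta> i u) ` {..<r}) \<and>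
               vec.dim (E \<kappa> (chart_inv \<kappa> u)) = r)) \<and>
    (\<forall>\<kappa>\<in>\<A>. \<forall>\<kappa>'\<in>\<A>. \<forall>x\<in>fst \<kappa> \<inter> fst \<kappa>'.
        E \<kappa> x = (\<lambda>\<theta>. \<theta> v* cjacobian (local_rep \<kappa> \<kappa>' id) (snd \<kappa> x)) ` E \<kappa>' x)"

text \<open>The holomorphic sections of \<open>E\<close> over the open subset of \<open>fst \<kappa>\<close> with coordinate image \<open>V\<close>.\<close>

definition sections ::
    "('m, 'n) cotangent_subbundle \<Rightarrow> ('m, complex^'n) chart \<Rightarrow> (complex^'n) set \<Rightarrow>
      (complex^'n \<Rightarrow> complex^'n) set" where
  "sections E \<kappa> V = {\<theta>. holomorphic_map_on \<theta> V \<and> (\<forall>u\<in>V. \<theta> u \<in> E \<kappa> (chart_inv \<kappa> u))}"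

definition pfaffian_system ::
    "('m, 'n) cotangent_subbundle \<Rightarrow> ('m, (complex, 'n) vec) chart \<Rightarrow> ((complex, 'n) vec) set \<Rightarrow>
      ('n::{finite,linorder}) form set" where
  "pfaffian_system E \<kappa> V = differential_ideal V (one_form V ` sections E \<kappa> V)"

text \<open>The coordinate expression, in the charts \<open>\<kappa>\<close> and \<open>\<kappa>'\<close>, of the pull-back by \<open>F\<close> of the Pfaffian
  system of \<open>E\<close>: pull-back commutes with wedge products and exterior derivatives, so this is the
  differential ideal generated by the pull-backs of local sections of \<open>E\<close>.\<close>

definition pullback_system ::
    "('m \<Rightarrow> 'k) \<Rightarrow> ('k, 'l::finite) cotangent_subbundle \<Rightarrow>
      ('m, (complex, 'n) vec) chart \<Rightarrow> ('k, (complex, 'l) vec) chart \<Rightarrow> ((complex, 'n) vec) set \<Rightarrow>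
      ('n::{finite,linorder}) form set" where
  "pullback_system F E \<kappa> \<kappa>' V = differential_ideal V
    {one_form V (\<lambda>u. \<theta> (local_rep \<kappa> \<kappa>' F u) v* cjacobian (local_rep \<kappa> \<kappa>' F) u) | \<theta> W.
       open W \<and> W \<subseteq> snd \<kappa>' ` fst \<kappa>' \<and> local_rep \<kappa> \<kappa>' F ` V \<subseteq> W \<and> \<theta> \<in> sections E \<kappa>' W}"

definition pullback_equals ::
    "('m, (complex, 'n) vec) chart set \<Rightarrow> ('k, (complex, 'l) vec) chart set \<Rightarrow> ('m \<Rightarrow> 'k) \<Rightarrow>
      ('k, 'l::finite) cotangent_subbundle \<Rightarrow> ('m, 'n::{finite,linorder}) cotangent_subbundle \<Rightarrow> bool" where
  "pullback_equals \<A> \<B> F E D \<longleftrightarrow>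
    (\<forall>\<kappa>\<in>\<A>. \<forall>\<kappa>'\<in>\<B>. \<forall>V. open V \<and> V \<subseteq> snd \<kappa> ` (fst \<kappa> \<inter> F -` fst \<kappa>') \<longrightarrow>
      pullback_system F E \<kappa> \<kappa>' V = pfaffian_system D \<kappa> V)"

definition equivariant_on ::
    "'g set \<Rightarrow> 'm set \<Rightarrow> ('m \<Rightarrow> 'g \<Rightarrow> 'm) \<Rightarrow> ('k \<Rightarrow> 'g \<Rightarrow> 'k) \<Rightarrow> ('m \<Rightarrow> 'k) \<Rightarrow> bool" where
  "equivariant_on G M act act' F \<longleftrightarrow> (\<forall>x\<in>M. \<forall>g\<in>G. F (act x g) = act' (F x) g)"

text \<open>Equivalence of Pfaffian systems is local: the equivalence map is a local biholomorphism onto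
  the whole target. It need not be injective.\<close>

definition equivariantly_equivalent ::
    "'g set \<Rightarrow>
      ('m, (complex, 'n) vec) chart set \<Rightarrow> ('m \<Rightarrow> 'g \<Rightarrow> 'm) \<Rightarrow> ('m, 'n::{finite,linorder}) cotangent_subbundle \<Rightarrow>
      ('k, (complex, 'l) vec) chart set \<Rightarrow> ('k \<Rightarrow> 'g \<Rightarrow> 'k) \<Rightarrow> ('k, 'l::finite) cotangent_subbundle \<Rightarrow> bool" where
  "equivariantly_equivalent G \<A> act D \<B> act' E \<longleftrightarrow>
    (\<exists>F. local_biholomorphism \<A> \<B> F \<and> F ` carrier_of \<A> = carrier_of \<B> \<and>
         equivariant_on G (carrier_of \<A>) act act' F \<and> pullback_equals \<A> \<B> F E D)"


section \<open>The complex projective line\<close>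

definition proportional :: "complex^2 \<Rightarrow> complex^2 \<Rightarrow> bool" where
  "proportional u v \<longleftrightarrow> u \<noteq> 0 \<and> v \<noteq> 0 \<and> (\<exists>c. c \<noteq> 0 \<and> v = c *s u)"

quotient_type cp1 = "complex^2" / partial: proportional
proof (rule part_equivpI)
  show "\<exists>u. proportional u u"
    by (rule exI[of _ "axis 1 1"])
      (auto simp: proportional_def axis_eq_0_iff intro!: exI[of _ "1::complex"])
  show "symp proportional"
  proof (rule sympI)
    fix u v assume "proportional u v"
    then obtain c where "u \<noteq> 0" "v \<noteq> 0" "c \<noteq> 0" "v = c *s u"
      by (auto simp: proportional_def)
    then show "proportional v u"
      unfolding proportional_def by (intro conjI exI[of _ "inverse c"]) (auto simp: vec_eq_iff)
  qed
  show "transp proportional"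
  proof (rule transpI)
    fix u v w assume "proportional u v" "proportional v w"
    then obtain c d where "u \<noteq> 0" "w \<noteq> 0" "c \<noteq> 0" "v = c *s u" "d \<noteq> 0" "w = d *s v"
      by (auto simp: proportional_def)
    then show "proportional u w"
      unfolding proportional_def by (intro conjI exI[of _ "d * c"]) (auto simp: vec_eq_iff)
  qed
qed

definition cp1_act :: "cp1 \<Rightarrow> complex^2^2 \<Rightarrow> cp1" where
  "cp1_act x A = abs_cp1 (rep_cp1 x v* A)"

text \<open>Since \<open>1 + 1 = 0 = 2\<close> in the index type, \<open>affine_chart 2\<close> is \<open>p / q\<close> (defined for \<open>q \<noteq> 0\<close>) and
  \<open>affine_chart 1\<close> is \<open>q / p\<close> (defined for \<open>p \<noteq> 0\<close>).\<close>

definition affine_chart :: "2 \<Rightarrow> (cp1, complex) chart" where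
  "affine_chart i = ({x. rep_cp1 x $ i \<noteq> 0}, \<lambda>x. rep_cp1 x $ (i + 1) / rep_cp1 x $ i)"

definition cp1_atlas :: "(cp1, complex) chart set" where
  "cp1_atlas = range affine_chart"


section \<open>The jet space\<close>

definition holomorphic_near :: "(cp1 \<Rightarrow> cp1) \<Rightarrow> cp1 \<Rightarrow> bool" where
  "holomorphic_near f x \<longleftrightarrow>
    (\<forall>\<kappa>\<in>cp1_atlas. \<forall>\<kappa>'\<in>cp1_atlas. x \<in> fst \<kappa> \<and> f x \<in> fst \<kappa>' \<longrightarrow>
      (\<exists>V. open V \<and> snd \<kappa> x \<in> V \<and> V \<subseteq> snd \<kappa> ` fst \<kappa> \<and>
        (\<forall>t\<in>V. f (chart_inv \<kappa> t) \<in> fst \<kappa>') \<and> local_rep \<kappa> \<kappa>' f holomorphic_on V))"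

text \<open>The coordinates \<open>(z, w, w_z, w_zz)\<close> of the 2-jet of \<open>f\<close> at \<open>x\<close>, for the coordinate functions
  \<open>z\<close> (of \<open>\<kappa>\<close>) and \<open>w\<close> (of \<open>\<kappa>'\<close>).\<close>

definition germ_coords ::
    "(cp1, complex) chart \<Rightarrow> (cp1, complex) chart \<Rightarrow> cp1 \<times> (cp1 \<Rightarrow> cp1) \<Rightarrow> complex^4" where
  "germ_coords \<kappa> \<kappa>' = (\<lambda>(x, f).
    vector [snd \<kappa> x, snd \<kappa>' (f x), deriv (local_rep \<kappa> \<kappa>' f) (snd \<kappa> x),
            (deriv ^^ 2) (local_rep \<kappa> \<kappa>' f) (snd \<kappa> x)])"

definition same_2jet :: "cp1 \<times> (cp1 \<Rightarrow> cp1) \<Rightarrow> cp1 \<times> (cp1 \<Rightarrow> cp1) \<Rightarrow> bool" where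
  "same_2jet = (\<lambda>(x, f) (y, g).
    x = y \<and> f x = g x \<and> holomorphic_near f x \<and> holomorphic_near g x \<and>
    (\<forall>\<kappa>\<in>cp1_atlas. \<forall>\<kappa>'\<in>cp1_atlas. x \<in> fst \<kappa> \<and> f x \<in> fst \<kappa>' \<longrightarrow>
      germ_coords \<kappa> \<kappa>' (x, f) = germ_coords \<kappa> \<kappa>' (x, g)))"

lemma affine_chart_surj: "snd (affine_chart i) ` fst (affine_chart i) = UNIV"
proof (intro set_eqI iffI UNIV_I)
  fix t :: complex
  define v :: "complex^2" where "v = (\<chi> j. if j = i then 1 else t)"
  have ne: "i + 1 \<noteq> i"
    by (metis add_cancel_right_right zero_neq_one)
  have "v $ i = 1"
    by (simp add: v_def)
  then have "v \<noteq> 0"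
    by auto
  then have "proportional v v"
    unfolding proportional_def by (intro conjI exI[of _ 1]) auto
  then have "proportional (rep_cp1 (abs_cp1 v)) v"
    by (rule Quotient3_rep_abs[OF Quotient3_cp1])
  then obtain c where c: "c \<noteq> 0" "v = c *s rep_cp1 (abs_cp1 v)"
    by (auto simp: proportional_def)
  have 1: "c * rep_cp1 (abs_cp1 v) $ i = 1"
    using arg_cong[OF c(2), of "\<lambda>w. w $ i"] \<open>v $ i = 1\<close> by simp
  have 2: "c * rep_cp1 (abs_cp1 v) $ (i + 1) = t"
    using arg_cong[OF c(2), of "\<lambda>w. w $ (i + 1)"] ne by (simp add: v_def)
  have "rep_cp1 (abs_cp1 v) $ i \<noteq> 0"
    using 1 by auto
  moreover have "t = rep_cp1 (abs_cp1 v) $ (i + 1) / rep_cp1 (abs_cp1 v) $ i"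
    using 1 2 calculation by (metis mult.commute mult_cancel_left nonzero_eq_divide_eq mult_divide_mult_cancel_left c(1) div_by_1)
  ultimately show "t \<in> snd (affine_chart i) ` fst (affine_chart i)"
    by (auto simp: affine_chart_def)
qed

lemma holomorphic_near_const: "holomorphic_near (\<lambda>_. y) x"
  unfolding holomorphic_near_def
proof (intro ballI impI)
  fix \<kappa> \<kappa>' :: "(cp1, complex) chart"
  assume "\<kappa> \<in> cp1_atlas" "x \<in> fst \<kappa> \<and> y \<in> fst \<kappa>'"
  then show "\<exists>V. open V \<and> snd \<kappa> x \<in> V \<and> V \<subseteq> snd \<kappa> ` fst \<kappa> \<and>
      (\<forall>t\<in>V. y \<in> fst \<kappa>') \<and> local_rep \<kappa> \<kappa>' (\<lambda>_. y) holomorphic_on V"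
    by (intro exI[of _ UNIV]) (auto simp: cp1_atlas_def affine_chart_surj local_rep_def o_def)
qed

quotient_type jet2 = "cp1 \<times> (cp1 \<Rightarrow> cp1)" / partial: same_2jet
proof (rule part_equivpI)
  show "\<exists>r. same_2jet r r"
    by (rule exI[of _ "(undefined, \<lambda>_. undefined)"]) (simp add: same_2jet_def holomorphic_near_const)
  show "symp same_2jet"
    by (rule sympI) (auto simp: same_2jet_def)
  show "transp same_2jet"
    by (rule transpI) (auto simp: same_2jet_def)
qed

definition jet_of :: "cp1 \<Rightarrow> (cp1 \<Rightarrow> cp1) \<Rightarrow> jet2" where
  "jet_of x f = abs_jet2 (x, f)"

definition jet_source :: "jet2 \<Rightarrow> cp1" where
  "jet_source j = fst (rep_jet2 j)"

definition jet_map :: "jet2 \<Rightarrow> cp1 \<Rightarrow> cp1" where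
  "jet_map j = snd (rep_jet2 j)"

definition jet_chart :: "(cp1, complex) chart \<Rightarrow> (cp1, complex) chart \<Rightarrow> (jet2, complex^4) chart" where
  "jet_chart \<kappa> \<kappa>' =
    ({j. jet_source j \<in> fst \<kappa> \<and> jet_map j (jet_source j) \<in> fst \<kappa>'},
     \<lambda>j. germ_coords \<kappa> \<kappa>' (rep_jet2 j))"

definition jet2_atlas :: "(jet2, complex^4) chart set" where
  "jet2_atlas = {jet_chart \<kappa> \<kappa>' | \<kappa> \<kappa>'. \<kappa> \<in> cp1_atlas \<and> \<kappa>' \<in> cp1_atlas}"

definition immersion_jets :: "jet2 set" where
  "immersion_jets = {j. \<forall>\<kappa>\<in>jet2_atlas. j \<in> fst \<kappa> \<longrightarrow> snd \<kappa> j $ 3 \<noteq> 0}"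

definition immersion_atlas :: "(jet2, complex^4) chart set" where
  "immersion_atlas = (\<lambda>\<kappa>. (fst \<kappa> \<inter> immersion_jets, snd \<kappa>)) ` jet2_atlas"

text \<open>The span of \<open>dw - w_z dz\<close> and \<open>dw_z - w_zz dz\<close> in the coordinates \<open>(z, w, w_z, w_zz)\<close>.\<close>

definition contact_bundle :: "(jet2, 4) cotangent_subbundle" where
  "contact_bundle \<kappa> j = vec.span
    {axis 2 1 - (snd \<kappa> j $ 3) *s axis 1 1, axis 3 1 - (snd \<kappa> j $ 4) *s axis 1 1}"

text \<open>The prolongation of the action \<open>(z, w) \<cdot> A = (z, w \<cdot> A)\<close>: the jet of \<open>f\<close> is sent to the jet, at
  the same point, of \<open>f\<close> followed by \<open>w \<mapsto> w \<cdot> A\<close>. In the affine coordinate \<open>w = p / q\<close> the latter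
  is \<open>w \<mapsto> (a w + c) / (b w + d)\<close>.\<close>

definition prolonged_act :: "jet2 \<Rightarrow> complex^2^2 \<Rightarrow> jet2" where
  "prolonged_act j A = jet_of (jet_source j) (\<lambda>y. cp1_act (jet_map j y) A)"


section \<open>The system on the product of SL(2,C) with the projective line\<close>

definition SL2 :: "(complex^2^2) set" where
  "SL2 = {A. det A = 1}"

text \<open>On the hypersurface \<open>a d - b c = 1\<close> the functions \<open>(a, b, c)\<close> are coordinates where \<open>a \<noteq> 0\<close>
  and \<open>(a, b, d)\<close> are coordinates where \<open>b \<noteq> 0\<close>; these two regions cover it.\<close>

definition product_chart_a :: "(cp1, complex) chart \<Rightarrow> ((complex^2^2) \<times> cp1, complex^4) chart" where
  "product_chart_a \<kappa> = ({(A, x). A \<in> SL2 \<and> A $ 1 $ 1 \<noteq> 0 \<and> x \<in> fst \<kappa>},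
     \<lambda>(A, x). vector [A $ 1 $ 1, A $ 1 $ 2, A $ 2 $ 1, snd \<kappa> x])"

definition product_chart_b :: "(cp1, complex) chart \<Rightarrow> ((complex^2^2) \<times> cp1, complex^4) chart" where
  "product_chart_b \<kappa> = ({(A, x). A \<in> SL2 \<and> A $ 1 $ 2 \<noteq> 0 \<and> x \<in> fst \<kappa>},
     \<lambda>(A, x). vector [A $ 1 $ 1, A $ 1 $ 2, A $ 2 $ 2, snd \<kappa> x])"

definition product_atlas :: "((complex^2^2) \<times> cp1, complex^4) chart set" where
  "product_atlas = product_chart_a ` cp1_atlas \<union> product_chart_b ` cp1_atlas"

definition diagonal_act :: "(complex^2^2) \<times> cp1 \<Rightarrow> complex^2^2 \<Rightarrow> (complex^2^2) \<times> cp1" where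
  "diagonal_act = (\<lambda>(A, x) C. (A ** C, cp1_act x C))"

definition differential_of ::
    "('m \<Rightarrow> complex) \<Rightarrow> ('m, complex^'n) chart \<Rightarrow> 'm \<Rightarrow> complex^'n" where
  "differential_of f \<kappa> x = cgradient (f \<circ> chart_inv \<kappa>) (snd \<kappa> x)"

text \<open>The entries of the matrix \<open>A\<^sup>-\<^sup>1 dA\<close> of 1-forms.\<close>

definition maurer_cartan ::
    "2 \<Rightarrow> 2 \<Rightarrow> ((complex^2^2) \<times> cp1, complex^4) chart \<Rightarrow> (complex^2^2) \<times> cp1 \<Rightarrow> complex^4" where
  "maurer_cartan i j \<kappa> m =
    (\<Sum>k\<in>UNIV. matrix_inv (fst m) $ i $ k *s differential_of (\<lambda>m'. fst m' $ k $ j) \<kappa> m)"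

text \<open>The span does not depend on the choice of the homogeneous coordinates \<open>[p, q]\<close>, since the
  coefficients of the three forms are homogeneous of degree two.\<close>

definition H_bundle :: "((complex^2^2) \<times> cp1, 4) cotangent_subbundle" where
  "H_bundle \<kappa> m =
    (let p = rep_cp1 (snd m) $ 1; q = rep_cp1 (snd m) $ 2;
         \<alpha>1 = maurer_cartan 1 1 \<kappa> m; \<alpha>2 = maurer_cartan 1 2 \<kappa> m; \<alpha>3 = maurer_cartan 2 1 \<kappa> m
     in vec.span {(p * q) *s \<alpha>2 - q\<^sup>2 *s \<alpha>1, (p * q) *s \<alpha>3 + p\<^sup>2 *s \<alpha>1, q\<^sup>2 *s \<alpha>3 + p\<^sup>2 *s \<alpha>2})"

definition Psi :: "(complex^2^2) \<times> cp1 \<Rightarrow> jet2" where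
  "Psi = (\<lambda>(A, x). prolonged_act (jet_of (cp1_act x (matrix_inv A)) id) A)"


section \<open>The prolonged action in affine coordinates\<close>

lemma cp1_rep_abs: assumes "v \<noteq> 0" shows "\<exists>c. c \<noteq> 0 \<and> rep_cp1 (abs_cp1 v) = c *s v"
proof -
  have "proportional v v" using assms
    unfolding proportional_def by (intro conjI exI[of _ 1]) auto
  then have "proportional (rep_cp1 (abs_cp1 v)) v"
    by (rule Quotient3_rep_abs[OF Quotient3_cp1])
  then obtain c where c: "c \<noteq> 0" "v = c *s rep_cp1 (abs_cp1 v)" by (auto simp: proportional_def)
  have "rep_cp1 (abs_cp1 v) = (1 / c) *s (c *s rep_cp1 (abs_cp1 v))" using c(1) by simp
  then show ?thesis using c by (intro exI[of _ "1 / c"]) simp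
qed

lemma cp1_rep_nonzero: "rep_cp1 x \<noteq> 0"
  using Quotient3_rep_reflp[OF Quotient3_cp1] unfolding proportional_def by blast

lemma cp1_abs_rep: "abs_cp1 (rep_cp1 x) = x"
  by (rule Quotient3_abs_rep[OF Quotient3_cp1])

lemma cp1_abs_eq: assumes "v \<noteq> 0" "u = c *s v" "c \<noteq> 0" shows "abs_cp1 u = abs_cp1 v"
proof -
  have "proportional v u" "proportional v v" "proportional u u"
    using assms by (auto simp: proportional_def intro: exI[of _ 1])
  then show ?thesis using Quotient3_rel[OF Quotient3_cp1] by metis
qed

definition affine_vec :: "2 \<Rightarrow> complex \<Rightarrow> complex^2" where "affine_vec i t = (\<chi> j. if j = i then 1 else t)"

lemma index2_succ: "(i::2) + 1 \<noteq> i" "(i::2) + 1 + 1 = i"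
  using exhaust_2[of i] by auto

lemma UNIV_index2: "(UNIV::2 set) = {i, i+1}"
  using exhaust_2[of i] by (auto simp: UNIV_2)

lemma affine_vec_simps: "affine_vec i t $ i = 1" "affine_vec i t $ (i+1) = t" "affine_vec i t \<noteq> 0"
  by (auto simp: affine_vec_def index2_succ vec_eq_iff)

lemma chart_inv_affine: "chart_inv (affine_chart i) t = abs_cp1 (affine_vec i t)"
proof -
  have mem: "abs_cp1 (affine_vec i t) \<in> fst (affine_chart i)" and val: "snd (affine_chart i) (abs_cp1 (affine_vec i t)) = t"
    using cp1_rep_abs[OF affine_vec_simps(3)[of i t]] by (auto simp: affine_chart_def affine_vec_simps)
  have "inj_on (snd (affine_chart i)) (fst (affine_chart i))"
  proof (rule inj_onI)
    fix x y assume a: "x \<in> fst (affine_chart i)" "y \<in> fst (affine_chart i)" "snd (affine_chart i) x = snd (affine_chart i) y"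
    have "rep_cp1 x = (rep_cp1 x $ i / rep_cp1 y $ i) *s rep_cp1 y"
    proof (rule vec_eq_iff[THEN iffD2], rule allI)
      fix k :: 2
      have "k = i \<or> k = i + 1" using UNIV_index2[of i] by auto
      then show "rep_cp1 x $ k = ((rep_cp1 x $ i / rep_cp1 y $ i) *s rep_cp1 y) $ k"
        using a by (auto simp: affine_chart_def field_simps)
    qed
    then have "abs_cp1 (rep_cp1 x) = abs_cp1 (rep_cp1 y)"
      by (rule cp1_abs_eq[OF cp1_rep_nonzero]) (use a in \<open>auto simp: affine_chart_def\<close>)
    then show "x = y" by (simp add: cp1_abs_rep)
  qed
  then show ?thesis unfolding chart_inv_def using mem val by (metis inv_into_f_f)
qed

lemma vector_matrix_mult_2: "(v v* A) $ k = v $ i * A $ i $ k + v $ (i+1) * (A $ (i+1) $ k)" for v :: "complex^2"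
  unfolding vector_matrix_mult_def by (simp add: UNIV_index2[of i] index2_succ)

lemma cp1_act_abs: assumes "A \<in> SL2" "v \<noteq> 0" shows "cp1_act (abs_cp1 v) A = abs_cp1 (v v* A)" "v v* A \<noteq> 0"
proof -
  have inv: "invertible A" using assms by (simp add: SL2_def invertible_det_nz)
  show nz: "v v* A \<noteq> 0"
  proof
    assume "v v* A = 0"
    moreover obtain B where "A ** B = mat 1" using inv by (auto simp: invertible_def)
    ultimately have "v v* mat 1 = (0 :: complex^2) v* B" by (metis vector_matrix_mul_assoc)
    then show False using assms(2) by (simp add: vec_eq_iff vector_matrix_mult_2[of _ _ _ 1] vector_matrix_mul_rid)
  qed
  obtain c where c: "c \<noteq> 0" "rep_cp1 (abs_cp1 v) = c *s v" using cp1_rep_abs assms by blast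
  show "cp1_act (abs_cp1 v) A = abs_cp1 (v v* A)"
    unfolding cp1_act_def c
    by (rule cp1_abs_eq[OF nz _ c(1)]) (auto simp: vec_eq_iff vector_matrix_mult_2[of _ _ _ 1] algebra_simps)
qed

lemma affine_chart_abs: assumes "v \<noteq> 0"
  shows "abs_cp1 v \<in> fst (affine_chart i) \<longleftrightarrow> v $ i \<noteq> 0"
    "snd (affine_chart i) (abs_cp1 v) = v $ (i+1) / v $ i"
  using cp1_rep_abs[OF assms] by (auto simp: affine_chart_def)

lemma affine_chart_back: assumes "x \<in> fst (affine_chart i)" shows "abs_cp1 (affine_vec i (snd (affine_chart i) x)) = x"
proof -
  have n: "rep_cp1 x $ i \<noteq> 0" using assms by (simp add: affine_chart_def)
  have "affine_vec i (snd (affine_chart i) x) = (1 / rep_cp1 x $ i) *s rep_cp1 x"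
  proof (rule vec_eq_iff[THEN iffD2], rule allI)
    fix k :: 2
    have "k = i \<or> k = i + 1" using UNIV_index2[of i] by auto
    then show "affine_vec i (snd (affine_chart i) x) $ k = ((1 / rep_cp1 x $ i) *s rep_cp1 x) $ k"
      using n by (auto simp: affine_chart_def affine_vec_simps)
  qed
  from cp1_abs_eq[OF cp1_rep_nonzero this] n show ?thesis by (simp add: cp1_abs_rep)
qed

lemma holomorphic_near_act: assumes "A \<in> SL2" "holomorphic_near f x" shows "holomorphic_near (\<lambda>y. cp1_act (f y) A) x"
  unfolding holomorphic_near_def cp1_atlas_def
proof (clarsimp)
  fix i k assume x: "x \<in> fst (affine_chart i)" and g: "cp1_act (f x) A \<in> fst (affine_chart k)"
  define l :: 2 where "l = (if f x \<in> fst (affine_chart 1) then 1 else 2)"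
  have l: "f x \<in> fst (affine_chart l)"
    using cp1_rep_nonzero[of "f x"] by (auto simp: l_def affine_chart_def vec_eq_iff forall_2)
  obtain V where V: "open V" "snd (affine_chart i) x \<in> V" 
     "\<forall>t\<in>V. f (chart_inv (affine_chart i) t) \<in> fst (affine_chart l)"
     "local_rep (affine_chart i) (affine_chart l) f holomorphic_on V"
    using assms(2) x l unfolding holomorphic_near_def cp1_atlas_def by blast
  define F where "F = local_rep (affine_chart i) (affine_chart l) f"
  have F: "f (chart_inv (affine_chart i) t) = abs_cp1 (affine_vec l (F t))" if "t \<in> V" for t
    using affine_chart_back V(3) that unfolding F_def local_rep_def by (metis comp_apply)
  define D where "D = (\<lambda>t. A $ l $ k + F t * A $ (l+1) $ k)"
  define N where "N = (\<lambda>t. A $ l $ (k+1) + F t * A $ (l+1) $ (k+1))"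
  have G: "cp1_act (f (chart_inv (affine_chart i) t)) A = abs_cp1 (affine_vec l (F t) v* A)" if "t \<in> V" for t
    using F[OF that] cp1_act_abs[OF assms(1) affine_vec_simps(3)] by simp
  have nz: "affine_vec l (F t) v* A \<noteq> 0" for t using cp1_act_abs[OF assms(1) affine_vec_simps(3)] by simp
  have D': "(affine_vec l (F t) v* A) $ k = D t" "(affine_vec l (F t) v* A) $ (k+1) = N t" for t
    by (auto simp: vector_matrix_mult_2[of _ _ _ l] affine_vec_simps D_def N_def)
  have hF: "F holomorphic_on V" using V(4) F_def by simp
  then have hD: "D holomorphic_on V" "N holomorphic_on V" unfolding D_def N_def by (auto intro!: holomorphic_intros)
  define W where "W = {t\<in>V. D t \<noteq> 0}"
  have W: "open W"
    using continuous_open_preimage[OF holomorphic_on_imp_continuous_on[OF hD(1)] V(1), of "- {0}"]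
    unfolding W_def by (simp add: vimage_def Int_def open_Compl)
  have xx: "chart_inv (affine_chart i) (snd (affine_chart i) x) = x" using chart_inv_affine affine_chart_back x by simp
  have xW: "snd (affine_chart i) x \<in> W"
    using g G[OF V(2)] V(2) affine_chart_abs(1)[OF nz] D' xx by (auto simp: W_def)
  have H: "local_rep (affine_chart i) (affine_chart k) (\<lambda>y. cp1_act (f y) A) t = N t / D t" if "t \<in> W" for t
    using that G affine_chart_abs(2)[OF nz] D' by (auto simp: W_def local_rep_def)
  have "(\<lambda>t. N t / D t) holomorphic_on W"
    using hD holomorphic_on_subset[of _ V W] by (intro holomorphic_intros) (auto simp: W_def)
  then have "local_rep (affine_chart i) (affine_chart k) (\<lambda>y. cp1_act (f y) A) holomorphic_on W"
    by (rule holomorphic_transform) (simp add: H)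
  then show "\<exists>V. open V \<and> snd (affine_chart i) x \<in> V \<and> V \<subseteq> snd (affine_chart i) ` fst (affine_chart i) \<and>
           (\<forall>t\<in>V. cp1_act (f (chart_inv (affine_chart i) t)) A \<in> fst (affine_chart k)) \<and>
           local_rep (affine_chart i) (affine_chart k) (\<lambda>y. cp1_act (f y) A) holomorphic_on V"
  proof (intro exI[of _ W] conjI ballI)
    fix t assume t: "t \<in> W"
    then have "t \<in> V" "D t \<noteq> 0" by (simp_all add: W_def)
    then show "cp1_act (f (chart_inv (affine_chart i) t)) A \<in> fst (affine_chart k)"
      using G[of t] affine_chart_abs(1)[OF nz[of t], of k] D'(1)[of t] by simp
  qed (simp_all add: W xW affine_chart_surj)
qed

lemma vector_4_nth: "(vector [a,b,c,d] :: complex^4) $ 1 = a" "(vector [a,b,c,d] :: complex^4) $ 2 = b"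
  "(vector [a,b,c,d] :: complex^4) $ 3 = c" "(vector [a,b,c,d] :: complex^4) $ 4 = d"
  by (simp_all add: vector_def)

lemma prolonged_act_coords:
  fixes z w w1 w2 :: complex
  defines "\<kappa> \<equiv> jet_chart (affine_chart 2) (affine_chart 2)"
  assumes A: "A \<in> SL2" and j: "j \<in> fst \<kappa>" and c: "snd \<kappa> j = vector [z, w, w1, w2]"
    and nz: "A $ 1 $ 2 * w + A $ 2 $ 2 \<noteq> 0"
  shows "prolonged_act j A \<in> fst \<kappa>"
    "snd \<kappa> (prolonged_act j A) = vector [z, (A $ 1 $ 1 * w + A $ 2 $ 1) / (A $ 1 $ 2 * w + A $ 2 $ 2),
       w1 / (A $ 1 $ 2 * w + A $ 2 $ 2)\<^sup>2,
       w2 / (A $ 1 $ 2 * w + A $ 2 $ 2)\<^sup>2 - 2 * A $ 1 $ 2 * w1\<^sup>2 / (A $ 1 $ 2 * w + A $ 2 $ 2)^3]"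
proof -
  define x f g where "x = jet_source j" and "f = jet_map j" and "g = (\<lambda>y. cp1_act (f y) A)"
  let ?C = "affine_chart 2"
  have r: "rep_jet2 j = (x, f)" by (simp add: x_def f_def jet_source_def jet_map_def)
  have "same_2jet (x,f) (x,f)" using Quotient3_rep_reflp[OF Quotient3_jet2, of j] r by simp
  then have hf: "holomorphic_near f x" by (simp add: same_2jet_def)
  then have hg: "holomorphic_near g x" unfolding g_def by (rule holomorphic_near_act[OF A])
  have x: "x \<in> fst ?C" "f x \<in> fst ?C" using j by (auto simp: \<kappa>_def jet_chart_def x_def f_def)
  define F where "F = local_rep ?C ?C f"
  have cc: "snd ?C x = z" "snd ?C (f x) = w" "deriv F z = w1" "deriv (deriv F) z = w2"
  proof -
    have e: "(vector [snd ?C x, snd ?C (f x), deriv F (snd ?C x), (deriv ^^ 2) F (snd ?C x)] :: complex^4) = vector [z, w, w1, w2]"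
      using c unfolding \<kappa>_def jet_chart_def snd_conv r germ_coords_def F_def split .
    show 1: "snd ?C x = z" using arg_cong[OF e, of "\<lambda>v. v $ 1"] unfolding vector_4_nth .
    show "snd ?C (f x) = w" using arg_cong[OF e, of "\<lambda>v. v $ 2"] unfolding vector_4_nth .
    show "deriv F z = w1" using arg_cong[OF e, of "\<lambda>v. v $ 3"] unfolding vector_4_nth 1 .
    show "deriv (deriv F) z = w2" using arg_cong[OF e, of "\<lambda>v. v $ 4"] unfolding vector_4_nth 1 numeral_2_eq_2 by simp
  qed
  obtain V where V: "open V" "z \<in> V" 
     "\<forall>t\<in>V. f (chart_inv ?C t) \<in> fst ?C" "F holomorphic_on V"
  proof -
    have m: "?C \<in> cp1_atlas" by (simp add: cp1_atlas_def)
    from hf[unfolded holomorphic_near_def, rule_format, OF m m, OF conjI, OF x]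
    have "\<exists>V. open V \<and> z \<in> V \<and> (\<forall>t\<in>V. f (chart_inv ?C t) \<in> fst ?C) \<and> F holomorphic_on V"
      unfolding cc(1) F_def by (elim ex_forward) simp
    then show ?thesis by (elim exE conjE) (rule that)
  qed
  have F: "f (chart_inv ?C t) = abs_cp1 (affine_vec 2 (F t))" if "t \<in> V" for t
    using affine_chart_back[OF V(3)[rule_format, OF that]] by (simp add: F_def local_rep_def)
  have zi: "chart_inv ?C z = x" using chart_inv_affine[of 2 z] affine_chart_back[OF x(1)] cc(1) by simp
  have Fz: "F z = w" by (simp add: F_def local_rep_def zi cc(2))
  define D where "D = (\<lambda>t. A $ 1 $ 2 * F t + A $ 2 $ 2)"
  define N where "N = (\<lambda>t. A $ 1 $ 1 * F t + A $ 2 $ 1)"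
  have n2: "affine_vec 2 (F t) v* A \<noteq> 0" for t using cp1_act_abs[OF A affine_vec_simps(3)] by simp
  have two: "(2::2) + 1 = 1" by simp
  have DN: "(affine_vec 2 (F t) v* A) $ 2 = D t" "(affine_vec 2 (F t) v* A) $ 1 = N t" for t
    using affine_vec_simps[of 2 "F t"] unfolding vector_matrix_mult_2[of _ _ _ 2] two by (auto simp: D_def N_def)
  have G: "g (chart_inv ?C t) = abs_cp1 (affine_vec 2 (F t) v* A)" if "t \<in> V" for t
    using F[OF that] cp1_act_abs[OF A affine_vec_simps(3)] by (simp add: g_def)
  have Dz: "D z \<noteq> 0" using nz by (simp add: D_def Fz)
  have gx: "g x \<in> fst ?C" using G[OF V(2)] zi affine_chart_abs(1)[OF n2] DN Dz by simp
  have H: "local_rep ?C ?C g t = N t / D t" if "t \<in> V" for t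
    using that G affine_chart_abs(2)[OF n2, of 2, unfolded two] DN by (simp add: local_rep_def)
  define W where "W = {t\<in>V. D t \<noteq> 0}"
  have hD: "D holomorphic_on V" unfolding D_def using V(4) by (auto intro!: holomorphic_intros)
  have W: "open W" "z \<in> W" "W \<subseteq> V"
    using continuous_open_preimage[OF holomorphic_on_imp_continuous_on[OF hD] V(1), of "- {0}"] V Dz
    unfolding W_def by (auto simp add: vimage_def Int_def open_Compl)
  have det: "A$1$1 * A$2$2 - A$1$2 * A$2$1 = 1" using A by (simp add: SL2_def det_2)
  have d1: "(F has_field_derivative deriv F t) (at t)" if "t \<in> V" for t
    using V that holomorphic_derivI by blast
  have d2: "(deriv F has_field_derivative deriv (deriv F) t) (at t)" if "t \<in> V" for t
  proof -
    have "deriv F holomorphic_on V" by (rule holomorphic_deriv[OF V(4,1)])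
    then show ?thesis using holomorphic_derivI[OF _ V(1) that] by blast
  qed
  have e1: "deriv (local_rep ?C ?C g) t = deriv F t / (D t)\<^sup>2" if "t \<in> W" for t
  proof -
    have t: "t \<in> V" "D t \<noteq> 0" using that by (auto simp: W_def)
    have "((\<lambda>t. N t / D t) has_field_derivative (A$1$1 * deriv F t * D t - N t * (A$1$2 * deriv F t)) / (D t * D t)) (at t)"
      using t unfolding N_def D_def by (auto intro!: derivative_eq_intros d1)
    moreover have "A$1$1 * deriv F t * D t - N t * (A$1$2 * deriv F t) = deriv F t * (A$1$1 * A$2$2 - A$1$2 * A$2$1)"
      by (simp add: D_def N_def algebra_simps)
    ultimately have "((\<lambda>t. N t / D t) has_field_derivative deriv F t / (D t)\<^sup>2) (at t)"
      by (simp add: det power2_eq_square)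
    then have "(local_rep ?C ?C g has_field_derivative deriv F t / (D t)\<^sup>2) (at t)"
      by (rule has_field_derivative_transform_within_open[OF _ V(1) t(1)]) (simp add: H)
    then show ?thesis by (rule DERIV_imp_deriv)
  qed
  have "((\<lambda>t. deriv F t / (D t)\<^sup>2) has_field_derivative
     (deriv (deriv F) z * (D z)\<^sup>2 - deriv F z * (2 * D z * (A$1$2 * deriv F z))) / ((D z)\<^sup>2 * (D z)\<^sup>2)) (at z)"
    using Dz unfolding D_def by (auto intro!: derivative_eq_intros d1 d2 V(2))
  then have "(deriv (local_rep ?C ?C g) has_field_derivative
     (deriv (deriv F) z * (D z)\<^sup>2 - deriv F z * (2 * D z * (A$1$2 * deriv F z))) / ((D z)\<^sup>2 * (D z)\<^sup>2)) (at z)"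
    by (rule has_field_derivative_transform_within_open[OF _ W(1,2)]) (simp add: e1)
  then have e2: "deriv (deriv (local_rep ?C ?C g)) z = w2 / (D z)\<^sup>2 - 2 * A $ 1 $ 2 * w1\<^sup>2 / (D z)^3"
    using Dz by (simp add: DERIV_imp_deriv cc field_simps power2_eq_square power3_eq_cube)
  have s: "same_2jet (x,g) (x,g)" using hg by (simp add: same_2jet_def)
  have "same_2jet (rep_jet2 (abs_jet2 (x,g))) (x,g)"
    by (rule Quotient3_rep_abs[OF Quotient3_jet2 s])
  moreover have "prolonged_act j A = abs_jet2 (x,g)"
    by (simp add: prolonged_act_def jet_of_def x_def f_def g_def)
  ultimately obtain h where h: "rep_jet2 (prolonged_act j A) = (x, h)" "same_2jet (x,h) (x,g)"
    by (cases "rep_jet2 (prolonged_act j A)") (auto simp: same_2jet_def)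
  have hx: "h x = g x" and hc: "germ_coords ?C ?C (x,h) = germ_coords ?C ?C (x,g)"
    using h(2) x gx by (auto simp: same_2jet_def cp1_atlas_def)
  show "prolonged_act j A \<in> fst \<kappa>"
    using h hx gx x by (simp add: \<kappa>_def jet_chart_def jet_source_def jet_map_def)
  have "snd ?C (g x) = N z / D z" using H[OF V(2)] zi by (simp add: local_rep_def)
  then show "snd \<kappa> (prolonged_act j A) = vector [z, (A $ 1 $ 1 * w + A $ 2 $ 1) / (A $ 1 $ 2 * w + A $ 2 $ 2),
       w1 / (A $ 1 $ 2 * w + A $ 2 $ 2)\<^sup>2,
       w2 / (A $ 1 $ 2 * w + A $ 2 $ 2)\<^sup>2 - 2 * A $ 1 $ 2 * w1\<^sup>2 / (A $ 1 $ 2 * w + A $ 2 $ 2)^3]"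
    using e1[OF W(2)] e2 cc h hc
    by (simp add: \<kappa>_def jet_chart_def germ_coords_def numeral_2_eq_2 D_def N_def Fz)
qed

end

theory Submission
  imports Defs
begin

text \<open>Write \<open>v = (p, q)\<close>. The three generators of the system are combinations of the two entries of the row
  \<open>v A\<^sup>-\<^sup>1 dA\<close>, and these entries span the fibre for every \<open>[p, q]\<close>. In affine coordinates the map \<open>Psi\<close>
  is \<open>(z, w, w\<^sub>z, w\<^sub>z\<^sub>z) = ((t a - b) / s, t, \<plusminus>s\<^sup>2, - 2 c s\<^sup>3)\<close> with \<open>s = d - t c\<close>, for suitably permuted
  entries \<open>a, b, c, d\<close> of \<open>A\<close>. It is inverted by choosing a square root \<open>s\<close> of \<open>\<plusminus>w\<^sub>z\<close>, so it is locally
  biholomorphic and two-to-one onto the jets of immersions. The contact forms pull back to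
  \<open>\<phi>' - t \<phi>\<close> and \<open>- 2 w\<^sub>z \<phi>\<close>, where \<open>\<phi>, \<phi>'\<close> are the entries of \<open>v A\<^sup>-\<^sup>1 dA\<close> for \<open>v = (1, t)\<close>. As \<open>w\<^sub>z\<close>
  has no zeros, both pairs generate the same module of holomorphic forms, even over open sets on which
  \<open>Psi\<close> is not injective.\<close>

section \<open>Complex gradients\<close>

text \<open>\<open>Psi (A, x)\<close> is the 2-jet, at \<open>x A\<^sup>-\<^sup>1\<close>, of the
  Moebius map \<open>y \<mapsto> y A\<close>. Each 2-jet of an immersion is osculated by exactly one
  Moebius map, and that map determines \<open>A\<close> up to sign; hence the square root of
  \<open>w\<^sub>z\<close>. The contact forms vanish along a curve of such jets when the variation
  of the Moebius map vanishes to second order at the moving source, that is, when the vector field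
  of \<open>X = A\<^sup>-\<^sup>1 A'\<close> has a double zero at the target \<open>[p, q]\<close>.
  For trace-free \<open>X\<close> this says \<open>v X = 0\<close>, which is where the row
  \<open>v A\<^sup>-\<^sup>1 dA\<close> comes from.

  Comparing ideals over arbitrary open sets requires holomorphic coefficients, not just equality of
  fibres. They are obtained by pairing with left-invariant tangent vectors that are dual to the two
  row entries.

  In the index type \<open>2\<close> the term \<open>i + 1\<close> is the other index, so one
  computation covers all pairs of affine charts; the sign \<open>eps\<close> records which pair it
  is.\<close>

definition has_cgradient :: "(complex^'n \<Rightarrow> complex) \<Rightarrow> complex^'n \<Rightarrow> complex^'n \<Rightarrow> bool" where
  "has_cgradient f g x \<longleftrightarrow> (f has_derivative (\<lambda>h. \<Sum>i\<in>UNIV. g $ i * h $ i)) (at x)"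

lemma cgradient_eq:
  fixes f :: "complex^'n \<Rightarrow> complex"
  assumes "has_cgradient f g x" shows "cgradient f x = g"
proof -
  have "frechet_derivative f (at x) = (\<lambda>h. \<Sum>i\<in>UNIV. g $ i * h $ i)"
    using frechet_derivative_at assms unfolding has_cgradient_def by metis
  then show ?thesis by (simp add: cgradient_def vec_eq_iff axis_def if_distrib[of "\<lambda>a. _ * a"] cong: if_cong)
qed

lemma holomorphic_fun_on_iff: "holomorphic_fun_on f S \<longleftrightarrow> (\<forall>x\<in>S. has_cgradient f (cgradient f x) x)"
  unfolding holomorphic_fun_on_def has_cgradient_def[symmetric] by (auto simp: cgradient_eq)

lemma holomorphic_fun_onI: "(\<And>x. x \<in> S \<Longrightarrow> \<exists>g. has_cgradient f g x) \<Longrightarrow> holomorphic_fun_on f S"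
  unfolding holomorphic_fun_on_def has_cgradient_def by blast

lemma holomorphic_fun_onD: "holomorphic_fun_on f S \<Longrightarrow> x \<in> S \<Longrightarrow> has_cgradient f (cgradient f x) x"
  by (simp add: holomorphic_fun_on_iff)

lemma has_cgradient_const: "has_cgradient (\<lambda>x. c) 0 x"
  by (simp add: has_cgradient_def)

lemma has_cgradient_nth: "has_cgradient (\<lambda>x. x $ i) (axis i 1) x"
  unfolding has_cgradient_def
  by (rule has_derivative_eq_rhs[OF bounded_linear.has_derivative[OF bounded_linear_vec_nth has_derivative_ident]])
    (simp add: axis_def if_distrib[of "\<lambda>a. a * _"] cong: if_cong)

lemma has_cgradient_add:
  "has_cgradient f f' x \<Longrightarrow> has_cgradient g g' x \<Longrightarrow> has_cgradient (\<lambda>x. f x + g x) (f' + g') x"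
  unfolding has_cgradient_def
  by (drule (1) has_derivative_add) (simp add: sum.distrib algebra_simps)

lemma has_cgradient_mult:
  "has_cgradient f f' x \<Longrightarrow> has_cgradient g g' x \<Longrightarrow>
    has_cgradient (\<lambda>x. f x * g x) (f x *s g' + g x *s f') x"
  unfolding has_cgradient_def
  by (drule (1) has_derivative_mult) (simp add: sum.distrib sum_distrib_left sum_distrib_right algebra_simps)

lemma has_cgradient_chain1:
  assumes "has_cgradient f g x" "(\<phi> has_field_derivative d) (at (f x))"
  shows "has_cgradient (\<lambda>x. \<phi> (f x)) (d *s g) x"
  using has_derivative_compose[OF assms(1)[unfolded has_cgradient_def] assms(2)[unfolded has_field_derivative_def]]
  unfolding has_cgradient_def by (simp add: sum_distrib_left mult.assoc)

lemma has_cgradient_scale: "has_cgradient f g x \<Longrightarrow> has_cgradient (\<lambda>x. c * f x) (c *s g) x"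
  using has_cgradient_mult[OF has_cgradient_const] by fastforce

lemma has_cgradient_minus: "has_cgradient f g x \<Longrightarrow> has_cgradient (\<lambda>x. - f x) (- g) x"
  unfolding has_cgradient_def by (drule has_derivative_minus) (simp add: sum_negf)

lemma has_cgradient_diff:
  "has_cgradient f f' x \<Longrightarrow> has_cgradient g g' x \<Longrightarrow> has_cgradient (\<lambda>x. f x - g x) (f' - g') x"
  using has_cgradient_add[OF _ has_cgradient_minus] by fastforce

lemma has_cgradient_inverse:
  "has_cgradient f g x \<Longrightarrow> f x \<noteq> 0 \<Longrightarrow> has_cgradient (\<lambda>x. inverse (f x)) (- (inverse (f x))\<^sup>2 *s g) x"
  by (rule has_cgradient_chain1) (auto intro!: derivative_eq_intros simp: power2_eq_square)

lemma has_cgradient_divide: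
  assumes "has_cgradient f f' x" "has_cgradient g g' x" "g x \<noteq> 0"
  shows "has_cgradient (\<lambda>x. f x / g x) ((1 / g x) *s f' - (f x / (g x)\<^sup>2) *s g') x"
  using has_cgradient_mult[OF assms(1) has_cgradient_inverse[OF assms(2,3)]]
  by (simp add: divide_inverse algebra_simps power2_eq_square vec.scale_minus_left)

lemma has_cgradient_power:
  "has_cgradient f g x \<Longrightarrow> has_cgradient (\<lambda>x. f x ^ n) ((of_nat n * f x ^ (n - 1)) *s g) x"
  by (rule has_cgradient_chain1) (auto intro!: derivative_eq_intros)

lemma has_derivative_vec:
  fixes F :: "complex^'n \<Rightarrow> complex^'m"
  assumes "\<And>i. ((\<lambda>x. F x $ i) has_derivative (\<lambda>h. D h $ i)) (at x)"
  shows "(F has_derivative D) (at x)"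
proof (subst has_derivative_componentwise_within, rule ballI)
  fix b :: "complex^'m" assume "b \<in> Basis"
  then obtain i c where "b = axis i c" by (auto simp: Basis_vec_def)
  then show "((\<lambda>x. F x \<bullet> b) has_derivative (\<lambda>h. D h \<bullet> b)) (at x)"
    using bounded_linear.has_derivative[OF bounded_linear_inner_left assms[of i], of c]
    by (simp add: inner_axis)
qed

text \<open>Gradients are rows, so the chain rule multiplies by the Jacobian on the right. The same
  product is the pull-back of a covector in \<open>pullback_system\<close> and
  \<open>holomorphic_subbundle\<close>.\<close>

lemma has_cgradient_compose:
  fixes F :: "complex^'n \<Rightarrow> complex^'m"
  assumes F: "\<And>i. has_cgradient (\<lambda>x. F x $ i) (J $ i) x" and f: "has_cgradient f g (F x)"
  shows "has_cgradient (\<lambda>x. f (F x)) (g v* J) x"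
proof -
  have "(F has_derivative (\<lambda>h. \<chi> i. \<Sum>j\<in>UNIV. J $ i $ j * h $ j)) (at x)"
    by (rule has_derivative_vec) (use F in \<open>simp add: has_cgradient_def\<close>)
  from has_derivative_compose[OF this f[unfolded has_cgradient_def]] show ?thesis
    unfolding has_cgradient_def
    by (rule has_derivative_eq_rhs)
      (simp add: fun_eq_iff vector_matrix_mult_def sum_distrib_left sum_distrib_right,
       subst sum.swap, simp add: mult.assoc)
qed

lemma has_cgradient_transform:
  assumes "has_cgradient f g x" "open S" "x \<in> S" "\<And>y. y \<in> S \<Longrightarrow> f y = f' y"
  shows "has_cgradient f' g x"
  using assms has_derivative_transform_within_open unfolding has_cgradient_def by blast

section \<open>Closure properties of holomorphic functions and maps\<close>

lemma holomorphic_fun_on_const: "holomorphic_fun_on (\<lambda>x. c) S"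
  by (blast intro: holomorphic_fun_onI has_cgradient_const)

lemma holomorphic_fun_on_nth: "holomorphic_fun_on (\<lambda>x. x $ i) S"
  by (blast intro: holomorphic_fun_onI has_cgradient_nth)

lemma holomorphic_fun_on_add:
  "holomorphic_fun_on f S \<Longrightarrow> holomorphic_fun_on g S \<Longrightarrow> holomorphic_fun_on (\<lambda>x. f x + g x) S"
  by (rule holomorphic_fun_onI) (blast dest: holomorphic_fun_onD has_cgradient_add)

lemma holomorphic_fun_on_diff:
  "holomorphic_fun_on f S \<Longrightarrow> holomorphic_fun_on g S \<Longrightarrow> holomorphic_fun_on (\<lambda>x. f x - g x) S"
  by (rule holomorphic_fun_onI) (blast dest: holomorphic_fun_onD has_cgradient_diff)

lemma holomorphic_fun_on_minus: "holomorphic_fun_on f S \<Longrightarrow> holomorphic_fun_on (\<lambda>x. - f x) S"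
  by (rule holomorphic_fun_onI) (blast dest: holomorphic_fun_onD has_cgradient_minus)

lemma holomorphic_fun_on_mult:
  "holomorphic_fun_on f S \<Longrightarrow> holomorphic_fun_on g S \<Longrightarrow> holomorphic_fun_on (\<lambda>x. f x * g x) S"
  by (rule holomorphic_fun_onI) (blast dest: holomorphic_fun_onD has_cgradient_mult)

lemma holomorphic_fun_on_divide:
  "holomorphic_fun_on f S \<Longrightarrow> holomorphic_fun_on g S \<Longrightarrow> (\<And>x. x \<in> S \<Longrightarrow> g x \<noteq> 0) \<Longrightarrow>
    holomorphic_fun_on (\<lambda>x. f x / g x) S"
  by (rule holomorphic_fun_onI) (blast dest: holomorphic_fun_onD has_cgradient_divide)

lemma holomorphic_fun_on_power: "holomorphic_fun_on f S \<Longrightarrow> holomorphic_fun_on (\<lambda>x. f x ^ n) S"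
  by (rule holomorphic_fun_onI) (blast dest: holomorphic_fun_onD has_cgradient_power)

lemma holomorphic_fun_on_sum:
  "(\<And>i. i \<in> I \<Longrightarrow> holomorphic_fun_on (f i) S) \<Longrightarrow> holomorphic_fun_on (\<lambda>x. \<Sum>i\<in>I. f i x) S"
  by (induction I rule: infinite_finite_induct) (auto intro: holomorphic_fun_on_const holomorphic_fun_on_add)

lemmas holomorphic_fun_intros = holomorphic_fun_on_const holomorphic_fun_on_nth holomorphic_fun_on_add
  holomorphic_fun_on_diff holomorphic_fun_on_minus holomorphic_fun_on_mult holomorphic_fun_on_divide
  holomorphic_fun_on_power holomorphic_fun_on_sum

lemma holomorphic_fun_on_subset: "holomorphic_fun_on f S \<Longrightarrow> T \<subseteq> S \<Longrightarrow> holomorphic_fun_on f T"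
  by (auto simp: holomorphic_fun_on_def)

lemma holomorphic_map_on_subset: "holomorphic_map_on f S \<Longrightarrow> T \<subseteq> S \<Longrightarrow> holomorphic_map_on f T"
  unfolding holomorphic_map_on_def by (blast intro: holomorphic_fun_on_subset)

lemma holomorphic_map_on_cjacobian:
  "holomorphic_map_on F S \<Longrightarrow> x \<in> S \<Longrightarrow> has_cgradient (\<lambda>y. F y $ i) (cjacobian F x $ i) x"
  by (simp add: holomorphic_map_on_def holomorphic_fun_on_iff cjacobian_def)

lemma holomorphic_fun_on_transform:
  "holomorphic_fun_on f S \<Longrightarrow> open S \<Longrightarrow> (\<And>y. y \<in> S \<Longrightarrow> f y = f' y) \<Longrightarrow> holomorphic_fun_on f' S"
  by (rule holomorphic_fun_onI) (metis holomorphic_fun_onD has_cgradient_transform)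

lemma holomorphic_map_on_transform:
  assumes "holomorphic_map_on f S" "open S" "\<And>y. y \<in> S \<Longrightarrow> f y = f' y"
  shows "holomorphic_map_on f' S"
  unfolding holomorphic_map_on_def
proof
  fix i show "holomorphic_fun_on (\<lambda>x. f' x $ i) S"
    by (rule holomorphic_fun_on_transform[where f = "\<lambda>x. f x $ i"])
      (use assms in \<open>auto simp: holomorphic_map_on_def\<close>)
qed

lemma holomorphic_fun_on_compose:
  assumes "holomorphic_map_on F S" "holomorphic_fun_on f T" "F ` S \<subseteq> T"
  shows "holomorphic_fun_on (\<lambda>x. f (F x)) S"
proof (rule holomorphic_fun_onI)
  fix x assume x: "x \<in> S"
  show "\<exists>g. has_cgradient (\<lambda>x. f (F x)) g x"
    using has_cgradient_compose[OF holomorphic_map_on_cjacobian[OF assms(1) x] holomorphic_fun_onD[OF assms(2)]]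
      x assms(3) by blast
qed

lemma holomorphic_map_on_compose:
  assumes "holomorphic_map_on F S" "holomorphic_map_on G T" "F ` S \<subseteq> T"
  shows "holomorphic_map_on (\<lambda>x. G (F x)) S"
  using assms holomorphic_fun_on_compose unfolding holomorphic_map_on_def[of "\<lambda>x. G (F x)"] holomorphic_map_on_def[of G]
  by blast

lemma holomorphic_fun_on_imp_continuous_on: "holomorphic_fun_on f S \<Longrightarrow> continuous_on S f"
  unfolding holomorphic_fun_on_def
  by (meson continuous_at_imp_continuous_on has_derivative_continuous)

lemma holomorphic_map_on_imp_continuous_on:
  fixes F :: "complex^'n \<Rightarrow> complex^'m"
  assumes "holomorphic_map_on F S" shows "continuous_on S F"
proof -
  have "continuous_on S (\<lambda>x. \<chi> i. F x $ i)"
    using assms by (intro continuous_on_vec_lambda holomorphic_fun_on_imp_continuous_on) (simp add: holomorphic_map_on_def)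
  then show ?thesis by simp
qed

lemma cjacobian_eq:
  assumes "\<And>i. has_cgradient (\<lambda>y. F y $ i) (J $ i) x" shows "cjacobian F x = J"
proof -
  have "cgradient (\<lambda>y. F y $ i) x = J $ i" for i by (rule cgradient_eq[OF assms])
  then show ?thesis by (simp add: cjacobian_def)
qed

section \<open>Charts\<close>

lemma chart_inv_left: "inj_on (snd \<kappa>) (fst \<kappa>) \<Longrightarrow> x \<in> fst \<kappa> \<Longrightarrow> chart_inv \<kappa> (snd \<kappa> x) = x"
  by (simp add: chart_inv_def)

lemma chart_inv_right: "u \<in> snd \<kappa> ` fst \<kappa> \<Longrightarrow> snd \<kappa> (chart_inv \<kappa> u) = u"
  by (simp add: chart_inv_def f_inv_into_f)

lemma chart_inv_in: "u \<in> snd \<kappa> ` fst \<kappa> \<Longrightarrow> chart_inv \<kappa> u \<in> fst \<kappa>"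
  by (simp add: chart_inv_def inv_into_into)

lemma chart_image_iff:
  assumes "inj_on (snd \<kappa>) (fst \<kappa>)"
  shows "u \<in> snd \<kappa> ` (M \<inter> fst \<kappa>) \<longleftrightarrow> u \<in> snd \<kappa> ` fst \<kappa> \<and> chart_inv \<kappa> u \<in> M"
  using chart_inv_left[OF assms] chart_inv_right[of u \<kappa>] chart_inv_in[of u \<kappa>] by force

lemma open_inter_vimage:
  assumes "open S" "continuous_on S f" "open U" shows "open {x \<in> S. f x \<in> U}"
  using continuous_open_preimage[OF assms(2,1,3)] by (simp add: vimage_def Int_def)

text \<open>The Hausdorff property is delegated to a map \<open>f\<close> into a Hausdorff space.
  Points with different images are separated by preimages of open sets; points with the same image
  lie in a common chart, where their coordinates separate them.\<close>

lemma complex_manifoldI: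
  fixes \<A> :: "('m, complex^'n) chart set" and f :: "'m \<Rightarrow> 'b::t2_space"
  assumes c: "countable \<A>"
    and inj: "\<And>\<kappa>. \<kappa> \<in> \<A> \<Longrightarrow> inj_on (snd \<kappa>) (fst \<kappa>)"
    and op: "\<And>\<kappa> \<kappa>'. \<kappa> \<in> \<A> \<Longrightarrow> \<kappa>' \<in> \<A> \<Longrightarrow> open (snd \<kappa> ` (fst \<kappa> \<inter> fst \<kappa>'))"
    and hol: "\<And>\<kappa> \<kappa>'. \<kappa> \<in> \<A> \<Longrightarrow> \<kappa>' \<in> \<A> \<Longrightarrow>
        holomorphic_map_on (local_rep \<kappa> \<kappa>' id) (snd \<kappa> ` (fst \<kappa> \<inter> fst \<kappa>'))"
    and f: "\<And>\<kappa>. \<kappa> \<in> \<A> \<Longrightarrow> continuous_on (snd \<kappa> ` fst \<kappa>) (\<lambda>u. f (chart_inv \<kappa> u))"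
    and sep: "\<And>x y. x \<in> carrier_of \<A> \<Longrightarrow> y \<in> carrier_of \<A> \<Longrightarrow> f x = f y \<Longrightarrow>
        \<exists>\<kappa>\<in>\<A>. x \<in> fst \<kappa> \<and> y \<in> fst \<kappa>"
  shows "complex_manifold \<A>"
proof -
  have opf: "open (snd \<kappa> ` fst \<kappa>)" if "\<kappa> \<in> \<A>" for \<kappa> using op[OF that that] by simp
  have "\<exists>M N. open_in \<A> M \<and> open_in \<A> N \<and> x \<in> M \<and> y \<in> N \<and> M \<inter> N = {}"
    if xy: "x \<in> carrier_of \<A>" "y \<in> carrier_of \<A>" "x \<noteq> y" for x y
  proof (cases "f x = f y")
    case False
    then obtain U V where UV: "open U" "open V" "f x \<in> U" "f y \<in> V" "U \<inter> V = {}" by (meson hausdorff)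
    have "open_in \<A> {x \<in> carrier_of \<A>. f x \<in> U}" if "open U" for U
      unfolding open_in_def
    proof (intro conjI ballI)
      fix \<kappa> assume k: "\<kappa> \<in> \<A>"
      have "{x \<in> carrier_of \<A>. f x \<in> U} \<inter> fst \<kappa> = {x. f x \<in> U} \<inter> fst \<kappa>"
        using k by (auto simp: carrier_of_def)
      then have "snd \<kappa> ` ({x \<in> carrier_of \<A>. f x \<in> U} \<inter> fst \<kappa>) = {u \<in> snd \<kappa> ` fst \<kappa>. f (chart_inv \<kappa> u) \<in> U}"
        by (simp only:) (simp add: set_eq_iff chart_image_iff[OF inj[OF k]])
      then show "open (snd \<kappa> ` ({x \<in> carrier_of \<A>. f x \<in> U} \<inter> fst \<kappa>))"
        using open_inter_vimage[OF opf[OF k] f[OF k] that] by simp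
    qed auto
    then show ?thesis using UV xy
      by (intro exI[of _ "{x \<in> carrier_of \<A>. f x \<in> U}"] exI[of _ "{x \<in> carrier_of \<A>. f x \<in> V}"]) auto
  next
    case True
    then obtain \<kappa> where k: "\<kappa> \<in> \<A>" "x \<in> fst \<kappa>" "y \<in> fst \<kappa>" using sep xy by blast
    then have "snd \<kappa> x \<noteq> snd \<kappa> y" using inj[OF k(1)] xy(3) by (auto dest: inj_onD)
    then obtain U V where UV: "open U" "open V" "snd \<kappa> x \<in> U" "snd \<kappa> y \<in> V" "U \<inter> V = {}" by (meson hausdorff)
    have "open_in \<A> {x \<in> fst \<kappa>. snd \<kappa> x \<in> U}" if "open U" for U
      unfolding open_in_def
    proof (intro conjI ballI)
      fix \<kappa>' assume k': "\<kappa>' \<in> \<A>"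
      have "snd \<kappa>' ` ({x \<in> fst \<kappa>. snd \<kappa> x \<in> U} \<inter> fst \<kappa>')
          = {u \<in> snd \<kappa>' ` (fst \<kappa>' \<inter> fst \<kappa>). local_rep \<kappa>' \<kappa> id u \<in> U}"
        by (force simp: local_rep_def chart_inv_left[OF inj[OF k']])
      then show "open (snd \<kappa>' ` ({x \<in> fst \<kappa>. snd \<kappa> x \<in> U} \<inter> fst \<kappa>'))"
        using open_inter_vimage[OF op[OF k' k(1)] holomorphic_map_on_imp_continuous_on[OF hol[OF k' k(1)]] that]
        by simp
    qed (use k in \<open>auto simp: carrier_of_def\<close>)
    then show ?thesis using UV k
      by (intro exI[of _ "{x \<in> fst \<kappa>. snd \<kappa> x \<in> U}"] exI[of _ "{x \<in> fst \<kappa>. snd \<kappa> x \<in> V}"]) auto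
  qed
  then show ?thesis
    unfolding complex_manifold_def using c by (intro conjI ballI impI exI[of _ \<A>] inj op hol) simp_all
qed

lemma complex_manifoldD:
  assumes "complex_manifold \<A>"
  shows "\<kappa> \<in> \<A> \<Longrightarrow> inj_on (snd \<kappa>) (fst \<kappa>)"
    and "\<kappa> \<in> \<A> \<Longrightarrow> \<kappa>' \<in> \<A> \<Longrightarrow> open (snd \<kappa> ` (fst \<kappa> \<inter> fst \<kappa>'))"
    and "\<kappa> \<in> \<A> \<Longrightarrow> \<kappa>' \<in> \<A> \<Longrightarrow> holomorphic_map_on (local_rep \<kappa> \<kappa>' id) (snd \<kappa> ` (fst \<kappa> \<inter> fst \<kappa>'))"
    and "\<kappa> \<in> \<A> \<Longrightarrow> open (snd \<kappa> ` fst \<kappa>)"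
proof -
  show 1: "\<kappa> \<in> \<A> \<Longrightarrow> \<kappa>' \<in> \<A> \<Longrightarrow> open (snd \<kappa> ` (fst \<kappa> \<inter> fst \<kappa>'))" for \<kappa> \<kappa>'
    using assms by (simp add: complex_manifold_def)
  show "\<kappa> \<in> \<A> \<Longrightarrow> open (snd \<kappa> ` fst \<kappa>)" using 1[of \<kappa> \<kappa>] by simp
qed (use assms in \<open>simp_all add: complex_manifold_def\<close>)

lemma open_in_chart:
  assumes A: "complex_manifold \<A>" and k: "\<kappa> \<in> \<A>" and M: "M \<subseteq> fst \<kappa>" "open (snd \<kappa> ` M)"
  shows "open_in \<A> M"
  unfolding open_in_def
proof (intro conjI ballI)
  note inj = complex_manifoldD(1)[OF A]
  fix \<kappa>' assume k': "\<kappa>' \<in> \<A>"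
  have "snd \<kappa>' ` (M \<inter> fst \<kappa>') = {u \<in> snd \<kappa>' ` (fst \<kappa>' \<inter> fst \<kappa>). local_rep \<kappa>' \<kappa> id u \<in> snd \<kappa> ` M}"
  proof (intro set_eqI iffI)
    fix u assume "u \<in> {u \<in> snd \<kappa>' ` (fst \<kappa>' \<inter> fst \<kappa>). local_rep \<kappa>' \<kappa> id u \<in> snd \<kappa> ` M}"
    then obtain x y where xy: "u = snd \<kappa>' x" "x \<in> fst \<kappa>'" "x \<in> fst \<kappa>" "local_rep \<kappa>' \<kappa> id u = snd \<kappa> y" "y \<in> M" by blast
    then have "snd \<kappa> x = snd \<kappa> y" by (simp add: local_rep_def chart_inv_left[OF inj[OF k']])
    then have "x = y" using inj[OF k] xy M(1) by (auto dest: inj_onD)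
    then show "u \<in> snd \<kappa>' ` (M \<inter> fst \<kappa>')" using xy by blast
  qed (use M in \<open>auto simp: local_rep_def chart_inv_left[OF inj[OF k']]\<close>)
  then show "open (snd \<kappa>' ` (M \<inter> fst \<kappa>'))"
    using open_inter_vimage[OF complex_manifoldD(2)[OF A k' k]
        holomorphic_map_on_imp_continuous_on[OF complex_manifoldD(3)[OF A k' k]] M(2)]
    by simp
qed (use k M in \<open>auto simp: carrier_of_def\<close>)

text \<open>The definition of holomorphy quantifies over all pairs of charts at a point. One pair is
  enough, because any other local expression is the given one composed with holomorphic transition
  maps on both sides.\<close>

lemma manifold_holomorphic_onI:
  fixes \<A> :: "('m, complex^'n) chart set" and \<B> :: "('k, complex^'l) chart set"
  assumes A: "complex_manifold \<A>" and B: "complex_manifold \<B>"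
    and F: "\<And>x. x \<in> M \<Longrightarrow> \<exists>\<kappa>\<in>\<A>. \<exists>\<kappa>'\<in>\<B>. \<exists>V. x \<in> fst \<kappa> \<and> open V \<and> snd \<kappa> x \<in> V \<and> V \<subseteq> snd \<kappa> ` fst \<kappa> \<and>
        (\<forall>u\<in>V. F (chart_inv \<kappa> u) \<in> fst \<kappa>') \<and> holomorphic_map_on (local_rep \<kappa> \<kappa>' F) V"
  shows "manifold_holomorphic_on \<A> \<B> F M"
  unfolding manifold_holomorphic_on_def
proof (intro ballI impI)
  note inj = complex_manifoldD(1)[OF A] and inj' = complex_manifoldD(1)[OF B]
  fix x \<kappa>1 \<kappa>1' assume x: "x \<in> M" and k1: "\<kappa>1 \<in> \<A>" "\<kappa>1' \<in> \<B>" and x1: "x \<in> fst \<kappa>1 \<and> F x \<in> fst \<kappa>1'"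
  obtain \<kappa> \<kappa>' V where k: "\<kappa> \<in> \<A>" "\<kappa>' \<in> \<B>" and xk: "x \<in> fst \<kappa>" and V: "open V" "snd \<kappa> x \<in> V" "V \<subseteq> snd \<kappa> ` fst \<kappa>"
    and FV: "\<And>u. u \<in> V \<Longrightarrow> F (chart_inv \<kappa> u) \<in> fst \<kappa>'" and hol: "holomorphic_map_on (local_rep \<kappa> \<kappa>' F) V"
    using F[OF x] by blast
  define \<sigma> where "\<sigma> = local_rep \<kappa>1 \<kappa> id"
  define G where "G = local_rep \<kappa> \<kappa>' F"
  define \<tau> where "\<tau> = local_rep \<kappa>' \<kappa>1' id"
  define S where "S = snd \<kappa>1 ` (fst \<kappa>1 \<inter> fst \<kappa>)"
  define T where "T = snd \<kappa>' ` (fst \<kappa>' \<inter> fst \<kappa>1')"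
  have \<sigma>: "holomorphic_map_on \<sigma> S" "open S"
    unfolding \<sigma>_def S_def using complex_manifoldD(2,3)[OF A k1(1) k(1)] by auto
  have \<tau>: "holomorphic_map_on \<tau> T" "open T"
    unfolding \<tau>_def T_def using complex_manifoldD(2,3)[OF B k(2) k1(2)] by auto
  \<comment> \<open>The neighbourhood is shrunk twice: \<open>V'\<close> keeps the values in the
    domain of the target transition \<open>\<tau>\<close>, and \<open>W\<close> below keeps the
    source transition \<open>\<sigma>\<close> inside \<open>V'\<close>.\<close>
  define V' where "V' = {v \<in> V. G v \<in> T}"
  have V': "open V'" unfolding V'_def
    by (rule open_inter_vimage[OF V(1) holomorphic_map_on_imp_continuous_on[OF hol[folded G_def]] \<tau>(2)])
  define W where "W = {u \<in> S. \<sigma> u \<in> V'}"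
  have W: "open W" unfolding W_def
    by (rule open_inter_vimage[OF \<sigma>(2) holomorphic_map_on_imp_continuous_on[OF \<sigma>(1)] V'])
  have inv: "chart_inv \<kappa> (\<sigma> u) = chart_inv \<kappa>1 u" if "u \<in> S" for u
    using that by (auto simp: S_def \<sigma>_def local_rep_def chart_inv_left[OF inj] k k1)
  have inv': "F (chart_inv \<kappa> v) \<in> fst \<kappa>1'" "\<tau> (G v) = snd \<kappa>1' (F (chart_inv \<kappa> v))" if "v \<in> V'" for v
  proof -
    have v: "v \<in> V" "G v \<in> T" using that by (auto simp: V'_def)
    obtain y where y: "G v = snd \<kappa>' y" "y \<in> fst \<kappa>'" "y \<in> fst \<kappa>1'" using v(2) by (auto simp: T_def)
    have "snd \<kappa>' y = snd \<kappa>' (F (chart_inv \<kappa> v))" using y by (simp add: G_def local_rep_def)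
    then have "y = F (chart_inv \<kappa> v)" using inj'[OF k(2)] y FV[OF v(1)] by (auto dest: inj_onD)
    then show "F (chart_inv \<kappa> v) \<in> fst \<kappa>1'" "\<tau> (G v) = snd \<kappa>1' (F (chart_inv \<kappa> v))"
      using y by (auto simp: \<tau>_def local_rep_def chart_inv_left[OF inj'[OF k(2)]])
  qed
  have xS: "snd \<kappa>1 x \<in> S" using x1 xk by (auto simp: S_def)
  have \<sigma>x: "\<sigma> (snd \<kappa>1 x) = snd \<kappa> x" using x1 by (simp add: \<sigma>_def local_rep_def chart_inv_left[OF inj[OF k1(1)]])
  have "F x \<in> fst \<kappa>'" using FV[OF V(2)] by (simp add: chart_inv_left[OF inj[OF k(1)] xk])
  then have "G (snd \<kappa> x) \<in> T" using x1 by (auto simp: G_def T_def local_rep_def chart_inv_left[OF inj[OF k(1)] xk])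
  then have xW: "snd \<kappa>1 x \<in> W" using xS \<sigma>x V(2) by (simp add: W_def V'_def)
  have "holomorphic_map_on (\<lambda>v. \<tau> (G v)) V'"
    by (rule holomorphic_map_on_compose[OF holomorphic_map_on_subset[OF hol[folded G_def]] \<tau>(1)]) (auto simp: V'_def)
  then have "holomorphic_map_on (\<lambda>u. \<tau> (G (\<sigma> u))) W"
    by (intro holomorphic_map_on_compose[where F = \<sigma> and G = "\<lambda>v. \<tau> (G v)" and T = V'] holomorphic_map_on_subset[OF \<sigma>(1)])
      (auto simp: W_def)
  then have "holomorphic_map_on (local_rep \<kappa>1 \<kappa>1' F) W"
    by (rule holomorphic_map_on_transform[OF _ W]) (simp add: W_def inv'(2) inv, simp add: local_rep_def)
  moreover have "F (chart_inv \<kappa>1 u) \<in> fst \<kappa>1'" if "u \<in> W" for u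
    using inv'(1)[of "\<sigma> u"] inv[of u] that by (simp add: W_def)
  moreover have "W \<subseteq> snd \<kappa>1 ` fst \<kappa>1" by (auto simp: W_def S_def)
  ultimately show "\<exists>V. open V \<and> snd \<kappa>1 x \<in> V \<and> V \<subseteq> snd \<kappa>1 ` fst \<kappa>1 \<and>
      (\<forall>u\<in>V. F (chart_inv \<kappa>1 u) \<in> fst \<kappa>1') \<and> holomorphic_map_on (local_rep \<kappa>1 \<kappa>1' F) V"
    using W xW by blast
qed

text \<open>Differentials of functions on the manifold change by the Jacobian of the transition map.
  This is what makes \<open>H_bundle\<close> transform as a subbundle.\<close>

lemma differential_of_transition:
  assumes A: "complex_manifold \<A>" and k: "\<kappa> \<in> \<A>" "\<kappa>' \<in> \<A>" and x: "x \<in> fst \<kappa>" "x \<in> fst \<kappa>'"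
    and f: "has_cgradient (\<lambda>u. f (chart_inv \<kappa>' u)) g (snd \<kappa>' x)"
  shows "differential_of f \<kappa> x = g v* cjacobian (local_rep \<kappa> \<kappa>' id) (snd \<kappa> x)"
proof -
  let ?\<sigma> = "local_rep \<kappa> \<kappa>' id" and ?S = "snd \<kappa> ` (fst \<kappa> \<inter> fst \<kappa>')"
  note inj = complex_manifoldD(1)[OF A]
  have xS: "snd \<kappa> x \<in> ?S" using x by blast
  have \<sigma>x: "?\<sigma> (snd \<kappa> x) = snd \<kappa>' x" using x by (simp add: local_rep_def chart_inv_left[OF inj[OF k(1)]])
  have "has_cgradient (\<lambda>u. f (chart_inv \<kappa>' (?\<sigma> u))) (g v* cjacobian ?\<sigma> (snd \<kappa> x)) (snd \<kappa> x)"
    by (rule has_cgradient_compose[where f = "\<lambda>u. f (chart_inv \<kappa>' u)"])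
      (use holomorphic_map_on_cjacobian[OF complex_manifoldD(3)[OF A k] xS] f in \<open>auto simp: \<sigma>x\<close>)
  then have "has_cgradient (\<lambda>u. f (chart_inv \<kappa> u)) (g v* cjacobian ?\<sigma> (snd \<kappa> x)) (snd \<kappa> x)"
    by (rule has_cgradient_transform[OF _ complex_manifoldD(2)[OF A k] xS])
      (auto simp: local_rep_def chart_inv_left inj k)
  then show ?thesis by (simp add: differential_of_def o_def cgradient_eq)
qed

section \<open>Spans and differential ideals\<close>

lemma span_image_matrix: "(\<lambda>\<theta>. \<theta> v* J) ` vec.span S = vec.span ((\<lambda>\<theta>. \<theta> v* J) ` S)"
  for J :: "complex^'n^'m"
proof -
  interpret l: Vector_Spaces.linear "(*s)" "(*s)" "\<lambda>\<theta>::complex^'m. \<theta> v* J"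
    by unfold_locales (auto simp: vector_matrix_left_distrib scalar_vector_matrix_assoc vec.scale_right_distrib vec.scale_left_distrib)
  show ?thesis by (rule l.span_image[symmetric])
qed

lemma span_pair: "vec.span {a, b} = {x *s a + y *s b | x y. True}" for a b :: "complex^'n"
proof (intro set_eqI iffI)
  fix v assume "v \<in> vec.span {a, b}"
  then obtain x y where "v - x *s a = y *s b" by (auto simp: vec.span_insert vec.span_singleton)
  then have "v = x *s a + y *s b" by (simp add: algebra_simps)
  then show "v \<in> {x *s a + y *s b | x y. True}" by blast
qed (auto simp: vec.span_base intro!: vec.span_add vec.span_scale)

lemma span_pair_triangular:
  fixes a b :: "complex^'n"
  assumes "x \<noteq> 0" "z \<noteq> 0" shows "vec.span {x *s a, y *s a + z *s b} = vec.span {a, b}"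
proof (rule vec.span_eq[THEN iffD2], intro conjI)
  show "{x *s a, y *s a + z *s b} \<subseteq> vec.span {a, b}" by (auto simp: vec.span_base intro!: vec.span_add vec.span_scale)
  have "a = (1 / x) *s (x *s a) + 0 *s (y *s a + z *s b)" using assms by simp
  moreover have "b = (- y / (x * z)) *s (x *s a) + (1 / z) *s (y *s a + z *s b)"
    using assms by (simp add: vec_eq_iff field_simps)
  ultimately show "{a, b} \<subseteq> vec.span {x *s a, y *s a + z *s b}" unfolding span_pair by blast
qed

lemma dim_span_pair:
  fixes a b :: "complex^'n"
  assumes "\<And>x y. x *s a + y *s b = 0 \<Longrightarrow> x = 0 \<and> y = 0"
  shows "vec.dim (vec.span {a, b}) = 2"
proof -
  have "a \<noteq> b" using assms[of 1 "-1"] by (auto simp: vec.scale_minus_left)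
  moreover have "vec.independent {a, b}"
  proof (subst vec.independent_insert, simp add: \<open>a \<noteq> b\<close>, intro conjI)
    show "b \<noteq> 0" using assms[of 0 1] by auto
    show "a \<notin> vec.span {b}" using assms[of 1 "- _"] by (auto simp: vec.span_singleton vec.scale_minus_left)
  qed
  ultimately show ?thesis using vec.dim_eq_card[of "{a,b}"] vec.dim_span[of "{a, b}"] by simp
qed

text \<open>The ideal is the least set closed under its rules, so two ideals are compared by
  checking generators only.\<close>

lemma differential_ideal_subset:
  assumes "S \<subseteq> differential_ideal V T" shows "differential_ideal V S \<subseteq> differential_ideal V T"
proof
  fix \<omega> assume "\<omega> \<in> differential_ideal V S"
  then show "\<omega> \<in> differential_ideal V T"
    by induction (use assms in \<open>auto intro: differential_ideal.intros\<close>)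
qed

lemma one_form_add: "one_form V (\<lambda>u. f u + g u) = form_add (one_form V f) (one_form V g)"
  by (auto simp: one_form_def form_add_def fun_eq_iff sum.distrib[symmetric] intro!: sum.cong)

lemma one_form_cong: "(\<And>u. u \<in> V \<Longrightarrow> f u = g u) \<Longrightarrow> one_form V f = one_form V g"
  by (auto simp: one_form_def fun_eq_iff intro!: sum.cong)

text \<open>Multiplication by a function is the wedge product with a 0-form: \<open>f\<close> is
  placed at the empty index set and extended by zero outside \<open>V\<close>, and only the empty
  set contributes to the sum in \<open>wedge\<close>.\<close>

lemma one_form_scale_in_ideal:
  fixes V :: "(complex^'n::{finite,linorder}) set"
  assumes w: "one_form V \<theta> \<in> differential_ideal V S" and f: "holomorphic_fun_on f V" and V: "open V"
  shows "one_form V (\<lambda>u. f u *s \<theta> u) \<in> differential_ideal V S"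
proof -
  define \<beta> :: "'n form" where "\<beta> = (\<lambda>x I. if x \<in> V \<and> I = {} then f x else 0)"
  have "holomorphic_fun_on (\<lambda>x. \<beta> x I) V" for I
    by (cases "I = {}")
      (auto simp: \<beta>_def holomorphic_fun_on_const intro: holomorphic_fun_on_transform[OF f V])
  then have "\<beta> \<in> holomorphic_forms V" by (auto simp: holomorphic_forms_def \<beta>_def)
  moreover have "wedge \<beta> (one_form V \<theta>) = one_form V (\<lambda>u. f u *s \<theta> u)"
  proof (intro ext)
    fix x K
    have "wedge \<beta> (one_form V \<theta>) x K = (\<Sum>I\<in>{{}}. (-1) ^ card {(i, j). i \<in> I \<and> j \<in> K - I \<and> j < i} * \<beta> x I * one_form V \<theta> x (K - I))"
      unfolding wedge_def by (rule sum.mono_neutral_right) (auto simp: \<beta>_def)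
    also have "\<dots> = one_form V (\<lambda>u. f u *s \<theta> u) x K"
      by (auto simp: \<beta>_def one_form_def sum_distrib_left intro!: sum.cong)
    finally show "wedge \<beta> (one_form V \<theta>) x K = one_form V (\<lambda>u. f u *s \<theta> u) x K" .
  qed
  ultimately show ?thesis using differential_ideal.wedge_left[OF w] by metis
qed

section \<open>Germs of maps of the projective line in affine charts\<close>

lemma index2_cases: "(j::2) = i \<or> j = i + 1"
  using UNIV_index2[of i] by auto

lemma index2_neq: "(j::2) \<noteq> i \<Longrightarrow> j = i + 1"
  using index2_cases by blast

lemma SL2_mat_1: "mat 1 \<in> SL2"
  by (simp add: SL2_def)

lemma vector_matrix_mult_nonzero: "A \<in> SL2 \<Longrightarrow> v \<noteq> 0 \<Longrightarrow> v v* A \<noteq> 0"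
  by (rule cp1_act_abs(2))

lemma cp1_act_mat_1: "cp1_act x (mat 1) = x"
  by (simp add: cp1_act_def cp1_abs_rep vector_matrix_mul_rid)

definition flip :: "2 \<Rightarrow> 2 \<Rightarrow> complex \<Rightarrow> complex" where
  "flip i i' t = (if i = i' then t else 1 / t)"

lemma abs_affine_in_chart: "abs_cp1 (affine_vec i t) \<in> fst (affine_chart i') \<longleftrightarrow> i = i' \<or> t \<noteq> 0"
proof (cases "i' = i")
  case False
  then have "i' = i + 1" by (rule index2_neq)
  then show ?thesis by (simp add: affine_chart_abs(1)[OF affine_vec_simps(3)] affine_vec_simps)
qed (simp add: affine_chart_abs(1)[OF affine_vec_simps(3)] affine_vec_simps)

lemma abs_affine_coord: "snd (affine_chart i') (abs_cp1 (affine_vec i t)) = flip i i' t"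
proof (cases "i' = i")
  case False
  then have "i' = i + 1" by (rule index2_neq)
  then show ?thesis
    by (simp add: affine_chart_abs(2)[OF affine_vec_simps(3)] affine_vec_simps flip_def index2_succ(2))
qed (simp add: affine_chart_abs(2)[OF affine_vec_simps(3)] affine_vec_simps flip_def)

lemma chart_flip:
  assumes "x \<in> fst (affine_chart i)"
  shows "snd (affine_chart i') x = flip i i' (snd (affine_chart i) x)"
    and "x \<in> fst (affine_chart i') \<longleftrightarrow> i = i' \<or> snd (affine_chart i) x \<noteq> 0"
  using abs_affine_coord[of i' i "snd (affine_chart i) x"] abs_affine_in_chart[of i "snd (affine_chart i) x" i']
  by (simp_all add: affine_chart_back[OF assms])

lemma abs_affine_flip: "i = i' \<or> t \<noteq> 0 \<Longrightarrow> abs_cp1 (affine_vec i' (flip i i' t)) = abs_cp1 (affine_vec i t)"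
  using affine_chart_back[of "abs_cp1 (affine_vec i t)" i'] by (simp add: abs_affine_in_chart abs_affine_coord)

lemma cp1_in_some_chart: obtains i where "x \<in> fst (affine_chart i)"
  using cp1_rep_nonzero[of x] by (auto simp: affine_chart_def vec_eq_iff)

lemma inj_affine_chart: "inj_on (snd (affine_chart i)) (fst (affine_chart i))"
  by (rule inj_on_inverseI[where g = "\<lambda>t. abs_cp1 (affine_vec i t)"]) (rule affine_chart_back)

text \<open>The Moebius map \<open>y \<mapsto> y A\<close> read from affine chart \<open>i\<close>
  to affine chart \<open>k\<close>. For \<open>i = k = 2\<close> it is
  \<open>(a t + c) / (b t + d)\<close>.\<close>

definition mob :: "complex^2^2 \<Rightarrow> 2 \<Rightarrow> 2 \<Rightarrow> complex \<Rightarrow> complex" where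
  "mob A i k t = (A $ i $ (k+1) + t * A $ (i+1) $ (k+1)) / (A $ i $ k + t * A $ (i+1) $ k)"

lemma affine_vec_mult: "(affine_vec i t v* A) $ k = A $ i $ k + t * A $ (i+1) $ k"
  by (simp add: vector_matrix_mult_2[of _ _ _ i] affine_vec_simps)

lemma cp1_act_affine_in:
  assumes "A \<in> SL2"
  shows "cp1_act (abs_cp1 (affine_vec i t)) A \<in> fst (affine_chart k) \<longleftrightarrow> A $ i $ k + t * A $ (i+1) $ k \<noteq> 0"
  using affine_chart_abs(1)[OF vector_matrix_mult_nonzero[OF assms affine_vec_simps(3)]]
  by (simp add: cp1_act_abs(1)[OF assms affine_vec_simps(3)] affine_vec_mult)

lemma cp1_act_affine:
  assumes "A \<in> SL2" "A $ i $ k + t * A $ (i+1) $ k \<noteq> 0"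
  shows "cp1_act (abs_cp1 (affine_vec i t)) A = abs_cp1 (affine_vec k (mob A i k t))"
proof -
  have "cp1_act (abs_cp1 (affine_vec i t)) A \<in> fst (affine_chart k)" using assms cp1_act_affine_in by simp
  from affine_chart_back[OF this]
  show ?thesis
    using affine_chart_abs(2)[OF vector_matrix_mult_nonzero[OF assms(1) affine_vec_simps(3)]]
    by (simp add: cp1_act_abs(1)[OF assms(1) affine_vec_simps(3)] affine_vec_mult mob_def)
qed

lemma mob_mat_1: "mob (mat 1) i k = flip i k"
  using index2_neq[of k i] by (auto simp: fun_eq_iff mob_def flip_def mat_def index2_succ index2_succ(1)[symmetric])

text \<open>Near \<open>x\<close>, the map \<open>f\<close> is given by the analytic function
  \<open>F\<close> in one pair of charts. Using a filter instead of explicit neighbourhoods turns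
  chart changes and the group action into plain composition of analytic functions.\<close>

definition germ_rep :: "2 \<Rightarrow> 2 \<Rightarrow> (cp1 \<Rightarrow> cp1) \<Rightarrow> cp1 \<Rightarrow> (complex \<Rightarrow> complex) \<Rightarrow> bool" where
  "germ_rep i k f x F \<longleftrightarrow> x \<in> fst (affine_chart i) \<and> F analytic_on {snd (affine_chart i) x} \<and>
    (\<forall>\<^sub>F t in nhds (snd (affine_chart i) x). f (abs_cp1 (affine_vec i t)) = abs_cp1 (affine_vec k (F t)))"

lemma germ_rep_value:
  assumes "germ_rep i k f x F" shows "f x = abs_cp1 (affine_vec k (F (snd (affine_chart i) x)))"
proof -
  have x: "x \<in> fst (affine_chart i)" using assms by (simp add: germ_rep_def)
  have "\<forall>\<^sub>F t in nhds (snd (affine_chart i) x). f (abs_cp1 (affine_vec i t)) = abs_cp1 (affine_vec k (F t))"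
    using assms by (simp add: germ_rep_def)
  from eventually_nhds_x_imp_x[OF this] show ?thesis by (simp only: affine_chart_back[OF x])
qed

lemma germ_rep_in_chart: "germ_rep i k f x F \<Longrightarrow> f x \<in> fst (affine_chart k)"
  by (simp add: germ_rep_value abs_affine_in_chart)

lemma germ_rep_source:
  assumes "germ_rep i k f x F" "x \<in> fst (affine_chart i')"
  shows "germ_rep i' k f x (\<lambda>t. F (flip i' i t))"
proof (cases "i = i'")
  case False
  define s where "s = snd (affine_chart i') x"
  have s: "snd (affine_chart i) x = 1 / s" "s \<noteq> 0"
    using chart_flip[OF assms(2), of i] assms(1) False by (auto simp: s_def flip_def germ_rep_def)
  have F: "F analytic_on {1 / s}" and
    ev: "\<forall>\<^sub>F t in nhds (1 / s). f (abs_cp1 (affine_vec i t)) = abs_cp1 (affine_vec k (F t))"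
    using assms(1) s by (auto simp: germ_rep_def)
  have "(\<lambda>t. 1 / t) analytic_on {s}" using s by (intro analytic_intros) auto
  then have "(\<lambda>t. F (1 / t)) analytic_on {s}"
    using analytic_on_compose[of "\<lambda>t. 1 / t" "{s}" F] F by (simp add: o_def)
  moreover have "\<forall>\<^sub>F t in nhds s. f (abs_cp1 (affine_vec i' t)) = abs_cp1 (affine_vec k (F (1 / t)))"
  proof -
    have "filterlim (\<lambda>t. 1 / t) (nhds (1 / s)) (nhds s)"
      using s by (intro tendsto_intros filterlim_ident) auto
    then have "\<forall>\<^sub>F t in nhds s. f (abs_cp1 (affine_vec i (1 / t))) = abs_cp1 (affine_vec k (F (1 / t)))"
      by (rule eventually_compose_filterlim[OF ev])
    moreover have "\<forall>\<^sub>F t in nhds s. t \<noteq> 0" by (rule t1_space_nhds[OF s(2)])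
    ultimately show ?thesis
      by eventually_elim (use False abs_affine_flip[of i' i] in \<open>simp add: flip_def\<close>)
  qed
  ultimately show ?thesis using assms(2) False by (simp add: germ_rep_def s_def flip_def)
qed (use assms in \<open>simp add: flip_def\<close>)

lemma germ_rep_act:
  assumes g: "germ_rep i k f x F" and A: "A \<in> SL2" and k': "cp1_act (f x) A \<in> fst (affine_chart k')"
  shows "mob A k k' analytic_on {F (snd (affine_chart i) x)}"
    and "germ_rep i k' (\<lambda>y. cp1_act (f y) A) x (\<lambda>t. mob A k k' (F t))"
proof -
  define z where "z = snd (affine_chart i) x"
  define D where "D = (\<lambda>w. A $ k $ k' + w * A $ (k+1) $ k')"
  have F: "F analytic_on {z}" using g by (simp add: germ_rep_def z_def)
  have D: "D (F z) \<noteq> 0"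
    using k' germ_rep_value[OF g] cp1_act_affine_in[OF A] by (simp add: D_def z_def)
  show M: "mob A k k' analytic_on {F (snd (affine_chart i) x)}"
    using D unfolding mob_def z_def D_def by (intro analytic_intros) auto
  have "(\<lambda>t. mob A k k' (F t)) analytic_on {z}"
    using analytic_on_compose[OF F, of "mob A k k'"] M by (simp add: o_def z_def)
  moreover have "\<forall>\<^sub>F t in nhds z. cp1_act (f (abs_cp1 (affine_vec i t))) A = abs_cp1 (affine_vec k' (mob A k k' (F t)))"
  proof -
    have "isCont (\<lambda>t. D (F t)) z" unfolding D_def by (intro continuous_intros analytic_at_imp_isCont F)
    then have "\<forall>\<^sub>F t in nhds z. D (F t) \<noteq> 0"
      using D by (intro tendsto_imp_eventually_ne[of _ "D (F z)"])
        (simp_all add: isCont_def tendsto_at_iff_tendsto_nhds[where g = "\<lambda>t. D (F t)"])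
    moreover have "\<forall>\<^sub>F t in nhds z. f (abs_cp1 (affine_vec i t)) = abs_cp1 (affine_vec k (F t))"
      using g by (simp add: germ_rep_def z_def)
    ultimately show ?thesis by eventually_elim (simp add: cp1_act_affine[OF A] D_def)
  qed
  ultimately show "germ_rep i k' (\<lambda>y. cp1_act (f y) A) x (\<lambda>t. mob A k k' (F t))"
    using g by (simp add: germ_rep_def z_def)
qed

text \<open>A change of target chart is the action of the identity matrix, read in the new
  chart.\<close>

lemma germ_rep_target:
  assumes "germ_rep i k f x F" "f x \<in> fst (affine_chart k')"
  shows "germ_rep i k' f x (\<lambda>t. flip k k' (F t))"
  using germ_rep_act(2)[OF assms(1) SL2_mat_1, of k'] assms(2) by (simp add: cp1_act_mat_1 mob_mat_1)

lemma germ_rep_local_rep: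
  assumes "germ_rep i k f x F"
  shows "\<forall>\<^sub>F t in nhds (snd (affine_chart i) x). local_rep (affine_chart i) (affine_chart k) f t = F t"
proof -
  have "\<forall>\<^sub>F t in nhds (snd (affine_chart i) x). f (abs_cp1 (affine_vec i t)) = abs_cp1 (affine_vec k (F t))"
    using assms by (simp add: germ_rep_def)
  then show ?thesis
    by eventually_elim (simp add: local_rep_def chart_inv_affine abs_affine_coord flip_def)
qed

lemma germ_rep_coords:
  assumes "germ_rep i k f x F"
  defines "z \<equiv> snd (affine_chart i) x"
  shows "germ_coords (affine_chart i) (affine_chart k) (x, f) = vector [z, F z, deriv F z, (deriv ^^ 2) F z]"
proof -
  note ev = germ_rep_local_rep[OF assms(1), folded z_def]
  have "deriv (local_rep (affine_chart i) (affine_chart k) f) z = deriv F z" by (rule deriv_cong_ev[OF ev refl])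
  moreover have "(deriv ^^ 2) (local_rep (affine_chart i) (affine_chart k) f) z = (deriv ^^ 2) F z"
    by (rule higher_deriv_cong_ev[OF ev refl])
  moreover have "snd (affine_chart k) (f x) = F z"
    using germ_rep_value[OF assms(1)] by (simp add: abs_affine_coord flip_def z_def)
  ultimately show ?thesis by (simp add: germ_coords_def z_def)
qed

text \<open>A representation in one pair of charts can be moved to any other pair at the point,
  first on the source side and then on the target side.\<close>

lemma germ_rep_imp_holomorphic_near:
  assumes g: "germ_rep i k f x F" shows "holomorphic_near f x"
  unfolding holomorphic_near_def cp1_atlas_def
proof (clarsimp)
  fix i' k' assume x: "x \<in> fst (affine_chart i')" and fx: "f x \<in> fst (affine_chart k')"
  obtain G where G: "germ_rep i' k' f x G" using germ_rep_target[OF germ_rep_source[OF g x] fx] by blast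
  let ?z = "snd (affine_chart i') x" and ?L = "local_rep (affine_chart i') (affine_chart k') f"
  obtain S where S: "open S" "?z \<in> S" "G holomorphic_on S" using G by (auto simp: germ_rep_def analytic_at)
  have "\<forall>\<^sub>F t in nhds ?z. f (abs_cp1 (affine_vec i' t)) = abs_cp1 (affine_vec k' (G t)) \<and> ?L t = G t \<and> t \<in> S"
    using G germ_rep_local_rep[OF G] eventually_nhds_in_open[OF S(1,2)] by (intro eventually_conj) (auto simp: germ_rep_def)
  then obtain V where V: "open V" "?z \<in> V"
    "\<And>t. t \<in> V \<Longrightarrow> f (abs_cp1 (affine_vec i' t)) = abs_cp1 (affine_vec k' (G t)) \<and> ?L t = G t \<and> t \<in> S"
    by (auto simp: eventually_nhds)
  have "G holomorphic_on V" using V(3) by (intro holomorphic_on_subset[OF S(3)]) auto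
  then have "?L holomorphic_on V" by (rule holomorphic_transform) (use V(3) in auto)
  then show "\<exists>V. open V \<and> ?z \<in> V \<and> V \<subseteq> snd (affine_chart i') ` fst (affine_chart i') \<and>
      (\<forall>t\<in>V. f (chart_inv (affine_chart i') t) \<in> fst (affine_chart k')) \<and> ?L holomorphic_on V"
    using V by (intro exI[of _ V]) (auto simp: affine_chart_surj chart_inv_affine abs_affine_in_chart)
qed

lemma holomorphic_near_germ_rep:
  assumes h: "holomorphic_near f x" and x: "x \<in> fst (affine_chart i)" and fx: "f x \<in> fst (affine_chart k)"
  obtains F where "germ_rep i k f x F"
proof -
  let ?L = "local_rep (affine_chart i) (affine_chart k) f"
  have atlas: "affine_chart i \<in> cp1_atlas" "affine_chart k \<in> cp1_atlas" by (simp_all add: cp1_atlas_def)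
  obtain V where V: "open V" "snd (affine_chart i) x \<in> V" "V \<subseteq> snd (affine_chart i) ` fst (affine_chart i)"
    "\<forall>t\<in>V. f (chart_inv (affine_chart i) t) \<in> fst (affine_chart k)" "?L holomorphic_on V"
    using h[unfolded holomorphic_near_def, rule_format, OF atlas conjI[OF x fx]] by (elim exE conjE) (rule that)
  have "?L analytic_on {snd (affine_chart i) x}" using V by (auto simp: analytic_at)
  moreover have "\<forall>\<^sub>F t in nhds (snd (affine_chart i) x). f (abs_cp1 (affine_vec i t)) = abs_cp1 (affine_vec k (?L t))"
    using eventually_nhds_in_open[OF V(1,2)]
    by eventually_elim (use V(4) affine_chart_back[of _ k] in \<open>simp add: local_rep_def chart_inv_affine\<close>)
  ultimately have "germ_rep i k f x ?L" using x by (simp add: germ_rep_def)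
  then show thesis by (rule that)
qed

text \<open>Up to order two, the derivatives of a composite depend only on those of its factors.
  Both the chart independence of jets and the prolonged action rest on this.\<close>

lemma deriv_compose_analytic:
  assumes f: "f analytic_on {z}" and g: "g analytic_on {f z}"
  shows "deriv (\<lambda>t. g (f t)) z = deriv g (f z) * deriv f z"
    and "(deriv ^^ 2) (\<lambda>t. g (f t)) z = (deriv ^^ 2) g (f z) * (deriv f z)\<^sup>2 + deriv g (f z) * (deriv ^^ 2) f z"
proof -
  have d: "(h has_field_derivative deriv h w) (at w)" if "h analytic_on {w}" for h :: "complex \<Rightarrow> complex" and w
    using that by (simp add: DERIV_deriv_iff_field_differentiable analytic_on_imp_differentiable_at)
  have first: "deriv (\<lambda>t. g (f t)) w = deriv g (f w) * deriv f w" if "f analytic_on {w}" "g analytic_on {f w}" for w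
    by (rule DERIV_imp_deriv, rule DERIV_chain2) (intro d that)+
  show "deriv (\<lambda>t. g (f t)) z = deriv g (f z) * deriv f z" by (rule first[OF assms])
  \<comment> \<open>To be differentiated once more, the first-order chain rule must hold in a whole
    neighbourhood of \<open>z\<close>, so analyticity is spread from the point to nearby
    points.\<close>
  have ev_analytic: "\<forall>\<^sub>F w in nhds u. h analytic_on {w}" if h: "h analytic_on {u}" for h :: "complex \<Rightarrow> complex" and u
  proof -
    obtain S where "open S" "u \<in> S" "h holomorphic_on S" using h by (auto simp: analytic_at)
    then show ?thesis by (auto simp: eventually_nhds analytic_at)
  qed
  have "\<forall>\<^sub>F w in nhds z. f analytic_on {w}" "\<forall>\<^sub>F w in nhds (f z). g analytic_on {w}"
    by (rule ev_analytic[OF f], rule ev_analytic[OF g])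
  moreover have "filterlim f (nhds (f z)) (nhds z)"
    using analytic_at_imp_isCont[OF f] by (simp add: isCont_def tendsto_at_iff_tendsto_nhds)
  ultimately have "\<forall>\<^sub>F w in nhds z. f analytic_on {w}" "\<forall>\<^sub>F w in nhds z. g analytic_on {f w}"
    by (auto simp: filterlim_iff)
  then have "\<forall>\<^sub>F w in nhds z. deriv (\<lambda>t. g (f t)) w = deriv g (f w) * deriv f w"
    by eventually_elim (rule first)
  then have "(deriv ^^ 2) (\<lambda>t. g (f t)) z = deriv (\<lambda>w. deriv g (f w) * deriv f w) z"
    by (simp add: numeral_2_eq_2 deriv_cong_ev)
  also have "\<dots> = deriv (deriv g) (f z) * deriv f z * deriv f z + deriv (deriv f) z * deriv g (f z)"
    by (rule DERIV_imp_deriv, rule DERIV_mult, rule DERIV_chain2) (intro d assms analytic_deriv)+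
  finally show "(deriv ^^ 2) (\<lambda>t. g (f t)) z = (deriv ^^ 2) g (f z) * (deriv f z)\<^sup>2 + deriv g (f z) * (deriv ^^ 2) f z"
    by (simp add: numeral_2_eq_2 algebra_simps)
qed

lemma flip_analytic: "i = i' \<or> t \<noteq> 0 \<Longrightarrow> flip i i' analytic_on {t}"
  unfolding flip_def by (cases "i = i'") (auto intro!: analytic_intros)

text \<open>In any other pair of charts the two moved maps are read as \<open>mob\<close>, then
  \<open>F\<close> or \<open>G\<close>, then \<open>flip\<close>, with the same outer and inner
  functions. Agreement of \<open>F\<close> and \<open>G\<close> to second order in one pair of
  charts therefore carries over to all pairs. For \<open>A = mat 1\<close> this gives injectivity of
  the jet charts; in general it shows that the prolonged action does not depend on
  representatives.\<close>

lemma same_2jet_act: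
  assumes f: "germ_rep i k f x F" and g: "germ_rep i k g x G" and A: "A \<in> SL2"
    and eq: "germ_coords (affine_chart i) (affine_chart k) (x, f) = germ_coords (affine_chart i) (affine_chart k) (x, g)"
  shows "same_2jet (x, \<lambda>y. cp1_act (f y) A) (x, \<lambda>y. cp1_act (g y) A)"
proof -
  define z where "z = snd (affine_chart i) x"
  have eqs: "F z = G z" "deriv F z = deriv G z" "(deriv ^^ 2) F z = (deriv ^^ 2) G z"
    using eq unfolding germ_rep_coords[OF f] germ_rep_coords[OF g] z_def[symmetric] vec_eq_iff forall_4 vector_4_nth
    by auto
  have fgx: "f x = g x" using germ_rep_value[OF f] germ_rep_value[OF g] eqs by (simp add: z_def)
  have "germ_coords (affine_chart i') (affine_chart k') (x, \<lambda>y. cp1_act (f y) A)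
      = germ_coords (affine_chart i') (affine_chart k') (x, \<lambda>y. cp1_act (g y) A)"
    if i': "x \<in> fst (affine_chart i')" and k': "cp1_act (f x) A \<in> fst (affine_chart k')" for i' k'
  proof -
    define s where "s = snd (affine_chart i') x"
    have sz: "flip i' i s = z" and s: "i' = i \<or> s \<noteq> 0"
      using chart_flip[OF i', of i] f by (auto simp: s_def z_def germ_rep_def)
    have rep: "germ_coords (affine_chart i') (affine_chart k') (x, \<lambda>y. cp1_act (h y) A) =
        (let H' = (\<lambda>t. mob A k k' (H (flip i' i t))) in vector [s, H' s, deriv H' s, (deriv ^^ 2) H' s])"
      "mob A k k' analytic_on {H z}" "H analytic_on {z}"
      if h: "germ_rep i k h x H" and hx: "h x = f x" for h H
    proof -
      have k2: "cp1_act (h x) A \<in> fst (affine_chart k')" using k' hx by simp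
      show "germ_coords (affine_chart i') (affine_chart k') (x, \<lambda>y. cp1_act (h y) A) =
          (let H' = (\<lambda>t. mob A k k' (H (flip i' i t))) in vector [s, H' s, deriv H' s, (deriv ^^ 2) H' s])"
        using germ_rep_coords[OF germ_rep_source[OF germ_rep_act(2)[OF h A k2] i']] by (simp add: s_def Let_def)
      show "mob A k k' analytic_on {H z}" using germ_rep_act(1)[OF h A k2] by (simp add: z_def)
      show "H analytic_on {z}" using h by (simp add: germ_rep_def z_def)
    qed
    have \<sigma>: "flip i' i analytic_on {s}" by (rule flip_analytic[OF s])
    have step: "(\<lambda>t. H (flip i' i t)) analytic_on {s}" if "H analytic_on {z}" for H
      using analytic_on_compose[OF \<sigma>, of H] that sz by (simp add: o_def)
    have D: "deriv (\<lambda>t. mob A k k' (H (flip i' i t))) s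
          = deriv (mob A k k') (H z) * (deriv H z * deriv (flip i' i) s)"
      "(deriv ^^ 2) (\<lambda>t. mob A k k' (H (flip i' i t))) s
          = (deriv ^^ 2) (mob A k k') (H z) * (deriv H z * deriv (flip i' i) s)\<^sup>2 +
            deriv (mob A k k') (H z) * ((deriv ^^ 2) H z * (deriv (flip i' i) s)\<^sup>2 + deriv H z * (deriv ^^ 2) (flip i' i) s)"
      if "H analytic_on {z}" "mob A k k' analytic_on {H z}" for H
      using deriv_compose_analytic[OF \<sigma>, of H] deriv_compose_analytic[OF step[OF that(1)], of "mob A k k'"] that sz
      by simp_all
    show ?thesis
      using rep(1)[OF f refl] rep(1)[OF g fgx[symmetric]] D[OF rep(3,2)[OF f refl]]
        D[OF rep(3,2)[OF g fgx[symmetric]]] eqs sz by (simp add: Let_def)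
  qed
  moreover have "holomorphic_near (\<lambda>y. cp1_act (f y) A) x" "holomorphic_near (\<lambda>y. cp1_act (g y) A) x"
    using germ_rep_imp_holomorphic_near f g holomorphic_near_act[OF A] by blast+
  ultimately show ?thesis using fgx by (auto simp: same_2jet_def cp1_atlas_def)
qed

section \<open>Jets in charts\<close>

lemma jet_holomorphic_near: "holomorphic_near (jet_map j) (jet_source j)"
  using Quotient3_rep_reflp[OF Quotient3_jet2, of j]
  by (auto simp: same_2jet_def jet_map_def jet_source_def split: prod.splits)

lemma jet_of_self: "jet_of (jet_source j) (jet_map j) = j"
  using Quotient3_abs_rep[OF Quotient3_jet2, of j] by (simp add: jet_of_def jet_source_def jet_map_def)

lemma same_2jet_refl: "holomorphic_near f x \<Longrightarrow> same_2jet (x, f) (x, f)"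
  by (simp add: same_2jet_def)

lemma jet_of_rep:
  assumes "holomorphic_near f x" shows "same_2jet (jet_source (jet_of x f), jet_map (jet_of x f)) (x, f)"
  using Quotient3_rep_abs[OF Quotient3_jet2 same_2jet_refl[OF assms]]
  by (simp add: jet_of_def jet_source_def jet_map_def)

lemma jet_of_source:
  assumes "holomorphic_near f x"
  shows "jet_source (jet_of x f) = x" "jet_map (jet_of x f) x = f x"
  using jet_of_rep[OF assms] by (auto simp: same_2jet_def)

lemma jet_of_eqI: "same_2jet (x, f) (x, g) \<Longrightarrow> jet_of x f = jet_of x g"
  unfolding jet_of_def by (rule Quotient3_rel_abs[OF Quotient3_jet2])

abbreviation jchart :: "2 \<Rightarrow> 2 \<Rightarrow> (jet2, complex^4) chart" where
  "jchart i k \<equiv> jet_chart (affine_chart i) (affine_chart k)"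

lemma jchart_in: "j \<in> fst (jchart i k) \<longleftrightarrow>
    jet_source j \<in> fst (affine_chart i) \<and> jet_map j (jet_source j) \<in> fst (affine_chart k)"
  by (simp add: jet_chart_def)

lemma jchart_coords: "snd (jchart i k) j = germ_coords (affine_chart i) (affine_chart k) (jet_source j, jet_map j)"
  by (simp add: jet_chart_def jet_source_def jet_map_def)

lemma jet_germ_rep:
  assumes "j \<in> fst (jchart i k)" obtains F where "germ_rep i k (jet_map j) (jet_source j) F"
  using holomorphic_near_germ_rep[OF jet_holomorphic_near] assms jchart_in by blast

lemma jet_of_coords:
  assumes g: "germ_rep i k f x F"
  defines "z \<equiv> snd (affine_chart i) x"
  shows "jet_of x f \<in> fst (jchart i k)"
    "snd (jchart i k) (jet_of x f) = vector [z, F z, deriv F z, (deriv ^^ 2) F z]"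
proof -
  have h: "holomorphic_near f x" by (rule germ_rep_imp_holomorphic_near[OF g])
  have x: "x \<in> fst (affine_chart i)" "f x \<in> fst (affine_chart k)" using g germ_rep_in_chart by (auto simp: germ_rep_def)
  then show "jet_of x f \<in> fst (jchart i k)" using jet_of_source[OF h] by (simp add: jchart_in)
  have "germ_coords (affine_chart i) (affine_chart k) (jet_source (jet_of x f), jet_map (jet_of x f))
      = germ_coords (affine_chart i) (affine_chart k) (x, f)"
    using jet_of_rep[OF h] x jet_of_source[OF h] by (auto simp: same_2jet_def cp1_atlas_def)
  then show "snd (jchart i k) (jet_of x f) = vector [z, F z, deriv F z, (deriv ^^ 2) F z]"
    by (simp add: jchart_coords germ_rep_coords[OF g] z_def)
qed

lemma inj_jchart: "inj_on (snd (jchart i k)) (fst (jchart i k))"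
proof (rule inj_onI)
  fix j j' assume j: "j \<in> fst (jchart i k)" and j': "j' \<in> fst (jchart i k)" and eq: "snd (jchart i k) j = snd (jchart i k) j'"
  obtain F where F: "germ_rep i k (jet_map j) (jet_source j) F" using jet_germ_rep[OF j] .
  obtain G where G: "germ_rep i k (jet_map j') (jet_source j') G" using jet_germ_rep[OF j'] .
  have "snd (affine_chart i) (jet_source j) = snd (affine_chart i) (jet_source j')"
    using arg_cong[OF eq, of "\<lambda>v. v $ 1"] by (simp only: jchart_coords germ_coords_def split vector_4_nth)
  then have x: "jet_source j = jet_source j'" using j j' by (auto simp: jchart_in intro: inj_onD[OF inj_affine_chart])
  \<comment> \<open>The action of the identity matrix reduces the claim to
    \<open>same_2jet_act\<close>.\<close>
  have "same_2jet (jet_source j, \<lambda>y. cp1_act (jet_map j y) (mat 1)) (jet_source j, \<lambda>y. cp1_act (jet_map j' y) (mat 1))"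
    by (rule same_2jet_act[OF F _ SL2_mat_1]) (use G eq in \<open>simp_all add: x jchart_coords\<close>)
  then have "jet_of (jet_source j) (jet_map j) = jet_of (jet_source j) (jet_map j')"
    by (intro jet_of_eqI) (simp add: cp1_act_mat_1)
  then show "j = j'" using jet_of_self x by metis
qed

text \<open>\<open>prolonged_act\<close> is defined through the representative that
  \<open>rep_jet2\<close> chooses; here that choice is replaced by an arbitrary representative
  \<open>f\<close>.\<close>

lemma prolonged_act_jet_of:
  assumes A: "A \<in> SL2" and h: "holomorphic_near f x"
  shows "prolonged_act (jet_of x f) A = jet_of x (\<lambda>y. cp1_act (f y) A)"
proof -
  define j where "j = jet_of x f"
  have j: "jet_source j = x" "jet_map j x = f x" using jet_of_source[OF h] by (auto simp: j_def)
  obtain i k where ik: "x \<in> fst (affine_chart i)" "f x \<in> fst (affine_chart k)" using cp1_in_some_chart by metis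
  obtain F where F: "germ_rep i k f x F" using holomorphic_near_germ_rep[OF h ik] .
  obtain G where G: "germ_rep i k (jet_map j) x G"
    using holomorphic_near_germ_rep[OF jet_holomorphic_near[of j]] ik j by metis
  have "germ_coords (affine_chart i) (affine_chart k) (x, jet_map j) = germ_coords (affine_chart i) (affine_chart k) (x, f)"
    using jet_of_rep[OF h] ik j by (auto simp: same_2jet_def cp1_atlas_def j_def)
  then have "jet_of x (\<lambda>y. cp1_act (jet_map j y) A) = jet_of x (\<lambda>y. cp1_act (f y) A)"
    by (intro jet_of_eqI same_2jet_act[OF G F A])
  then show ?thesis by (simp add: prolonged_act_def j_def[symmetric] j(1))
qed

text \<open>Every coordinate vector is realised by a quadratic Taylor polynomial; the factor
  \<open>1 / 2\<close> is there because the fourth coordinate is a second derivative. At the point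
  missing from chart \<open>i\<close> the coordinate has a default value from division by zero,
  which does not affect the germ.\<close>

definition jet_inv :: "2 \<Rightarrow> 2 \<Rightarrow> complex^4 \<Rightarrow> jet2" where
  "jet_inv i k v = jet_of (abs_cp1 (affine_vec i (v $ 1)))
    (\<lambda>y. let h = snd (affine_chart i) y - v $ 1 in abs_cp1 (affine_vec k (v $ 2 + v $ 3 * h + v $ 4 / 2 * h\<^sup>2)))"

lemma jet_inv:
  shows jet_inv_in: "jet_inv i k v \<in> fst (jchart i k)" and jet_inv_coords: "snd (jchart i k) (jet_inv i k v) = v"
proof -
  define F where "F = (\<lambda>t. v $ 2 + v $ 3 * (t - v $ 1) + v $ 4 / 2 * (t - v $ 1)\<^sup>2)"
  let ?x = "abs_cp1 (affine_vec i (v $ 1))"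
  let ?f = "\<lambda>y. let h = snd (affine_chart i) y - v $ 1 in abs_cp1 (affine_vec k (v $ 2 + v $ 3 * h + v $ 4 / 2 * h\<^sup>2))"
  have g: "germ_rep i k ?f ?x F"
    unfolding germ_rep_def F_def
    by (auto simp: abs_affine_in_chart abs_affine_coord flip_def Let_def intro!: analytic_intros always_eventually)
  have d: "deriv F = (\<lambda>t. v $ 3 + v $ 4 * (t - v $ 1))"
    unfolding F_def by (intro ext DERIV_imp_deriv) (auto intro!: derivative_eq_intros)
  have dd: "deriv (\<lambda>t. v $ 3 + v $ 4 * (t - v $ 1)) = (\<lambda>t. v $ 4)"
    by (intro ext DERIV_imp_deriv) (auto intro!: derivative_eq_intros)
  show "jet_inv i k v \<in> fst (jchart i k)" using jet_of_coords(1)[OF g] by (simp add: jet_inv_def)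
  show "snd (jchart i k) (jet_inv i k v) = v"
    using jet_of_coords(2)[OF g] unfolding jet_inv_def vec_eq_iff forall_4 vector_4_nth
    by (simp add: abs_affine_coord flip_def d dd numeral_2_eq_2) (simp add: F_def)
qed

section \<open>The manifold of jets of immersions\<close>

lemma vector_4_component:
  "(vector [a,b,c,d] :: 'a::zero^4) $ 1 = a" "(vector [a,b,c,d] :: 'a^4) $ 2 = b"
  "(vector [a,b,c,d] :: 'a^4) $ 3 = c" "(vector [a,b,c,d] :: 'a^4) $ 4 = d"
  by (simp_all add: vector_def)

text \<open>The second prolongation of \<open>z \<mapsto> 1 / z\<close>; \<open>target_flip\<close>
  is that of \<open>w \<mapsto> 1 / w\<close>. Every transition between jet charts is a source flip
  followed by a target flip, so computations are made for these two only.\<close>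

definition source_flip :: "2 \<Rightarrow> 2 \<Rightarrow> complex^4 \<Rightarrow> complex^4" where
  "source_flip i i' v = (if i = i' then v else
    vector [1 / v $ 1, v $ 2, - (v $ 1)\<^sup>2 * v $ 3, (v $ 1) ^ 4 * v $ 4 + 2 * (v $ 1) ^ 3 * v $ 3])"

definition target_flip :: "2 \<Rightarrow> 2 \<Rightarrow> complex^4 \<Rightarrow> complex^4" where
  "target_flip k k' v = (if k = k' then v else
    vector [v $ 1, 1 / v $ 2, - v $ 3 / (v $ 2)\<^sup>2, 2 * (v $ 3)\<^sup>2 / (v $ 2) ^ 3 - v $ 4 / (v $ 2)\<^sup>2])"

lemma deriv_reciprocal:
  assumes "t \<noteq> (0::complex)"
  shows "deriv (\<lambda>t. 1 / t) t = - 1 / t\<^sup>2" "(deriv ^^ 2) (\<lambda>t. 1 / t) t = 2 / t ^ 3"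
proof -
  have d: "deriv (\<lambda>t. 1 / t) s = - 1 / s\<^sup>2" if "s \<noteq> 0" for s :: complex
    by (rule DERIV_imp_deriv) (use that in \<open>auto intro!: derivative_eq_intros simp: power2_eq_square\<close>)
  show "deriv (\<lambda>t. 1 / t) t = - 1 / t\<^sup>2" by (rule d[OF assms])
  have "\<forall>\<^sub>F s in nhds t. deriv (\<lambda>t. 1 / t) s = - 1 / s\<^sup>2"
    using t1_space_nhds[OF assms] by eventually_elim (rule d)
  then have "(deriv ^^ 2) (\<lambda>t. 1 / t) t = deriv (\<lambda>s. - 1 / s\<^sup>2) t" by (simp add: numeral_2_eq_2 deriv_cong_ev)
  also have "\<dots> = 2 / t ^ 3"
    by (rule DERIV_imp_deriv) (use assms in \<open>auto intro!: derivative_eq_intros simp: field_simps power2_eq_square power3_eq_cube\<close>)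
  finally show "(deriv ^^ 2) (\<lambda>t. 1 / t) t = 2 / t ^ 3" .
qed

lemma jchart_coords_rep:
  assumes j: "j \<in> fst (jchart i k)" and F: "germ_rep i k (jet_map j) (jet_source j) F"
  defines "z \<equiv> snd (affine_chart i) (jet_source j)"
  shows "snd (jchart i k) j = vector [z, F z, deriv F z, (deriv ^^ 2) F z]"
  using germ_rep_coords[OF F] by (simp add: jchart_coords z_def)

lemma jchart_source_flip:
  assumes j: "j \<in> fst (jchart i k)" and j': "j \<in> fst (jchart i' k)"
  shows "snd (jchart i' k) j = source_flip i i' (snd (jchart i k) j)"
proof (cases "i = i'")
  case False
  obtain F where F: "germ_rep i k (jet_map j) (jet_source j) F" using jet_germ_rep[OF j] .
  define z where "z = snd (affine_chart i) (jet_source j)"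
  have x: "jet_source j \<in> fst (affine_chart i)" "jet_source j \<in> fst (affine_chart i')" using j j' by (auto simp: jchart_in)
  have s: "snd (affine_chart i') (jet_source j) = 1 / z" "z \<noteq> 0"
    using chart_flip[OF x(1), of i'] x False by (auto simp: z_def flip_def)
  have a: "(\<lambda>t. 1 / t) analytic_on {1 / z}" using s by (intro analytic_intros) auto
  have Fa: "F analytic_on {1 / (1 / z)}" using F by (simp add: germ_rep_def z_def)
  have nz: "1 / z \<noteq> 0" using s by simp
  have "germ_rep i' k (jet_map j) (jet_source j) (\<lambda>t. F (1 / t))"
    using germ_rep_source[OF F x(2)] False by (simp add: flip_def)
  from jchart_coords_rep[OF j' this] jchart_coords_rep[OF j F, folded z_def] show ?thesis
    using deriv_compose_analytic[OF a Fa] s(2) False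
    by (simp add: s deriv_reciprocal[OF nz] source_flip_def vector_4_component power_divide algebra_simps
        flip: power_mult)
qed (simp add: source_flip_def)

lemma jchart_target_flip:
  assumes j: "j \<in> fst (jchart i k)" and j': "j \<in> fst (jchart i k')"
  shows "snd (jchart i k') j = target_flip k k' (snd (jchart i k) j)"
proof (cases "k = k'")
  case False
  obtain F where F: "germ_rep i k (jet_map j) (jet_source j) F" using jet_germ_rep[OF j] .
  define z where "z = snd (affine_chart i) (jet_source j)"
  define y where "y = jet_map j (jet_source j)"
  have y: "y \<in> fst (affine_chart k)" "y \<in> fst (affine_chart k')" using j j' by (auto simp: jchart_in y_def)
  have "snd (affine_chart k) y = F z" using germ_rep_value[OF F] by (simp add: y_def z_def abs_affine_coord flip_def)
  then have nz: "F z \<noteq> 0" using chart_flip[OF y(1), of k'] y False by auto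
  have Fa: "F analytic_on {z}" using F by (simp add: germ_rep_def z_def)
  have a: "(\<lambda>t. 1 / t) analytic_on {F z}" using nz by (intro analytic_intros) auto
  have "germ_rep i k' (jet_map j) (jet_source j) (\<lambda>t. 1 / F t)"
    using germ_rep_target[OF F y(2)[unfolded y_def]] False by (simp add: flip_def)
  from jchart_coords_rep[OF j' this] jchart_coords_rep[OF j F] show ?thesis
    unfolding z_def[symmetric]
    using deriv_compose_analytic[OF Fa a] False
    by (simp add: deriv_reciprocal[OF nz] target_flip_def vector_4_component)
qed (simp add: target_flip_def)

lemma jchart_points:
  assumes j: "j \<in> fst (jchart i k)"
  shows "jet_source j = abs_cp1 (affine_vec i (snd (jchart i k) j $ 1))"
    "jet_map j (jet_source j) = abs_cp1 (affine_vec k (snd (jchart i k) j $ 2))"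
proof -
  have "snd (jchart i k) j $ 1 = snd (affine_chart i) (jet_source j)"
    "snd (jchart i k) j $ 2 = snd (affine_chart k) (jet_map j (jet_source j))"
    unfolding jchart_coords germ_coords_def split vector_4_nth by (rule refl)+
  then show "jet_source j = abs_cp1 (affine_vec i (snd (jchart i k) j $ 1))"
    "jet_map j (jet_source j) = abs_cp1 (affine_vec k (snd (jchart i k) j $ 2))"
    using j by (simp_all add: jchart_in affine_chart_back)
qed

lemma jchart_in_iff:
  assumes j: "j \<in> fst (jchart i k)"
  shows "j \<in> fst (jchart i' k') \<longleftrightarrow>
    (i = i' \<or> snd (jchart i k) j $ 1 \<noteq> 0) \<and> (k = k' \<or> snd (jchart i k) j $ 2 \<noteq> 0)"
  by (simp add: jchart_in[of j i' k'] jchart_points(2)[OF j] abs_affine_in_chart)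
    (simp add: jchart_points(1)[OF j] abs_affine_in_chart)

lemma jchart_transition:
  assumes j: "j \<in> fst (jchart i k)" and j': "j \<in> fst (jchart i' k')"
  shows "snd (jchart i' k') j = target_flip k k' (source_flip i i' (snd (jchart i k) j))"
proof -
  have j2: "j \<in> fst (jchart i' k)" using j j' by (simp add: jchart_in)
  show ?thesis using jchart_target_flip[OF j2 j'] jchart_source_flip[OF j j2] by simp
qed

lemma jet2_atlas_eq: "jet2_atlas = range (\<lambda>p. jchart (fst p) (snd p))"
proof (intro set_eqI iffI)
  fix \<kappa> assume "\<kappa> \<in> jet2_atlas"
  then obtain i k where "\<kappa> = jchart i k" unfolding jet2_atlas_def cp1_atlas_def by blast
  then show "\<kappa> \<in> range (\<lambda>p. jchart (fst p) (snd p))" by (intro range_eqI[of _ _ "(i, k)"]) simp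
qed (unfold jet2_atlas_def cp1_atlas_def, blast)

lemma immersion_jets_eq: "immersion_jets = {j. \<forall>i k. j \<in> fst (jchart i k) \<longrightarrow> snd (jchart i k) j $ 3 \<noteq> 0}"
  by (simp add: immersion_jets_def jet2_atlas_eq)

text \<open>Both flips multiply the third coordinate by a factor without zeros,
  \<open>- z\<^sup>2\<close> or \<open>- 1 / w\<^sup>2\<close>, so one chart decides.\<close>

lemma immersion_jets_iff:
  assumes j: "j \<in> fst (jchart i k)"
  shows "j \<in> immersion_jets \<longleftrightarrow> snd (jchart i k) j $ 3 \<noteq> 0"
proof
  assume "snd (jchart i k) j $ 3 \<noteq> 0"
  then have "snd (jchart i' k') j $ 3 \<noteq> 0" if j': "j \<in> fst (jchart i' k')" for i' k'
    using j' unfolding jchart_transition[OF j j'] jchart_in_iff[OF j]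
    by (cases "i = i'"; cases "k = k'") (auto simp: target_flip_def source_flip_def vector_4_component)
  then show "j \<in> immersion_jets" by (simp add: immersion_jets_eq)
qed (use j in \<open>simp add: immersion_jets_eq\<close>)

definition ichart :: "2 \<Rightarrow> 2 \<Rightarrow> (jet2, complex^4) chart" where
  "ichart i k = (fst (jchart i k) \<inter> immersion_jets, snd (jchart i k))"

lemma immersion_atlas_eq: "immersion_atlas = range (\<lambda>p. ichart (fst p) (snd p))"
  by (simp add: immersion_atlas_def jet2_atlas_eq ichart_def image_image)

lemma ichart_in_atlas: "ichart i k \<in> immersion_atlas"
  unfolding immersion_atlas_eq by (rule range_eqI[of _ _ "(i, k)"]) simp

lemma immersion_atlas_cases:
  assumes "\<kappa> \<in> immersion_atlas" obtains i k where "\<kappa> = ichart i k"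
  using assms unfolding immersion_atlas_eq by blast

lemma inj_ichart: "inj_on (snd (ichart i k)) (fst (ichart i k))"
  using inj_on_subset[OF inj_jchart] by (auto simp: ichart_def)

lemma jet_inv_immersion: "jet_inv i k v \<in> immersion_jets \<longleftrightarrow> v $ 3 \<noteq> 0"
  by (simp add: immersion_jets_iff[OF jet_inv_in] jet_inv_coords)

lemma ichart_transition_domain:
  "snd (ichart i k) ` (fst (ichart i k) \<inter> fst (ichart i' k'))
    = {v. v $ 3 \<noteq> 0 \<and> (i = i' \<or> v $ 1 \<noteq> 0) \<and> (k = k' \<or> v $ 2 \<noteq> 0)}" (is "?L = ?R")
proof
  show "?L \<subseteq> ?R"
  proof
    fix v assume "v \<in> ?L"
    then obtain j where j: "v = snd (jchart i k) j" "j \<in> fst (jchart i k)" "j \<in> fst (jchart i' k')" "j \<in> immersion_jets"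
      by (force simp: ichart_def)
    then show "v \<in> ?R" using immersion_jets_iff[OF j(2)] jchart_in_iff[OF j(2), of i' k'] by simp
  qed
  show "?R \<subseteq> ?L"
  proof
    fix v assume "v \<in> ?R"
    then have "jet_inv i k v \<in> fst (ichart i k) \<inter> fst (ichart i' k')"
      using jchart_in_iff[OF jet_inv_in] by (simp add: ichart_def jet_inv_in jet_inv_coords jet_inv_immersion)
    moreover have "v = snd (ichart i k) (jet_inv i k v)" by (simp add: ichart_def jet_inv_coords)
    ultimately show "v \<in> ?L" by blast
  qed
qed

lemma ichart_image: "snd (ichart i k) ` fst (ichart i k) = {v. v $ 3 \<noteq> 0}"
  using ichart_transition_domain[of i k i k] by simp

lemma chart_inv_ichart: "v $ 3 \<noteq> 0 \<Longrightarrow> chart_inv (ichart i k) v = jet_inv i k v"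
  using chart_inv_left[OF inj_ichart, of "jet_inv i k v" i k]
  by (simp add: ichart_def jet_inv_in jet_inv_coords jet_inv_immersion)

lemma ichart_local_rep_id:
  assumes "v $ 3 \<noteq> 0" "i = i' \<or> v $ 1 \<noteq> 0" "k = k' \<or> v $ 2 \<noteq> 0"
  shows "local_rep (ichart i k) (ichart i' k') id v = target_flip k k' (source_flip i i' v)"
proof -
  have "jet_inv i k v \<in> fst (jchart i' k')" using assms jchart_in_iff[OF jet_inv_in] by (simp add: jet_inv_coords)
  from jchart_transition[OF jet_inv_in this] show ?thesis
    using assms(1) by (simp add: local_rep_def chart_inv_ichart jet_inv_coords) (simp add: ichart_def)
qed

section \<open>Invariance of the contact system under coordinate changes\<close>

definition contact_form1 :: "complex^4 \<Rightarrow> complex^4" where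
  "contact_form1 v = axis 2 1 - (v $ 3) *s axis 1 1"

definition contact_form2 :: "complex^4 \<Rightarrow> complex^4" where
  "contact_form2 v = axis 3 1 - (v $ 4) *s axis 1 1"

lemma contact_bundle_eq: "contact_bundle \<kappa> j = vec.span {contact_form1 (snd \<kappa> j), contact_form2 (snd \<kappa> j)}"
  by (simp add: contact_bundle_def contact_form1_def contact_form2_def)

lemma axis_vector_matrix: "axis m 1 v* (J :: complex^'n^'l) = J $ m"
  by (simp add: vec_eq_iff vector_matrix_mult_def axis_def if_distrib[of "\<lambda>a. a * _"] cong: if_cong)

lemma contact_form_pullback:
  "contact_form1 v v* J = J $ 2 - (v $ 3) *s J $ 1" "contact_form2 v v* J = J $ 3 - (v $ 4) *s J $ 1"
  unfolding contact_form1_def contact_form2_def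
  by (simp_all add: vector_matrix_mult_diff_distrib scalar_vector_matrix_assoc axis_vector_matrix)

text \<open>Stated at one point, for the span and with an explicit Jacobian, so that composition of
  maps becomes a product of matrices.\<close>

definition contact_preserving :: "(complex^4 \<Rightarrow> complex^4) \<Rightarrow> complex^4 \<Rightarrow> bool" where
  "contact_preserving T v \<longleftrightarrow> (\<exists>J. (\<forall>m. has_cgradient (\<lambda>x. T x $ m) (J $ m) v) \<and>
    (\<lambda>\<theta>. \<theta> v* J) ` vec.span {contact_form1 (T v), contact_form2 (T v)} = vec.span {contact_form1 v, contact_form2 v})"

text \<open>Prolonged coordinate changes also preserve the contact line of 1-jets, which is spanned
  by the first form alone. The action on the two forms is therefore triangular, and nonzero diagonal
  factors suffice.\<close>

lemma contact_preservingI: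
  assumes J: "\<And>m. has_cgradient (\<lambda>x. T x $ m) (J $ m) v"
    and 1: "contact_form1 (T v) v* J = a *s contact_form1 v"
    and 2: "contact_form2 (T v) v* J = b *s contact_form1 v + c *s contact_form2 v"
    and nz: "a \<noteq> 0" "c \<noteq> 0"
  shows "contact_preserving T v"
  unfolding contact_preserving_def
  using J span_pair_triangular[OF nz, of "contact_form1 v" b "contact_form2 v"] 1 2
  by (intro exI[of _ J]) (simp add: span_image_matrix)

lemma contact_preserving_id: "contact_preserving (\<lambda>v. v) v"
proof (rule contact_preservingI[of _ "mat 1" _ 1 0 1])
  have "mat 1 $ m = (axis m 1 :: complex^4)" for m by (simp add: vec_eq_iff mat_def axis_def eq_commute)
  then show "has_cgradient (\<lambda>x. x $ m) (mat 1 $ m) v" for m by (simp add: has_cgradient_nth)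
qed (simp_all add: vector_matrix_mul_rid)

lemma contact_preserving_compose:
  assumes "contact_preserving S v" "contact_preserving T (S v)"
  shows "contact_preserving (\<lambda>v. T (S v)) v"
proof -
  obtain J where J: "\<And>m. has_cgradient (\<lambda>x. S x $ m) (J $ m) v"
    "(\<lambda>\<theta>. \<theta> v* J) ` vec.span {contact_form1 (S v), contact_form2 (S v)} = vec.span {contact_form1 v, contact_form2 v}"
    using assms(1) by (auto simp: contact_preserving_def)
  obtain K where K: "\<And>m. has_cgradient (\<lambda>x. T x $ m) (K $ m) (S v)"
    "(\<lambda>\<theta>. \<theta> v* K) ` vec.span {contact_form1 (T (S v)), contact_form2 (T (S v))} = vec.span {contact_form1 (S v), contact_form2 (S v)}"
    using assms(2) by (auto simp: contact_preserving_def)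
  have "has_cgradient (\<lambda>x. T (S x) $ m) ((K ** J) $ m) v" for m
    using has_cgradient_compose[OF J(1) K(1)[of m]] by (simp add: vector_matrix_mult_def matrix_matrix_mult_def)
  moreover have "(\<lambda>\<theta>. \<theta> v* (K ** J)) ` vec.span {contact_form1 (T (S v)), contact_form2 (T (S v))} = vec.span {contact_form1 v, contact_form2 v}"
    by (simp only: J(2)[symmetric] K(2)[symmetric] image_image vector_matrix_mul_assoc)
  ultimately show ?thesis unfolding contact_preserving_def by blast
qed

lemma has_cgradient_eq_rhs: "has_cgradient f g x \<Longrightarrow> g = g' \<Longrightarrow> has_cgradient f g' x"
  by simp

lemma contact_preserving_source_flip:
  assumes "i = i' \<or> v $ 1 \<noteq> 0" shows "contact_preserving (source_flip i i') v"
proof (cases "i = i'")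
  case True
  then have "source_flip i i' = (\<lambda>v. v)" by (simp add: source_flip_def fun_eq_iff)
  then show ?thesis by (simp add: contact_preserving_id)
next
  case False
  define z where "z = v $ 1"
  have z: "z \<noteq> 0" using assms False by (simp add: z_def)
  \<comment> \<open>The rows are the gradients of the four components of \<open>source_flip\<close>
    at \<open>v\<close>.\<close>
  define J :: "complex^4^4" where "J = vector [vector [- 1 / z\<^sup>2, 0, 0, 0], vector [0, 1, 0, 0],
    vector [- 2 * z * v $ 3, 0, - z\<^sup>2, 0], vector [4 * z ^ 3 * v $ 4 + 6 * z\<^sup>2 * v $ 3, 0, 2 * z ^ 3, z ^ 4]]"
  have S: "source_flip i i' = (\<lambda>v. vector [1 / v $ 1, v $ 2, - (v $ 1)\<^sup>2 * v $ 3, (v $ 1) ^ 4 * v $ 4 + 2 * (v $ 1) ^ 3 * v $ 3])"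
    using False by (simp add: source_flip_def fun_eq_iff)
  show ?thesis
  \<comment> \<open>For \<open>s = 1 / z\<close> the product \<open>w\<^sub>s ds\<close> equals
    \<open>w\<^sub>z dz\<close>, so the first form is unchanged. The second is scaled by the factor
    in \<open>w\<^sub>s = - z\<^sup>2 w\<^sub>z\<close>.\<close>
  proof (rule contact_preservingI[of _ J _ 1 0 "- z\<^sup>2"])
    note mult = has_cgradient_mult and nth = has_cgradient_nth and power = has_cgradient_power[OF has_cgradient_nth]
    have "has_cgradient (\<lambda>v. 1 / v $ 1) (J $ 1) v"
      by (rule has_cgradient_eq_rhs[OF has_cgradient_divide[OF has_cgradient_const nth]])
        (use z in \<open>simp_all add: vec_eq_iff forall_4 J_def vector_4_component axis_def z_def\<close>)
    moreover have "has_cgradient (\<lambda>v. v $ 2) (J $ 2) v"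
      by (rule has_cgradient_eq_rhs[OF nth]) (simp add: vec_eq_iff forall_4 J_def vector_4_component axis_def)
    moreover have "has_cgradient (\<lambda>v. - (v $ 1)\<^sup>2 * v $ 3) (J $ 3) v"
      by (rule has_cgradient_eq_rhs[OF mult[OF has_cgradient_minus[OF power] nth]])
        (simp add: vec_eq_iff forall_4 J_def vector_4_component axis_def z_def)
    moreover have "has_cgradient (\<lambda>v. (v $ 1) ^ 4 * v $ 4 + 2 * (v $ 1) ^ 3 * v $ 3) (J $ 4) v"
      by (rule has_cgradient_eq_rhs[OF has_cgradient_add[OF mult[OF power nth] mult[OF has_cgradient_scale[OF power] nth]]])
        (simp add: vec_eq_iff forall_4 J_def vector_4_component axis_def z_def)
    ultimately show "has_cgradient (\<lambda>x. source_flip i i' x $ m) (J $ m) v" for m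
      unfolding S using exhaust_4[of m] by (auto simp: vector_4_component)
    show "contact_form1 (source_flip i i' v) v* J = 1 *s contact_form1 v"
      using z by (simp add: contact_form_pullback S vector_4_component J_def)
        (simp add: vec_eq_iff forall_4 vector_4_component contact_form1_def axis_def z_def)
    show "contact_form2 (source_flip i i' v) v* J = 0 *s contact_form1 v + (- z\<^sup>2) *s contact_form2 v"
      using z by (simp add: contact_form_pullback S vector_4_component J_def)
        (simp add: vec_eq_iff forall_4 vector_4_component contact_form2_def axis_def z_def field_simps power2_eq_square power3_eq_cube power4_eq_xxxx)
  qed (use z in auto)
qed

lemma contact_preserving_target_flip:
  assumes "k = k' \<or> v $ 2 \<noteq> 0" shows "contact_preserving (target_flip k k') v"
proof (cases "k = k'")
  case True
  then have "target_flip k k' = (\<lambda>v. v)" by (simp add: target_flip_def fun_eq_iff)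
  then show ?thesis by (simp add: contact_preserving_id)
next
  case False
  define w where "w = v $ 2"
  have w: "w \<noteq> 0" using assms False by (simp add: w_def)
  define J :: "complex^4^4" where "J = vector [vector [1, 0, 0, 0], vector [0, - 1 / w\<^sup>2, 0, 0],
    vector [0, 2 * v $ 3 / w ^ 3, - 1 / w\<^sup>2, 0],
    vector [0, 2 * v $ 4 / w ^ 3 - 6 * (v $ 3)\<^sup>2 / w ^ 4, 4 * v $ 3 / w ^ 3, - 1 / w\<^sup>2]]"
  have T: "target_flip k k' = (\<lambda>v. vector [v $ 1, 1 / v $ 2, - v $ 3 / (v $ 2)\<^sup>2, 2 * (v $ 3)\<^sup>2 / (v $ 2) ^ 3 - v $ 4 / (v $ 2)\<^sup>2])"
    using False by (simp add: target_flip_def fun_eq_iff)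
  show ?thesis
  \<comment> \<open>The first form is scaled by the derivative \<open>- 1 / w\<^sup>2\<close> of
    \<open>1 / w\<close>. The derivative of this factor along the curve,
    \<open>2 w\<^sub>z / w\<^sup>3\<close>, is the off-diagonal coefficient.\<close>
  proof (rule contact_preservingI[of _ J _ "- 1 / w\<^sup>2" "2 * v $ 3 / w ^ 3" "- 1 / w\<^sup>2"])
    note divide = has_cgradient_divide and nth = has_cgradient_nth and power = has_cgradient_power[OF has_cgradient_nth]
    have "has_cgradient (\<lambda>v. v $ 1) (J $ 1) v"
      by (rule has_cgradient_eq_rhs[OF nth]) (simp add: vec_eq_iff forall_4 J_def vector_4_component axis_def)
    moreover have "has_cgradient (\<lambda>v. 1 / v $ 2) (J $ 2) v"
      by (rule has_cgradient_eq_rhs[OF divide[OF has_cgradient_const nth]])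
        (use w in \<open>simp_all add: vec_eq_iff forall_4 J_def vector_4_component axis_def w_def\<close>)
    moreover have "has_cgradient (\<lambda>v. - v $ 3 / (v $ 2)\<^sup>2) (J $ 3) v"
      by (rule has_cgradient_eq_rhs[OF divide[OF has_cgradient_minus[OF nth] power]])
        (use w in \<open>simp_all add: vec_eq_iff forall_4 J_def vector_4_component axis_def w_def field_simps power2_eq_square power3_eq_cube\<close>)
    moreover have "has_cgradient (\<lambda>v. 2 * (v $ 3)\<^sup>2 / (v $ 2) ^ 3 - v $ 4 / (v $ 2)\<^sup>2) (J $ 4) v"
      by (rule has_cgradient_eq_rhs[OF has_cgradient_diff[OF divide[OF has_cgradient_scale[OF power] power] divide[OF nth power]]])
        (use w in \<open>simp_all add: vec_eq_iff forall_4 J_def vector_4_component axis_def w_def field_simps power2_eq_square power3_eq_cube power4_eq_xxxx\<close>)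
    ultimately show "has_cgradient (\<lambda>x. target_flip k k' x $ m) (J $ m) v" for m
      unfolding T using exhaust_4[of m] by (auto simp: vector_4_component)
    show "contact_form1 (target_flip k k' v) v* J = (- 1 / w\<^sup>2) *s contact_form1 v"
      using w by (simp add: contact_form_pullback T vector_4_component J_def)
        (simp add: vec_eq_iff forall_4 vector_4_component contact_form1_def axis_def w_def)
    show "contact_form2 (target_flip k k' v) v* J = (2 * v $ 3 / w ^ 3) *s contact_form1 v + (- 1 / w\<^sup>2) *s contact_form2 v"
      using w by (simp add: contact_form_pullback T vector_4_component J_def)
        (simp add: vec_eq_iff forall_4 vector_4_component contact_form1_def contact_form2_def axis_def w_def field_simps power2_eq_square power3_eq_cube)
  qed (use w in auto)
qed

lemma contact_preserving_transition:
  assumes "i = i' \<or> v $ 1 \<noteq> 0" "k = k' \<or> v $ 2 \<noteq> 0"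
  shows "contact_preserving (\<lambda>v. target_flip k k' (source_flip i i' v)) v"
proof -
  have "source_flip i i' v $ 2 = v $ 2" by (simp add: source_flip_def vector_4_component)
  then show ?thesis
    using assms
    by (intro contact_preserving_compose[OF contact_preserving_source_flip contact_preserving_target_flip]) simp_all
qed

section \<open>Open coordinate domains and separation of points\<close>

lemma open_nth_nonzero: "open {v :: complex^'n. v $ i \<noteq> 0}"
  by (intro open_Collect_neq continuous_intros)

lemma open_ichart_domain:
  "open {v :: complex^4. v $ 3 \<noteq> 0 \<and> (P \<or> v $ 1 \<noteq> 0) \<and> (Q \<or> v $ 2 \<noteq> 0)}"
  by (cases P; cases Q) (auto intro!: open_Collect_conj open_nth_nonzero)

text \<open>The first row of the orthogonal projection \<open>v v\<^sup>* / |v|\<^sup>2\<close> onto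
  the line of \<open>v\<close>. It is homogeneous of degree zero, hence defined on the projective
  line, and it serves as a continuous injection into a Hausdorff space.\<close>

definition cp1_embed :: "cp1 \<Rightarrow> complex \<times> complex" where
  "cp1_embed x = (let v = rep_cp1 x; n = v $ 1 * cnj (v $ 1) + v $ 2 * cnj (v $ 2)
    in (v $ 1 * cnj (v $ 1) / n, v $ 1 * cnj (v $ 2) / n))"

lemma jet_inv_points:
  "cp1_embed (jet_source (jet_inv i k v)) = cp1_embed (abs_cp1 (affine_vec i (v $ 1)))"
  "cp1_embed (jet_map (jet_inv i k v) (jet_source (jet_inv i k v))) = cp1_embed (abs_cp1 (affine_vec k (v $ 2)))"
  using jchart_points[OF jet_inv_in] by (simp_all only: jet_inv_coords)

lemma norm_sum_nonzero: "(v :: complex^2) \<noteq> 0 \<Longrightarrow> v $ 1 * cnj (v $ 1) + v $ 2 * cnj (v $ 2) \<noteq> 0"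
proof
  assume v: "v \<noteq> 0" and "v $ 1 * cnj (v $ 1) + v $ 2 * cnj (v $ 2) = 0"
  then have "complex_of_real ((cmod (v $ 1))\<^sup>2 + (cmod (v $ 2))\<^sup>2) = 0"
    by (simp only: of_real_add complex_norm_square)
  then have "(cmod (v $ 1))\<^sup>2 + (cmod (v $ 2))\<^sup>2 = 0" by (simp only: of_real_eq_0_iff)
  then show False using v by (simp add: sum_power2_eq_zero_iff vec_eq_iff forall_2)
qed

lemma cp1_embed_abs:
  assumes "v \<noteq> 0"
  shows "cp1_embed (abs_cp1 v) = (let n = v $ 1 * cnj (v $ 1) + v $ 2 * cnj (v $ 2)
    in (v $ 1 * cnj (v $ 1) / n, v $ 1 * cnj (v $ 2) / n))"
proof -
  obtain c where c: "c \<noteq> 0" "rep_cp1 (abs_cp1 v) = c *s v" using cp1_rep_abs[OF assms] by blast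
  define n where "n = v $ 1 * cnj (v $ 1) + v $ 2 * cnj (v $ 2)"
  define d where "d = c * cnj c"
  have "d \<noteq> 0" using c by (simp add: d_def)
  have e: "c * v $ i * cnj (c * v $ j) = d * (v $ i * cnj (v $ j))" for i j by (simp add: d_def)
  have "cp1_embed (abs_cp1 v) = (d * (v $ 1 * cnj (v $ 1)) / (d * n), d * (v $ 1 * cnj (v $ 2)) / (d * n))"
    unfolding cp1_embed_def c(2) Let_def vector_smult_component e n_def distrib_left by (rule refl)
  then show ?thesis using \<open>d \<noteq> 0\<close> by (simp add: Let_def n_def)
qed

text \<open>If the first entry vanishes, the point is \<open>[0, 1]\<close>. Otherwise the conjugate
  of the quotient of the two entries is the affine coordinate \<open>q / p\<close>.\<close>

lemma inj_cp1_embed: "inj cp1_embed"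
proof (rule injI)
  fix x y assume eq: "cp1_embed x = cp1_embed y"
  define n where "n = (\<lambda>x. rep_cp1 x $ 1 * cnj (rep_cp1 x $ 1) + rep_cp1 x $ 2 * cnj (rep_cp1 x $ 2))"
  have n: "n z \<noteq> 0" for z unfolding n_def by (rule norm_sum_nonzero[OF cp1_rep_nonzero])
  have e: "cp1_embed z = (rep_cp1 z $ 1 * cnj (rep_cp1 z $ 1) / n z, rep_cp1 z $ 1 * cnj (rep_cp1 z $ 2) / n z)" for z
    by (simp add: cp1_embed_def n_def Let_def)
  have zero: "rep_cp1 z $ 1 = 0 \<longleftrightarrow> fst (cp1_embed z) = 0" for z using n[of z] by (simp add: e)
  show "x = y"
  proof (cases "rep_cp1 x $ 1 = 0")
    case True
    have "(2::2) + 1 = 1" by simp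
    then have coord: "snd (affine_chart 2) z = rep_cp1 z $ 1 / rep_cp1 z $ 2" for z
      by (simp only: affine_chart_def snd_conv)
    have "rep_cp1 y $ 1 = 0" using True zero[of x] zero[of y] eq by simp
    then have "x \<in> fst (affine_chart 2)" "y \<in> fst (affine_chart 2)" "snd (affine_chart 2) x = snd (affine_chart 2) y"
      using True cp1_rep_nonzero[of x] cp1_rep_nonzero[of y]
      by (auto simp: coord, auto simp: affine_chart_def vec_eq_iff forall_2)
    then show ?thesis using inj_onD[OF inj_affine_chart] by blast
  next
    case False
    have c: "rep_cp1 z $ 2 / rep_cp1 z $ 1 = cnj (snd (cp1_embed z) / fst (cp1_embed z))" if "rep_cp1 z $ 1 \<noteq> 0" for z
      using n[of z] that by (simp add: e)
    have "rep_cp1 y $ 1 \<noteq> 0" using False zero[of x] zero[of y] eq by simp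
    then have "x \<in> fst (affine_chart 1)" "y \<in> fst (affine_chart 1)" "snd (affine_chart 1) x = snd (affine_chart 1) y"
      using False c[of x] c[of y] eq by (auto simp: affine_chart_def)
    then show ?thesis using inj_onD[OF inj_affine_chart] by blast
  qed
qed

lemma continuous_affine_vec_nth: "continuous_on UNIV (\<lambda>t. affine_vec i t $ m)"
  by (cases "m = i") (auto simp: affine_vec_def)

lemma continuous_cp1_embed_affine: "continuous_on UNIV (\<lambda>t. cp1_embed (abs_cp1 (affine_vec i t)))"
proof -
  note a = continuous_affine_vec_nth[of i 1] and b = continuous_affine_vec_nth[of i 2]
  note n = continuous_on_add[OF continuous_on_mult[OF a continuous_on_cnj[OF a]] continuous_on_mult[OF b continuous_on_cnj[OF b]]]
  show ?thesis
    unfolding cp1_embed_abs[OF affine_vec_simps(3)] Let_def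
    by (rule continuous_on_Pair[OF continuous_on_divide[OF continuous_on_mult[OF a continuous_on_cnj[OF a]] n]
          continuous_on_divide[OF continuous_on_mult[OF a continuous_on_cnj[OF b]] n]])
      (simp_all only: norm_sum_nonzero[OF affine_vec_simps(3)] not_False_eq_True ball_simps simp_thms)
qed

lemma continuous_cp1_embed_affine':
  assumes "continuous_on S f" shows "continuous_on S (\<lambda>u. cp1_embed (abs_cp1 (affine_vec i (f u))))"
  by (rule continuous_on_compose2[OF continuous_cp1_embed_affine assms]) simp

lemma holomorphic_map_on_flips:
  "holomorphic_map_on (\<lambda>v. target_flip k k' (source_flip i i' v))
    {v. v $ 3 \<noteq> 0 \<and> (i = i' \<or> v $ 1 \<noteq> 0) \<and> (k = k' \<or> v $ 2 \<noteq> 0)}"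
  unfolding holomorphic_map_on_def
proof (intro allI holomorphic_fun_onI)
  fix m and v :: "complex^4" assume "v \<in> {v. v $ 3 \<noteq> 0 \<and> (i = i' \<or> v $ 1 \<noteq> 0) \<and> (k = k' \<or> v $ 2 \<noteq> 0)}"
  then show "\<exists>g. has_cgradient (\<lambda>v. target_flip k k' (source_flip i i' v) $ m) g v"
    using contact_preserving_transition[of i i' v k k'] unfolding contact_preserving_def by blast
qed

lemma carrier_immersion_atlas: "carrier_of immersion_atlas = immersion_jets"
proof -
  have "\<exists>i k. j \<in> fst (jchart i k)" for j
    using cp1_in_some_chart[of "jet_source j"] cp1_in_some_chart[of "jet_map j (jet_source j)"] by (metis jchart_in)
  then show ?thesis by (auto simp: carrier_of_def immersion_atlas_eq ichart_def)
qed

text \<open>Jets with the same source and the same target share a chart, so the separating map only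
  has to record these two points of the projective line.\<close>

lemma complex_manifold_immersion_atlas: "complex_manifold immersion_atlas"
proof (rule complex_manifoldI[where f = "\<lambda>j. (cp1_embed (jet_source j), cp1_embed (jet_map j (jet_source j)))"])
  show "countable immersion_atlas" unfolding immersion_atlas_eq by (intro countable_finite finite_imageI finite)
  fix \<kappa> assume "\<kappa> \<in> immersion_atlas"
  then obtain i k where k: "\<kappa> = ichart i k" by (elim immersion_atlas_cases)
  show "inj_on (snd \<kappa>) (fst \<kappa>)" by (simp add: k inj_ichart)
  have "continuous_on {v. v $ 3 \<noteq> 0} (\<lambda>v. (cp1_embed (abs_cp1 (affine_vec i (v $ 1))), cp1_embed (abs_cp1 (affine_vec k (v $ 2)))))"
    by (intro continuous_on_Pair continuous_cp1_embed_affine' continuous_intros)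
  then show "continuous_on (snd \<kappa> ` fst \<kappa>) (\<lambda>u. (cp1_embed (jet_source (chart_inv \<kappa> u)),
      cp1_embed (jet_map (chart_inv \<kappa> u) (jet_source (chart_inv \<kappa> u)))))"
    unfolding k ichart_image
    by (rule continuous_on_cong[THEN iffD1, rotated -1])
      (simp_all add: chart_inv_ichart jet_inv_points)
  fix \<kappa>' assume "\<kappa>' \<in> immersion_atlas"
  then obtain i' k' where k': "\<kappa>' = ichart i' k'" by (elim immersion_atlas_cases)
  show "open (snd \<kappa> ` (fst \<kappa> \<inter> fst \<kappa>'))" unfolding k k' ichart_transition_domain by (rule open_ichart_domain)
  show "holomorphic_map_on (local_rep \<kappa> \<kappa>' id) (snd \<kappa> ` (fst \<kappa> \<inter> fst \<kappa>'))"
    unfolding k k' ichart_transition_domain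
    by (rule holomorphic_map_on_transform[OF holomorphic_map_on_flips open_ichart_domain]) (simp add: ichart_local_rep_id)
next
  fix j j' assume jj: "j \<in> carrier_of immersion_atlas" "j' \<in> carrier_of immersion_atlas"
    and "(cp1_embed (jet_source j), cp1_embed (jet_map j (jet_source j))) = (cp1_embed (jet_source j'), cp1_embed (jet_map j' (jet_source j')))"
  then have eq: "jet_source j = jet_source j'" "jet_map j (jet_source j) = jet_map j' (jet_source j')"
    using injD[OF inj_cp1_embed] by auto
  obtain i where "jet_source j \<in> fst (affine_chart i)" using cp1_in_some_chart .
  moreover obtain k where "jet_map j (jet_source j) \<in> fst (affine_chart k)" using cp1_in_some_chart .
  ultimately have "j \<in> fst (ichart i k) \<and> j' \<in> fst (ichart i k)"
    using jj eq by (simp add: ichart_def jchart_in carrier_immersion_atlas)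
  then show "\<exists>\<kappa>\<in>immersion_atlas. j \<in> fst \<kappa> \<and> j' \<in> fst \<kappa>" using ichart_in_atlas by blast
qed

lemma holomorphic_contact_forms: "holomorphic_map_on contact_form1 V" "holomorphic_map_on contact_form2 V"
  unfolding holomorphic_map_on_def contact_form1_def contact_form2_def
  by (auto intro!: holomorphic_fun_intros)

lemma dim_contact: "vec.dim (vec.span {contact_form1 v, contact_form2 v}) = 2"
  by (rule dim_span_pair) (auto simp: contact_form1_def contact_form2_def vec_eq_iff forall_4 axis_def)

lemma holomorphic_subbundle_contact: "holomorphic_subbundle immersion_atlas 2 contact_bundle"
  unfolding holomorphic_subbundle_def
proof (intro conjI ballI)
  fix \<kappa> j assume "\<kappa> \<in> immersion_atlas" and j: "j \<in> fst \<kappa>"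
  then obtain i k where k: "\<kappa> = ichart i k" by (elim immersion_atlas_cases)
  let ?\<theta> = "\<lambda>n::nat. if n = 0 then contact_form1 else contact_form2"
  have im: "(\<lambda>n. ?\<theta> n u) ` {..<2} = {contact_form1 u, contact_form2 u}" for u
    by (auto simp: lessThan_nat_numeral lessThan_Suc image_iff split: if_splits)
  have "contact_bundle \<kappa> (chart_inv \<kappa> u) = vec.span {contact_form1 u, contact_form2 u}" if "u \<in> snd \<kappa> ` fst \<kappa>" for u
    by (simp add: contact_bundle_eq chart_inv_right[OF that])
  then show "\<exists>V \<theta>. open V \<and> snd \<kappa> j \<in> V \<and> V \<subseteq> snd \<kappa> ` fst \<kappa> \<and> (\<forall>i<2::nat. holomorphic_map_on (\<theta> i) V) \<and>
      (\<forall>u\<in>V. contact_bundle \<kappa> (chart_inv \<kappa> u) = vec.span ((\<lambda>i. \<theta> i u) ` {..<2}) \<and>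
             vec.dim (contact_bundle \<kappa> (chart_inv \<kappa> u)) = 2)"
    using j complex_manifoldD(4)[OF complex_manifold_immersion_atlas \<open>\<kappa> \<in> immersion_atlas\<close>] im dim_contact
    by (intro exI[of _ "snd \<kappa> ` fst \<kappa>"] exI[of _ ?\<theta>]) (simp add: holomorphic_contact_forms)
next
  fix \<kappa> \<kappa>' j assume "\<kappa> \<in> immersion_atlas" "\<kappa>' \<in> immersion_atlas" and j: "j \<in> fst \<kappa> \<inter> fst \<kappa>'"
  then obtain i k i' k' where k: "\<kappa> = ichart i k" "\<kappa>' = ichart i' k'" by (elim immersion_atlas_cases) blast
  let ?T = "\<lambda>v. target_flip k k' (source_flip i i' v)" and ?v = "snd \<kappa> j"
  have v: "?v \<in> {v. v $ 3 \<noteq> 0 \<and> (i = i' \<or> v $ 1 \<noteq> 0) \<and> (k = k' \<or> v $ 2 \<noteq> 0)}"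
    using j ichart_transition_domain[of i k i' k'] k by blast
  have Tv: "snd \<kappa>' j = ?T ?v" using j jchart_transition[of j i k i' k'] by (simp add: k ichart_def)
  obtain J where J: "\<And>m. has_cgradient (\<lambda>x. ?T x $ m) (J $ m) ?v"
    "(\<lambda>\<theta>. \<theta> v* J) ` vec.span {contact_form1 (?T ?v), contact_form2 (?T ?v)} = vec.span {contact_form1 ?v, contact_form2 ?v}"
    using contact_preserving_transition[of i i' ?v k k'] v unfolding contact_preserving_def by blast
  have "has_cgradient (\<lambda>x. local_rep \<kappa> \<kappa>' id x $ m) (J $ m) ?v" for m
    by (rule has_cgradient_transform[OF J(1) open_ichart_domain v]) (simp add: k ichart_local_rep_id)
  then have "cjacobian (local_rep \<kappa> \<kappa>' id) ?v = J" by (rule cjacobian_eq)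
  then show "contact_bundle \<kappa> j = (\<lambda>\<theta>. \<theta> v* cjacobian (local_rep \<kappa> \<kappa>' id) ?v) ` contact_bundle \<kappa>' j"
    by (simp add: contact_bundle_eq Tv J(2))
qed

section \<open>The manifold and the system on the product\<close>

definition pchart :: "bool \<Rightarrow> 2 \<Rightarrow> ((complex^2^2) \<times> cp1, complex^4) chart" where
  "pchart c i = (if c then product_chart_a (affine_chart i) else product_chart_b (affine_chart i))"

definition pdom :: "bool \<Rightarrow> complex^4 \<Rightarrow> bool" where
  "pdom c u \<longleftrightarrow> (if c then u $ 1 else u $ 2) \<noteq> 0"

text \<open>The matrix with the given coordinates; its remaining entry is recovered from
  \<open>det = 1\<close>.\<close>

definition pmat :: "bool \<Rightarrow> complex^4 \<Rightarrow> complex^2^2" where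
  "pmat c u = vector [vector [u $ 1, u $ 2],
    if c then vector [u $ 3, (1 + u $ 2 * u $ 3) / u $ 1] else vector [(u $ 1 * u $ 3 - 1) / u $ 2, u $ 3]]"

lemma pmat_simps:
  "pmat c u $ 1 $ 1 = u $ 1" "pmat c u $ 1 $ 2 = u $ 2"
  "pmat c u $ 2 $ 1 = (if c then u $ 3 else (u $ 1 * u $ 3 - 1) / u $ 2)"
  "pmat c u $ 2 $ 2 = (if c then (1 + u $ 2 * u $ 3) / u $ 1 else u $ 3)"
  by (simp_all add: pmat_def)

lemma det_pmat: "pdom c u \<Longrightarrow> det (pmat c u) = 1"
  by (cases c) (simp_all add: det_2 pmat_simps pdom_def)

lemma pmat_in_SL2: "pdom c u \<Longrightarrow> pmat c u \<in> SL2"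
  by (simp add: SL2_def det_pmat)

lemma product_atlas_eq: "product_atlas = range (\<lambda>p. pchart (fst p) (snd p))"
proof (intro set_eqI iffI)
  fix \<kappa> assume "\<kappa> \<in> product_atlas"
  then consider i where "\<kappa> = product_chart_a (affine_chart i)" | i where "\<kappa> = product_chart_b (affine_chart i)"
    unfolding product_atlas_def cp1_atlas_def by blast
  then show "\<kappa> \<in> range (\<lambda>p. pchart (fst p) (snd p))"
  proof cases
    case (1 i) then show ?thesis by (intro range_eqI[of _ _ "(True, i)"]) (simp add: pchart_def)
  next
    case (2 i) then show ?thesis by (intro range_eqI[of _ _ "(False, i)"]) (simp add: pchart_def)
  qed
next
  fix \<kappa> assume "\<kappa> \<in> range (\<lambda>p. pchart (fst p) (snd p))"
  then obtain p where "\<kappa> = pchart (fst p) (snd p)" by (rule rangeE)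
  then show "\<kappa> \<in> product_atlas"
    by (cases "fst p") (simp_all add: pchart_def product_atlas_def cp1_atlas_def)
qed

lemma pchart_in_atlas: "pchart c i \<in> product_atlas"
  unfolding product_atlas_eq by (rule range_eqI[of _ _ "(c, i)"]) simp

lemma product_atlas_cases:
  assumes "\<kappa> \<in> product_atlas" obtains c i where "\<kappa> = pchart c i"
  using assms unfolding product_atlas_eq by blast

lemma fst_pchart: "fst (pchart c i) = {(A, x). A \<in> SL2 \<and> (if c then A $ 1 $ 1 else A $ 1 $ 2) \<noteq> 0 \<and> x \<in> fst (affine_chart i)}"
  unfolding pchart_def product_chart_a_def product_chart_b_def by (cases c) simp_all

lemma snd_pchart: "snd (pchart c i) (A, x) =
    vector [A $ 1 $ 1, A $ 1 $ 2, if c then A $ 2 $ 1 else A $ 2 $ 2, snd (affine_chart i) x]"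
  unfolding pchart_def product_chart_a_def product_chart_b_def by (cases c) simp_all

lemma pmat_snd_pchart:
  assumes "(A, x) \<in> fst (pchart c i)" shows "pmat c (snd (pchart c i) (A, x)) = A"
proof -
  have "A $ 1 $ 1 * A $ 2 $ 2 - A $ 1 $ 2 * A $ 2 $ 1 = 1" using assms by (simp add: fst_pchart SL2_def det_2)
  then have "A $ 1 $ 1 * A $ 2 $ 2 = 1 + A $ 1 $ 2 * A $ 2 $ 1" by (simp add: algebra_simps)
  then show ?thesis
    using assms by (cases c) (simp_all add: vec_eq_iff forall_2 pmat_simps snd_pchart vector_4_component fst_pchart field_simps)
qed

definition pinv :: "bool \<Rightarrow> 2 \<Rightarrow> complex^4 \<Rightarrow> (complex^2^2) \<times> cp1" where
  "pinv c i u = (pmat c u, abs_cp1 (affine_vec i (u $ 4)))"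

lemma pinv_snd_pchart: "m \<in> fst (pchart c i) \<Longrightarrow> pinv c i (snd (pchart c i) m) = m"
  using pmat_snd_pchart[of "fst m" "snd m" c i]
  by (cases m) (simp add: pinv_def snd_pchart vector_4_component affine_chart_back fst_pchart)

lemma inj_pchart: "inj_on (snd (pchart c i)) (fst (pchart c i))"
  by (rule inj_on_inverseI[where g = "pinv c i"]) (rule pinv_snd_pchart)

lemma pinv_in: "pdom c u \<Longrightarrow> pinv c i u \<in> fst (pchart c' i') \<longleftrightarrow> pdom c' u \<and> (i = i' \<or> u $ 4 \<noteq> 0)"
  by (simp add: pinv_def fst_pchart pmat_in_SL2 pmat_simps abs_affine_in_chart pdom_def[of c'])

lemma snd_pchart_pinv:
  "snd (pchart c' i') (pinv c i u) = vector [u $ 1, u $ 2, if c' then pmat c u $ 2 $ 1 else pmat c u $ 2 $ 2, flip i i' (u $ 4)]"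
  by (simp add: pinv_def snd_pchart pmat_simps abs_affine_coord)

lemma snd_pchart_pinv_self: "snd (pchart c i) (pinv c i u) = u"
  by (simp add: snd_pchart_pinv vec_eq_iff forall_4 vector_4_component pmat_simps flip_def)

lemma pdom_snd_pchart: "m \<in> fst (pchart c i) \<Longrightarrow> pdom c (snd (pchart c i) m)"
  by (cases m) (auto simp: fst_pchart pdom_def snd_pchart vector_4_component)

lemma pchart_transition_domain:
  "snd (pchart c i) ` (fst (pchart c i) \<inter> fst (pchart c' i')) = {u. pdom c u \<and> pdom c' u \<and> (i = i' \<or> u $ 4 \<noteq> 0)}"
    (is "?L = ?R")
proof
  show "?L \<subseteq> ?R"
  proof
    fix u assume "u \<in> ?L"
    then obtain m where m: "m \<in> fst (pchart c i)" "m \<in> fst (pchart c' i')" "u = snd (pchart c i) m" by blast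
    then have "pinv c i u \<in> fst (pchart c' i')" "pdom c u" using pinv_snd_pchart pdom_snd_pchart by auto
    then show "u \<in> ?R" using pinv_in by simp
  qed
  show "?R \<subseteq> ?L"
  proof
    fix u assume "u \<in> ?R"
    then have "pinv c i u \<in> fst (pchart c i) \<inter> fst (pchart c' i')" by (simp add: pinv_in)
    then show "u \<in> ?L" using snd_pchart_pinv_self[of c i u] by (metis imageI)
  qed
qed

lemma pchart_image: "snd (pchart c i) ` fst (pchart c i) = {u. pdom c u}"
  using pchart_transition_domain[of c i c i] by simp

lemma chart_inv_pchart: "pdom c u \<Longrightarrow> chart_inv (pchart c i) u = pinv c i u"
  using chart_inv_left[OF inj_pchart, of "pinv c i u" c i] by (simp add: pinv_in snd_pchart_pinv_self)

lemma open_pdom: "open {u. pdom c u}"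
  by (cases c) (simp_all add: pdom_def open_nth_nonzero)

lemma open_pchart_domain: "open {u. pdom c u \<and> pdom c' u \<and> (P \<or> u $ 4 \<noteq> 0)}"
  by (cases P) (auto intro!: open_Collect_conj open_nth_nonzero open_pdom)

lemma holomorphic_pmat: "(\<And>u. u \<in> S \<Longrightarrow> pdom c u) \<Longrightarrow> holomorphic_fun_on (\<lambda>u. pmat c u $ l $ j) S"
  using exhaust_2[of l] exhaust_2[of j]
  by (cases c) (auto simp: pmat_simps pdom_def intro!: holomorphic_fun_intros)

lemma holomorphic_flip:
  "holomorphic_fun_on f S \<Longrightarrow> (\<And>u. u \<in> S \<Longrightarrow> i = i' \<or> f u \<noteq> 0) \<Longrightarrow> holomorphic_fun_on (\<lambda>u. flip i i' (f u)) S"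
  unfolding flip_def by (cases "i = i'") (auto intro!: holomorphic_fun_intros)

lemma holomorphic_map_on_vector4:
  assumes "holomorphic_fun_on a S" "holomorphic_fun_on b S" "holomorphic_fun_on c S" "holomorphic_fun_on d S"
  shows "holomorphic_map_on (\<lambda>u. vector [a u, b u, c u, d u] :: complex^4) S"
  unfolding holomorphic_map_on_def forall_4 vector_4_component using assms by simp

lemma complex_manifold_product_atlas: "complex_manifold product_atlas"
proof (rule complex_manifoldI[where f = "\<lambda>m. (fst m $ 1 $ 1, fst m $ 1 $ 2, fst m $ 2 $ 1, fst m $ 2 $ 2, cp1_embed (snd m))"])
  show "countable product_atlas" unfolding product_atlas_eq by (intro countable_finite finite_imageI finite)
  fix \<kappa> :: "((complex^2^2) \<times> cp1, complex^4) chart" assume "\<kappa> \<in> product_atlas"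
  then obtain c i where k: "\<kappa> = pchart c i" by (elim product_atlas_cases)
  show "inj_on (snd \<kappa>) (fst \<kappa>)" by (simp add: k inj_pchart)
  have entry: "continuous_on {u. pdom c u} (\<lambda>u. pmat c u $ l $ j)" for l j
    by (rule holomorphic_fun_on_imp_continuous_on[OF holomorphic_pmat]) simp
  have "continuous_on {u. pdom c u} (\<lambda>u. (pmat c u $ 1 $ 1, pmat c u $ 1 $ 2, pmat c u $ 2 $ 1, pmat c u $ 2 $ 2,
      cp1_embed (abs_cp1 (affine_vec i (u $ 4)))))"
    by (intro continuous_on_Pair entry continuous_cp1_embed_affine' holomorphic_fun_on_imp_continuous_on holomorphic_fun_on_nth)
  then show "continuous_on (snd \<kappa> ` fst \<kappa>) (\<lambda>u. (fst (chart_inv \<kappa> u) $ 1 $ 1, fst (chart_inv \<kappa> u) $ 1 $ 2,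
      fst (chart_inv \<kappa> u) $ 2 $ 1, fst (chart_inv \<kappa> u) $ 2 $ 2, cp1_embed (snd (chart_inv \<kappa> u))))"
    unfolding k pchart_image
    by (rule continuous_on_cong[THEN iffD1, rotated -1]) (simp_all add: chart_inv_pchart pinv_def)
  fix \<kappa>' :: "((complex^2^2) \<times> cp1, complex^4) chart" assume "\<kappa>' \<in> product_atlas"
  then obtain c' i' where k': "\<kappa>' = pchart c' i'" by (elim product_atlas_cases)
  show "open (snd \<kappa> ` (fst \<kappa> \<inter> fst \<kappa>'))" unfolding k k' pchart_transition_domain by (rule open_pchart_domain)
  have "holomorphic_map_on (\<lambda>u. vector [u $ 1, u $ 2, pmat c u $ 2 $ (if c' then 1 else 2), flip i i' (u $ 4)] :: complex^4)
      {u. pdom c u \<and> pdom c' u \<and> (i = i' \<or> u $ 4 \<noteq> 0)}"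
    by (intro holomorphic_map_on_vector4 holomorphic_fun_on_nth holomorphic_pmat holomorphic_flip) auto
  then show "holomorphic_map_on (local_rep \<kappa> \<kappa>' id) (snd \<kappa> ` (fst \<kappa> \<inter> fst \<kappa>'))"
    unfolding k k' pchart_transition_domain
    by (rule holomorphic_map_on_transform[OF _ open_pchart_domain])
      (cases c', simp_all add: local_rep_def chart_inv_pchart snd_pchart_pinv)
next
  fix m m' :: "(complex^2^2) \<times> cp1"
  assume m: "m \<in> carrier_of product_atlas" and "(fst m $ 1 $ 1, fst m $ 1 $ 2, fst m $ 2 $ 1, fst m $ 2 $ 2, cp1_embed (snd m)) =
    (fst m' $ 1 $ 1, fst m' $ 1 $ 2, fst m' $ 2 $ 1, fst m' $ 2 $ 2, cp1_embed (snd m'))"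
  then have "fst m = fst m'" "snd m = snd m'"
    using injD[OF inj_cp1_embed] by (auto simp: vec_eq_iff forall_2)
  then have "m = m'" by (rule prod_eqI)
  then show "\<exists>\<kappa>\<in>product_atlas. m \<in> fst \<kappa> \<and> m' \<in> fst \<kappa>" using m by (auto simp: carrier_of_def)
qed

lemma product_point_in_chart:
  assumes "A \<in> SL2" obtains c i where "(A, x) \<in> fst (pchart c i)"
proof -
  obtain i where i: "x \<in> fst (affine_chart i)" using cp1_in_some_chart .
  have "A $ 1 $ 1 \<noteq> 0 \<or> A $ 1 $ 2 \<noteq> 0" using assms by (auto simp: SL2_def det_2)
  then have "(A, x) \<in> fst (pchart True i) \<or> (A, x) \<in> fst (pchart False i)" using assms i by (auto simp: fst_pchart)
  then show thesis using that by blast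
qed

lemma carrier_product_atlas: "carrier_of product_atlas = SL2 \<times> UNIV"
proof (intro set_eqI iffI)
  fix m assume "m \<in> carrier_of product_atlas"
  then obtain c i where "m \<in> fst (pchart c i)" unfolding carrier_of_def by (auto elim: product_atlas_cases)
  then show "m \<in> SL2 \<times> UNIV" by (auto simp: fst_pchart)
next
  fix m :: "(complex^2^2) \<times> cp1" assume "m \<in> SL2 \<times> UNIV"
  then obtain c i where "m \<in> fst (pchart c i)" using product_point_in_chart[of "fst m" "snd m"] by (cases m) auto
  then show "m \<in> carrier_of product_atlas" using pchart_in_atlas unfolding carrier_of_def by blast
qed

section \<open>The Maurer-Cartan forms and the fibres of the system in coordinates\<close>

definition adj2 :: "complex^2^2 \<Rightarrow> complex^2^2" where
  "adj2 A = (\<chi> i j. if i = j then A $ (i+1) $ (i+1) else - A $ i $ j)"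

lemma adj2_simps: "adj2 A $ 1 $ 1 = A $ 2 $ 2" "adj2 A $ 1 $ 2 = - A $ 1 $ 2" "adj2 A $ 2 $ 1 = - A $ 2 $ 1" "adj2 A $ 2 $ 2 = A $ 1 $ 1"
proof -
  have "(2::2) + 1 = 1" "(1::2) + 1 = 2" by simp_all
  then show "adj2 A $ 1 $ 1 = A $ 2 $ 2" "adj2 A $ 1 $ 2 = - A $ 1 $ 2" "adj2 A $ 2 $ 1 = - A $ 2 $ 1" "adj2 A $ 2 $ 2 = A $ 1 $ 1"
    by (simp_all only: adj2_def vec_lambda_beta) simp_all
qed

lemma adj2_mult:
  assumes "A \<in> SL2" shows "adj2 A ** A = mat 1" "A ** adj2 A = mat 1"
  using assms by (simp_all add: vec_eq_iff forall_2 matrix_matrix_mult_def sum_2 adj2_simps mat_def SL2_def det_2 algebra_simps)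

text \<open>\<open>matrix_inv\<close> is given by choice; the adjugate has polynomial entries, for
  which linearity and holomorphy can be computed.\<close>

lemma matrix_inv_SL2: assumes "A \<in> SL2" shows "matrix_inv A = adj2 A"
proof -
  have "A ** adj2 A = mat 1 \<and> adj2 A ** A = mat 1" using adj2_mult[OF assms] by simp
  from someI[where P = "\<lambda>B. A ** B = mat 1 \<and> B ** A = mat 1", OF this]
  have "matrix_inv A ** A = mat 1" by (simp add: matrix_inv_def)
  then have "adj2 A = matrix_inv A ** (A ** adj2 A)" by (simp add: matrix_mul_assoc)
  then show ?thesis by (simp add: adj2_mult[OF assms])
qed

definition pgrad :: "bool \<Rightarrow> complex^4 \<Rightarrow> 2 \<Rightarrow> 2 \<Rightarrow> complex^4" where
  "pgrad c u l j = (if l = 1 then if j = 1 then axis 1 1 else axis 2 1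
    else if j = 1 then
      if c then axis 3 1 else vector [u $ 3 / u $ 2, - (u $ 1 * u $ 3 - 1) / (u $ 2)\<^sup>2, u $ 1 / u $ 2, 0]
    else
      if c then vector [- (1 + u $ 2 * u $ 3) / (u $ 1)\<^sup>2, u $ 3 / u $ 1, u $ 2 / u $ 1, 0] else axis 3 1)"

lemma has_cgradient_pmat: assumes "pdom c u" shows "has_cgradient (\<lambda>u. pmat c u $ l $ j) (pgrad c u l j) u"
proof -
  have "has_cgradient (\<lambda>u. (u $ 1 * u $ 3 - 1) / u $ 2) (vector [u $ 3 / u $ 2, - (u $ 1 * u $ 3 - 1) / (u $ 2)\<^sup>2, u $ 1 / u $ 2, 0]) u"
    if "u $ 2 \<noteq> 0"
    by (rule has_cgradient_eq_rhs[OF has_cgradient_divide[OF has_cgradient_diff[OF has_cgradient_mult[OF has_cgradient_nth has_cgradient_nth] has_cgradient_const] has_cgradient_nth that]])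
      (simp add: vec_eq_iff forall_4 vector_4_component axis_def diff_divide_distrib)
  moreover have "has_cgradient (\<lambda>u. (1 + u $ 2 * u $ 3) / u $ 1) (vector [- (1 + u $ 2 * u $ 3) / (u $ 1)\<^sup>2, u $ 3 / u $ 1, u $ 2 / u $ 1, 0]) u"
    if "u $ 1 \<noteq> 0"
    by (rule has_cgradient_eq_rhs[OF has_cgradient_divide[OF has_cgradient_add[OF has_cgradient_const has_cgradient_mult[OF has_cgradient_nth has_cgradient_nth]] has_cgradient_nth that]])
      (simp add: vec_eq_iff forall_4 vector_4_component axis_def add_divide_distrib diff_divide_distrib)
  ultimately show ?thesis
    using assms exhaust_2[of l] exhaust_2[of j]
    by (cases c) (auto simp: pmat_simps pgrad_def pdom_def has_cgradient_nth)
qed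

lemma holomorphic_pgrad:
  "(\<And>u. u \<in> S \<Longrightarrow> pdom c u) \<Longrightarrow> holomorphic_fun_on (\<lambda>u. pgrad c u l j $ m) S"
  using exhaust_2[of l] exhaust_2[of j] exhaust_4[of m]
  by (cases c) (auto simp: pgrad_def pdom_def vector_4_component intro!: holomorphic_fun_intros)

lemma pchart_entry_gradient:
  assumes "m \<in> fst (pchart c i)"
  shows "has_cgradient (\<lambda>u. fst (chart_inv (pchart c i) u) $ l $ j) (pgrad c (snd (pchart c i) m) l j) (snd (pchart c i) m)"
  by (rule has_cgradient_transform[OF has_cgradient_pmat open_pdom[of c]])
    (use pdom_snd_pchart[OF assms] in \<open>auto simp: chart_inv_pchart pinv_def\<close>)

lemma differential_of_entry:
  assumes "m \<in> fst (pchart c i)"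
  shows "differential_of (\<lambda>m'. fst m' $ l $ j) (pchart c i) m = pgrad c (snd (pchart c i) m) l j"
  unfolding differential_of_def o_def by (rule cgradient_eq[OF pchart_entry_gradient[OF assms]])

text \<open>This is the differential of \<open>det = 1\<close>, in other words the vanishing trace
  of \<open>A\<^sup>-\<^sup>1 dA\<close>.\<close>

lemma pgrad_trace:
  assumes "pdom c u"
  shows "pmat c u $ 2 $ 2 *s pgrad c u 1 1 + pmat c u $ 1 $ 1 *s pgrad c u 2 2
    - pmat c u $ 1 $ 2 *s pgrad c u 2 1 - pmat c u $ 2 $ 1 *s pgrad c u 1 2 = 0"
  using assms
  by (cases c) (simp_all add: vec_eq_iff forall_4 pmat_simps pgrad_def vector_4_component axis_def pdom_def field_simps power2_eq_square)

text \<open>The entries of the row \<open>v A\<^sup>-\<^sup>1 dA\<close>. For \<open>v = (p, q)\<close> they span the fibre of the system.\<close>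

definition hform :: "bool \<Rightarrow> complex^4 \<Rightarrow> complex^2 \<Rightarrow> 2 \<Rightarrow> complex^4" where
  "hform c u v j = (\<Sum>l\<in>UNIV. (v v* adj2 (pmat c u)) $ l *s pgrad c u l j)"

lemma hform_scale: "hform c u (s *s v) j = s *s hform c u v j"
  by (simp add: hform_def sum_2 scalar_vector_matrix_assoc vec.scale_right_distrib)

text \<open>With \<open>a, b\<close> the entries of \<open>v A\<^sup>-\<^sup>1 dA\<close> and
  \<open>v = (p, q)\<close>, the three covectors on the left are the generators of the system. No
  two of them span at every point: at \<open>p = 0\<close> or \<open>q = 0\<close> one of the first
  two vanishes and the third supplies what is lost.\<close>

lemma span_pencil:
  fixes a b :: "complex^'n"
  assumes "p \<noteq> 0 \<or> q \<noteq> 0" shows "vec.span {q *s b, p *s a, q *s a + p *s b} = vec.span {a, b}"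
proof (rule vec.span_eq[THEN iffD2], intro conjI)
  let ?S = "{q *s b, p *s a, q *s a + p *s b}"
  show "?S \<subseteq> vec.span {a, b}" by (auto simp: vec.span_base intro!: vec.span_add vec.span_scale)
  show "{a, b} \<subseteq> vec.span ?S"
  proof (cases "p = 0")
    case False
    then have "a = (1 / p) *s (p *s a)" by simp
    moreover have "b = (1 / p) *s (q *s a + p *s b) - (q / p\<^sup>2) *s (p *s a)"
      using False by (simp add: vec_eq_iff field_simps power2_eq_square)
    ultimately have "a \<in> vec.span ?S" "b \<in> vec.span ?S"
      by (metis insertCI vec.span_base vec.span_scale, metis insertCI vec.span_base vec.span_scale vec.span_diff)
    then show ?thesis by simp
  next
    case True
    then have q: "q \<noteq> 0" using assms by simp
    then have "a = (1 / q) *s (q *s a + p *s b)" "b = (1 / q) *s (q *s b)" using True by simp_all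
    then have "a \<in> vec.span ?S" "b \<in> vec.span ?S" by (metis insertCI vec.span_base vec.span_scale)+
    then show ?thesis by simp
  qed
qed

lemma H_bundle_eq:
  assumes m: "(A, abs_cp1 v) \<in> fst (pchart c i)" and v: "v \<noteq> 0"
  defines "u \<equiv> snd (pchart c i) (A, abs_cp1 v)"
  shows "H_bundle (pchart c i) (A, abs_cp1 v) = vec.span {hform c u v 1, hform c u v 2}"
proof -
  obtain s where s: "s \<noteq> 0" "rep_cp1 (abs_cp1 v) = s *s v" using cp1_rep_abs[OF v] by blast
  define p q where "p = s * v $ 1" and "q = s * v $ 2"
  have A: "A \<in> SL2" "pmat c u = A" "pdom c u"
    using m pmat_snd_pchart[OF m] pdom_snd_pchart[OF m] by (simp_all add: u_def fst_pchart)
  define \<alpha> where "\<alpha> = (\<lambda>i' j. maurer_cartan i' j (pchart c i) (A, abs_cp1 v))"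
  have mc: "\<alpha> i' j = (\<Sum>l\<in>UNIV. adj2 A $ i' $ l *s pgrad c u l j)" for i' j
    by (simp add: \<alpha>_def maurer_cartan_def differential_of_entry[OF m] matrix_inv_SL2[OF A(1)] u_def)
  have \<phi>: "hform c u (s *s v) j = p *s \<alpha> 1 j + q *s \<alpha> 2 j" for j
    by (simp add: hform_def A(2) mc sum_2 vector_matrix_mult_def p_def q_def vec_eq_iff algebra_simps)
  have tr: "\<alpha> 2 2 = - \<alpha> 1 1"
    using pgrad_trace[OF A(3)] by (simp add: mc sum_2 adj2_simps A(2) vec_eq_iff algebra_simps add_eq_0_iff)
  let ?a = "hform c u (s *s v) 1" and ?b = "hform c u (s *s v) 2"
  have "H_bundle (pchart c i) (A, abs_cp1 v) =
    vec.span {(p * q) *s \<alpha> 1 2 - q\<^sup>2 *s \<alpha> 1 1, (p * q) *s \<alpha> 2 1 + p\<^sup>2 *s \<alpha> 1 1, q\<^sup>2 *s \<alpha> 2 1 + p\<^sup>2 *s \<alpha> 1 2}"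
    by (simp add: H_bundle_def s(2) \<alpha>_def p_def q_def Let_def)
  \<comment> \<open>Writing \<open>\<alpha> 2 2\<close> as \<open>- \<alpha> 1 1\<close> turns
    \<open>q b\<close> and \<open>p a\<close> into the first two generators, and makes the two terms
    \<open>p q \<alpha> 1 1\<close> in \<open>q a + p b\<close> cancel.\<close>
  also have "\<dots> = vec.span {q *s ?b, p *s ?a, q *s ?a + p *s ?b}"
    unfolding \<phi> tr by (rule arg_cong[where f = vec.span], intro arg_cong2[where f = insert] refl)
      (simp_all add: vec_eq_iff algebra_simps power2_eq_square)
  also have "\<dots> = vec.span {?a, ?b}"
    by (rule span_pencil) (use s v in \<open>auto simp: p_def q_def vec_eq_iff forall_2\<close>)
  also have "\<dots> = vec.span {hform c u v 1, hform c u v 2}"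
    using span_pair_triangular[OF s(1) s(1), of "hform c u v 1" 0 "hform c u v 2"] by (simp add: hform_scale)
  finally show ?thesis .
qed

section \<open>Tangent vectors dual to the row entries, and holomorphic coefficients\<close>

definition pairing :: "complex^4 \<Rightarrow> complex^4 \<Rightarrow> complex" where
  "pairing g e = (\<Sum>m\<in>UNIV. g $ m * e $ m)"

lemma pairing_linear:
  "pairing (g + h) e = pairing g e + pairing h e" "pairing (g - h) e = pairing g e - pairing h e"
  "pairing (s *s g) e = s * pairing g e" "pairing 0 e = 0"
  by (simp_all add: pairing_def sum_4 algebra_simps)

text \<open>The coordinate vector of the tangent vector \<open>Y\<close> to \<open>SL2\<close> at \<open>pmat c u\<close>.\<close>

definition tangent_lift :: "bool \<Rightarrow> complex^2^2 \<Rightarrow> complex^4" where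
  "tangent_lift c Y = vector [Y $ 1 $ 1, Y $ 1 $ 2, if c then Y $ 2 $ 1 else Y $ 2 $ 2, 0]"

text \<open>Three entries of the matrix are coordinates, and for them the claim is immediate. For
  the fourth, the pairings and the entries of \<open>A X\<close> satisfy the same linear relation,
  namely the differentiated determinant condition; trace-freeness of \<open>X\<close> makes
  \<open>A X\<close> tangent. Its coefficient at the fourth entry is the one that is nonzero in the
  chart.\<close>

lemma pairing_pgrad:
  assumes u: "pdom c u" and X: "X $ 1 $ 1 + X $ 2 $ 2 = 0"
  shows "pairing (pgrad c u l j) (tangent_lift c (pmat c u ** X)) = (pmat c u ** X) $ l $ j"
proof -
  define A Y P where "A = pmat c u" and "Y = A ** X" and "P = (\<lambda>l j. pairing (pgrad c u l j) (tangent_lift c Y))"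
  have det: "A $ 1 $ 1 * A $ 2 $ 2 - A $ 1 $ 2 * A $ 2 $ 1 = 1" using det_pmat[OF u] by (simp add: A_def det_2)
  have X22: "X $ 2 $ 2 = - X $ 1 $ 1" using X by (simp add: add_eq_0_iff)
  have Yrel: "A $ 2 $ 2 * Y $ 1 $ 1 + A $ 1 $ 1 * Y $ 2 $ 2 - A $ 1 $ 2 * Y $ 2 $ 1 - A $ 2 $ 1 * Y $ 1 $ 2 = 0"
    by (simp add: Y_def matrix_matrix_mult_def sum_2 X22 algebra_simps)
  have "pairing (A $ 2 $ 2 *s pgrad c u 1 1 + A $ 1 $ 1 *s pgrad c u 2 2
      - A $ 1 $ 2 *s pgrad c u 2 1 - A $ 2 $ 1 *s pgrad c u 1 2) (tangent_lift c Y) = 0"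
    using pgrad_trace[OF u] by (simp add: A_def pairing_linear(4))
  then have Prel: "A $ 2 $ 2 * P 1 1 + A $ 1 $ 1 * P 2 2 - A $ 1 $ 2 * P 2 1 - A $ 2 $ 1 * P 1 2 = 0"
    by (simp add: pairing_linear P_def)
  have coord: "P 1 1 = Y $ 1 $ 1" "P 1 2 = Y $ 1 $ 2" "c \<Longrightarrow> P 2 1 = Y $ 2 $ 1" "\<not> c \<Longrightarrow> P 2 2 = Y $ 2 $ 2"
    by (simp_all add: P_def pairing_def sum_4 pgrad_def axis_def tangent_lift_def vector_4_component)
  have "P 2 2 = Y $ 2 $ 2" if "c"
  proof -
    have "A $ 1 $ 1 * (P 2 2 - Y $ 2 $ 2) =
        (A $ 2 $ 2 * P 1 1 + A $ 1 $ 1 * P 2 2 - A $ 1 $ 2 * P 2 1 - A $ 2 $ 1 * P 1 2) -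
        (A $ 2 $ 2 * Y $ 1 $ 1 + A $ 1 $ 1 * Y $ 2 $ 2 - A $ 1 $ 2 * Y $ 2 $ 1 - A $ 2 $ 1 * Y $ 1 $ 2)"
      by (simp add: coord(1,2) coord(3)[OF that] right_diff_distrib)
    then have "A $ 1 $ 1 * (P 2 2 - Y $ 2 $ 2) = 0" unfolding Prel Yrel by simp
    then show ?thesis using u that by (simp add: A_def pdom_def pmat_simps)
  qed
  moreover have "P 2 1 = Y $ 2 $ 1" if "\<not> c"
  proof -
    have "A $ 1 $ 2 * (Y $ 2 $ 1 - P 2 1) =
        (A $ 2 $ 2 * P 1 1 + A $ 1 $ 1 * P 2 2 - A $ 1 $ 2 * P 2 1 - A $ 2 $ 1 * P 1 2) -
        (A $ 2 $ 2 * Y $ 1 $ 1 + A $ 1 $ 1 * Y $ 2 $ 2 - A $ 1 $ 2 * Y $ 2 $ 1 - A $ 2 $ 1 * Y $ 1 $ 2)"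
      by (simp add: coord(1,2) coord(4)[OF that] right_diff_distrib)
    then have "A $ 1 $ 2 * (Y $ 2 $ 1 - P 2 1) = 0" unfolding Prel Yrel by simp
    then show ?thesis using u that by (simp add: A_def pdom_def pmat_simps)
  qed
  ultimately have "P l j = Y $ l $ j" using coord exhaust_2[of l] exhaust_2[of j] by (cases c) auto
  then show ?thesis by (simp add: P_def Y_def A_def)
qed

text \<open>\<open>A X\<close> is the value at \<open>A\<close> of the left-invariant vector field
  of \<open>X\<close>, on which \<open>A\<^sup>-\<^sup>1 dA\<close> takes the constant value
  \<open>X\<close>.\<close>

lemma pairing_hform:
  assumes u: "pdom c u" and X: "X $ 1 $ 1 + X $ 2 $ 2 = 0"
  shows "pairing (hform c u v j) (tangent_lift c (pmat c u ** X)) = (v v* X) $ j"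
proof -
  let ?A = "pmat c u"
  have "pairing (hform c u v j) (tangent_lift c (?A ** X)) = (\<Sum>l\<in>UNIV. (v v* adj2 ?A) $ l * (?A ** X) $ l $ j)"
    by (simp add: hform_def sum_2 pairing_linear pairing_pgrad[OF assms])
  also have "\<dots> = ((v v* adj2 ?A) v* (?A ** X)) $ j" by (simp add: vector_matrix_mult_def)
  also have "(v v* adj2 ?A) v* (?A ** X) = v v* X"
    using adj2_mult(1)[OF pmat_in_SL2[OF u]] by (simp add: vector_matrix_mul_assoc matrix_mul_assoc)
  finally show ?thesis .
qed

text \<open>Trace-free matrices \<open>X\<close> with \<open>v X = e\<^sub>k\<close>, respectively \<open>v X = e\<^sub>k\<^sub>+\<^sub>1\<close>, where \<open>v = affine_vec k t\<close>.\<close>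

definition dual1 :: "2 \<Rightarrow> complex \<Rightarrow> complex^2^2" where
  "dual1 k t = (\<chi> r s. if s = k then if r = k then 1 else 0 else if r = k then t else -1)"

definition dual2 :: "2 \<Rightarrow> complex^2^2" where
  "dual2 k = (\<chi> r s. if r = k \<and> s \<noteq> k then 1 else 0)"

lemma dual_trace: "dual1 k t $ 1 $ 1 + dual1 k t $ 2 $ 2 = 0" "dual2 k $ 1 $ 1 + dual2 k $ 2 $ 2 = 0"
  using exhaust_2[of k] by (auto simp: dual1_def dual2_def)

lemma affine_vec_dual:
  "affine_vec k t v* dual1 k t = axis k 1" "affine_vec k t v* dual2 k = axis (k + 1) 1"
  using exhaust_2[of k]
  by (auto simp: vec_eq_iff forall_2 vector_matrix_mult_def sum_2 affine_vec_def dual1_def dual2_def axis_def)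

text \<open>Coefficients with respect to the two row entries, written as pairings with the dual
  tangent vectors. Unlike coefficients extracted from membership in a span, they visibly depend
  holomorphically on the point.\<close>

definition hcoef1 :: "bool \<Rightarrow> complex^4 \<Rightarrow> 2 \<Rightarrow> complex \<Rightarrow> complex^4 \<Rightarrow> complex" where
  "hcoef1 c u k t \<eta> = pairing \<eta> (tangent_lift c (pmat c u ** dual1 k t))"

definition hcoef2 :: "bool \<Rightarrow> complex^4 \<Rightarrow> 2 \<Rightarrow> complex^4 \<Rightarrow> complex" where
  "hcoef2 c u k \<eta> = pairing \<eta> (tangent_lift c (pmat c u ** dual2 k))"

lemma hcoef_hform:
  fixes k :: 2 and t :: complex
  assumes "pdom c u"
  defines "\<phi> \<equiv> hform c u (affine_vec k t)"
  shows "hcoef1 c u k t (x *s \<phi> k + y *s \<phi> (k + 1)) = x" "hcoef2 c u k (x *s \<phi> k + y *s \<phi> (k + 1)) = y"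
  unfolding \<phi>_def hcoef1_def hcoef2_def pairing_linear pairing_hform[OF assms(1) dual_trace(1)]
    pairing_hform[OF assms(1) dual_trace(2)] affine_vec_dual
  by (simp_all add: axis_def index2_succ index2_succ(1)[symmetric])

lemma hform_span_index: "{hform c u v 1, hform c u v 2} = {hform c u v k, hform c u v (k + 1)}"
proof -
  have "{hform c u v 1, hform c u v 2} = hform c u v ` UNIV" by (simp add: UNIV_2)
  then show ?thesis by (simp add: UNIV_index2[of k])
qed

lemma in_span_hform:
  assumes "pdom c u"
  shows "\<eta> \<in> vec.span {hform c u (affine_vec k t) 1, hform c u (affine_vec k t) 2} \<longleftrightarrow>
    \<eta> = hcoef1 c u k t \<eta> *s hform c u (affine_vec k t) k + hcoef2 c u k \<eta> *s hform c u (affine_vec k t) (k + 1)"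
  unfolding hform_span_index[of c u _ k] span_pair using hcoef_hform[OF assms] by auto

lemma dim_span_hform:
  assumes "pdom c u"
  shows "vec.dim (vec.span {hform c u (affine_vec k t) 1, hform c u (affine_vec k t) 2}) = 2"
  unfolding hform_span_index[of c u _ k]
proof (rule dim_span_pair)
  fix x y assume eq: "x *s hform c u (affine_vec k t) k + y *s hform c u (affine_vec k t) (k + 1) = 0"
  show "x = 0 \<and> y = 0"
    using hcoef_hform[OF assms, where k = k and t = t and x = x and y = y] unfolding eq by (simp add: hcoef1_def hcoef2_def pairing_linear)
qed

lemma holomorphic_hform:
  assumes "\<And>u. u \<in> S \<Longrightarrow> pdom c u" and "holomorphic_fun_on t S"
  shows "holomorphic_map_on (\<lambda>u. hform c u (affine_vec k (t u)) j) S"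
  unfolding holomorphic_map_on_def
proof
  fix m
  have adj: "holomorphic_fun_on (\<lambda>u. adj2 (pmat c u) $ r $ s) S" for r s
    by (cases "r = s") (auto simp: adj2_def intro!: holomorphic_fun_intros holomorphic_pmat assms(1))
  have "holomorphic_fun_on (\<lambda>u. \<Sum>l\<in>UNIV. (adj2 (pmat c u) $ k $ l + t u * adj2 (pmat c u) $ (k + 1) $ l) * pgrad c u l j $ m) S"
    by (intro holomorphic_fun_intros adj assms(2) holomorphic_pgrad assms(1))
  then show "holomorphic_fun_on (\<lambda>u. hform c u (affine_vec k (t u)) j $ m) S"
    by (simp add: hform_def affine_vec_mult distrib_right)
qed

lemma holomorphic_hcoef:
  assumes u: "\<And>u. u \<in> S \<Longrightarrow> pdom c u" and t: "holomorphic_fun_on t S" and \<eta>: "holomorphic_map_on \<eta> S"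
  shows "holomorphic_fun_on (\<lambda>u. hcoef1 c u k (t u) (\<eta> u)) S" "holomorphic_fun_on (\<lambda>u. hcoef2 c u k (\<eta> u)) S"
proof -
  have \<eta>': "holomorphic_fun_on (\<lambda>u. \<eta> u $ m) S" for m using \<eta> by (simp add: holomorphic_map_on_def)
  have pair: "holomorphic_fun_on (\<lambda>u. pairing (\<eta> u) (tangent_lift c (pmat c u ** X u))) S"
    if X: "\<And>r s. holomorphic_fun_on (\<lambda>u. X u $ r $ s) S" for X
  proof -
    have XY: "holomorphic_fun_on (\<lambda>u. (pmat c u ** X u) $ r $ s) S" for r s
      by (simp add: matrix_matrix_mult_def) (intro holomorphic_fun_intros holomorphic_pmat u X)
    have "holomorphic_fun_on (\<lambda>u. \<eta> u $ 1 * (pmat c u ** X u) $ 1 $ 1 + \<eta> u $ 2 * (pmat c u ** X u) $ 1 $ 2 +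
        \<eta> u $ 3 * (pmat c u ** X u) $ 2 $ (if c then 1 else 2)) S"
      by (intro holomorphic_fun_intros \<eta>' XY)
    then show ?thesis by (cases c) (simp_all add: pairing_def sum_4 tangent_lift_def vector_4_component)
  qed
  have "holomorphic_fun_on (\<lambda>u. dual1 k (t u) $ r $ s) S" for r s
    by (cases "s = k"; cases "r = k") (simp_all add: dual1_def holomorphic_fun_on_const t)
  from pair[OF this] show "holomorphic_fun_on (\<lambda>u. hcoef1 c u k (t u) (\<eta> u)) S" unfolding hcoef1_def .
  show "holomorphic_fun_on (\<lambda>u. hcoef2 c u k (\<eta> u)) S"
    unfolding hcoef2_def by (rule pair) (rule holomorphic_fun_on_const)
qed

text \<open>Any representative \<open>v\<close> of the point is allowed: the coordinate lives in
  affine chart \<open>i\<close> of the source, while the frame can be adapted to the chart used for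
  the target of \<open>Psi\<close>.\<close>

lemma H_bundle_pchart:
  assumes "pdom c u" and "affine_vec i (u $ 4) = v \<or> abs_cp1 (affine_vec i (u $ 4)) = abs_cp1 v \<and> v \<noteq> 0"
  shows "H_bundle (pchart c i) (pinv c i u) = vec.span {hform c u v 1, hform c u v 2}"
proof -
  have v: "abs_cp1 (affine_vec i (u $ 4)) = abs_cp1 v" "v \<noteq> 0" using assms(2) affine_vec_simps(3) by auto
  have m: "(pmat c u, abs_cp1 v) \<in> fst (pchart c i)" using pinv_in[OF assms(1), of i c i] assms(1) v by (simp add: pinv_def)
  have "snd (pchart c i) (pmat c u, abs_cp1 v) = u" using snd_pchart_pinv_self[of c i u] v by (simp add: pinv_def)
  then show ?thesis using H_bundle_eq[OF m v(2)] v(1) by (simp add: pinv_def)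
qed

lemma holomorphic_subbundle_H: "holomorphic_subbundle product_atlas 2 H_bundle"
  unfolding holomorphic_subbundle_def
proof (intro conjI ballI)
  fix \<kappa> m assume k: "\<kappa> \<in> product_atlas" and m: "m \<in> fst \<kappa>"
  then obtain c i where \<kappa>: "\<kappa> = pchart c i" by (elim product_atlas_cases)
  let ?\<theta> = "\<lambda>(n::nat) u. hform c u (affine_vec i (u $ 4)) (if n = 0 then 1 else 2)"
  have im: "(\<lambda>n. ?\<theta> n u) ` {..<2} = {hform c u (affine_vec i (u $ 4)) 1, hform c u (affine_vec i (u $ 4)) 2}" for u
    by (auto simp: lessThan_nat_numeral lessThan_Suc image_iff split: if_splits)
  have E: "H_bundle \<kappa> (chart_inv \<kappa> u) = vec.span {hform c u (affine_vec i (u $ 4)) 1, hform c u (affine_vec i (u $ 4)) 2}"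
    if "pdom c u" for u
    using that by (simp add: \<kappa> chart_inv_pchart H_bundle_pchart)
  show "\<exists>V \<theta>. open V \<and> snd \<kappa> m \<in> V \<and> V \<subseteq> snd \<kappa> ` fst \<kappa> \<and> (\<forall>i<2::nat. holomorphic_map_on (\<theta> i) V) \<and>
      (\<forall>u\<in>V. H_bundle \<kappa> (chart_inv \<kappa> u) = vec.span ((\<lambda>i. \<theta> i u) ` {..<2}) \<and>
             vec.dim (H_bundle \<kappa> (chart_inv \<kappa> u)) = 2)"
  proof (intro exI[of _ "{u. pdom c u}"] exI[of _ ?\<theta>] conjI allI impI ballI)
    show "open {u. pdom c u}" by (rule open_pdom)
    show "snd \<kappa> m \<in> {u. pdom c u}" using m pdom_snd_pchart by (simp add: \<kappa>)
    show "{u. pdom c u} \<subseteq> snd \<kappa> ` fst \<kappa>" by (simp add: \<kappa> pchart_image)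
    show "holomorphic_map_on (?\<theta> n) {u. pdom c u}" for n by (intro holomorphic_hform holomorphic_fun_on_nth) simp
    fix u assume "u \<in> {u. pdom c u}"
    then have u: "pdom c u" by simp
    show "H_bundle \<kappa> (chart_inv \<kappa> u) = vec.span ((\<lambda>i. ?\<theta> i u) ` {..<2})" unfolding im by (rule E[OF u])
    show "vec.dim (H_bundle \<kappa> (chart_inv \<kappa> u)) = 2" unfolding E[OF u] by (rule dim_span_hform[OF u])
  qed
next
  fix \<kappa> \<kappa>' m assume k: "\<kappa> \<in> product_atlas" "\<kappa>' \<in> product_atlas" and m: "m \<in> fst \<kappa> \<inter> fst \<kappa>'"
  let ?J = "cjacobian (local_rep \<kappa> \<kappa>' id) (snd \<kappa> m)"
  obtain c' i' where \<kappa>': "\<kappa>' = pchart c' i'" using k(2) by (elim product_atlas_cases)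
  have m': "m \<in> fst (pchart c' i')" using m by (simp add: \<kappa>')
  \<comment> \<open>The matrix entries are functions on the manifold and the coefficients
    \<open>matrix_inv (fst m)\<close> do not involve a chart, so the Maurer-Cartan forms transform
    as these differentials do.\<close>
  have "differential_of (\<lambda>m'. fst m' $ l $ j) \<kappa> m = differential_of (\<lambda>m'. fst m' $ l $ j) \<kappa>' m v* ?J" for l j
    unfolding \<kappa>' differential_of_entry[OF m'] unfolding \<kappa>'[symmetric]
    by (rule differential_of_transition[OF complex_manifold_product_atlas k])
      (use m pchart_entry_gradient[OF m'] in \<open>auto simp: \<kappa>'\<close>)
  then have mc: "maurer_cartan r s \<kappa> m = maurer_cartan r s \<kappa>' m v* ?J" for r s
    by (simp add: maurer_cartan_def sum_2 vector_matrix_left_distrib scalar_vector_matrix_assoc)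
  show "H_bundle \<kappa> m = (\<lambda>\<theta>. \<theta> v* ?J) ` H_bundle \<kappa>' m"
    by (simp add: H_bundle_def Let_def mc span_image_matrix vector_matrix_left_distrib vector_matrix_mult_diff_distrib scalar_vector_matrix_assoc)
qed

section \<open>The map \<open>Psi\<close> in charts\<close>

text \<open>For the index \<open>2\<close> the term \<open>i + 1\<close> simplifies to the numeral
  \<open>3\<close>, which is \<open>1\<close> in the index type.\<close>

lemma nth_three: "(v :: 'a^2) $ 3 = v $ 1"
proof -
  have "(3::2) = 1" by simp
  then show ?thesis by (rule arg_cong)
qed

text \<open>The sign by which the determinant changes when rows are listed as
  \<open>i, i + 1\<close> and columns as \<open>k, k + 1\<close>, see
  \<open>minor_det\<close>.\<close>

definition eps :: "2 \<Rightarrow> 2 \<Rightarrow> complex" where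
  "eps i k = (if i = k then 1 else -1)"

lemma eps_sq: "eps i k * eps i k = 1" "eps i k * (eps i k * a) = a" "eps i k \<noteq> 0"
  by (simp_all add: eps_def)

lemma minor_det: "A $ i $ k * A $ (i+1) $ (k+1) - A $ i $ (k+1) * A $ (i+1) $ k = eps i k * det A"
  using exhaust_2[of i] exhaust_2[of k] by (auto simp: det_2 eps_def nth_three algebra_simps)

text \<open>Together with \<open>psi_num\<close>, up to the common sign \<open>eps i k\<close>: the
  components of \<open>v A\<^sup>-\<^sup>1\<close> for \<open>v = affine_vec k t\<close>, that is,
  homogeneous coordinates of the source of the jet.\<close>

definition psi_den :: "2 \<Rightarrow> 2 \<Rightarrow> complex^2^2 \<Rightarrow> complex \<Rightarrow> complex" where
  "psi_den i k A t = A $ (i+1) $ (k+1) - t * A $ (i+1) $ k"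

definition psi_num :: "2 \<Rightarrow> 2 \<Rightarrow> complex^2^2 \<Rightarrow> complex \<Rightarrow> complex" where
  "psi_num i k A t = t * A $ i $ k - A $ i $ (k+1)"

text \<open>These are the two components of \<open>(v A\<^sup>-\<^sup>1) A = v\<close>, multiplied
  by the sign.\<close>

lemma psi_den_num:
  assumes "A \<in> SL2"
  shows "A $ i $ k * psi_den i k A t + A $ (i+1) $ k * psi_num i k A t = eps i k"
    and "A $ i $ (k+1) * psi_den i k A t + A $ (i+1) $ (k+1) * psi_num i k A t = eps i k * t"
proof -
  have m: "eps i k = A $ i $ k * A $ (i+1) $ (k+1) - A $ i $ (k+1) * A $ (i+1) $ k"
    using minor_det[of A i k] assms by (simp add: SL2_def)
  show "A $ i $ k * psi_den i k A t + A $ (i+1) $ k * psi_num i k A t = eps i k"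
    "A $ i $ (k+1) * psi_den i k A t + A $ (i+1) $ (k+1) * psi_num i k A t = eps i k * t"
    unfolding m by (simp_all add: psi_den_def psi_num_def algebra_simps)
qed

lemma affine_vec_adj2:
  "(affine_vec k t v* adj2 A) $ i = eps i k * psi_den i k A t"
  "(affine_vec k t v* adj2 A) $ (i+1) = eps i k * psi_num i k A t"
  unfolding affine_vec_mult using exhaust_2[of i] exhaust_2[of k]
  by (auto simp: adj2_simps eps_def psi_den_def psi_num_def nth_three algebra_simps)

definition psi_coords :: "2 \<Rightarrow> 2 \<Rightarrow> complex^2^2 \<Rightarrow> complex \<Rightarrow> complex^4" where
  "psi_coords i k A t = vector [psi_num i k A t / psi_den i k A t, t, eps i k * (psi_den i k A t)\<^sup>2,
    - 2 * A $ (i+1) $ k * (psi_den i k A t) ^ 3]"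

lemma adj2_SL2: "A \<in> SL2 \<Longrightarrow> adj2 A \<in> SL2"
  by (simp add: SL2_def det_2 adj2_simps algebra_simps)

lemma SL2_mult: "A \<in> SL2 \<Longrightarrow> B \<in> SL2 \<Longrightarrow> A ** B \<in> SL2"
  by (simp add: SL2_def det_mul)

lemma adj2_mult_distrib: "adj2 (A ** B) = adj2 B ** adj2 A"
  by (simp add: vec_eq_iff forall_2 adj2_simps matrix_matrix_mult_def sum_2 algebra_simps)

lemma cp1_act_mult:
  assumes "A \<in> SL2" "B \<in> SL2" shows "cp1_act (cp1_act x A) B = cp1_act x (A ** B)"
proof -
  obtain v where v: "x = abs_cp1 v" "v \<noteq> 0" using cp1_abs_rep cp1_rep_nonzero by metis
  show ?thesis
    using v assms by (simp add: cp1_act_abs SL2_mult vector_matrix_mul_assoc)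
qed

lemma germ_rep_id: "x \<in> fst (affine_chart i) \<Longrightarrow> germ_rep i i id x (\<lambda>t. t)"
  by (simp add: germ_rep_def analytic_on_ident)

lemma holomorphic_near_id: "holomorphic_near id x"
  using germ_rep_imp_holomorphic_near[OF germ_rep_id] cp1_in_some_chart by metis

lemma Psi_eq: "A \<in> SL2 \<Longrightarrow> Psi (A, x) = jet_of (cp1_act x (adj2 A)) (\<lambda>y. cp1_act y A)"
  by (simp add: Psi_def matrix_inv_SL2 prolonged_act_jet_of holomorphic_near_id)

text \<open>The source is unchanged, since
  \<open>x C (A C)\<^sup>-\<^sup>1 = x A\<^sup>-\<^sup>1\<close>, and the Moebius map of
  \<open>A C\<close> is that of \<open>A\<close> followed by that of \<open>C\<close>.\<close>

lemma Psi_equivariant: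
  assumes A: "A \<in> SL2" and C: "C \<in> SL2"
  shows "Psi (diagonal_act (A, x) C) = prolonged_act (Psi (A, x)) C"
proof -
  have h: "holomorphic_near (\<lambda>y. cp1_act y A) y" for y
    using holomorphic_near_act[OF A holomorphic_near_id] by simp
  have "C ** adj2 (A ** C) = adj2 A"
    using adj2_mult(2)[OF C] by (simp add: adj2_mult_distrib matrix_mul_assoc)
  then show ?thesis
    by (simp add: diagonal_act_def Psi_eq[OF A] Psi_eq[OF SL2_mult[OF A C]] prolonged_act_jet_of[OF C h]
        cp1_act_mult[OF C adj2_SL2[OF SL2_mult[OF A C]]] cp1_act_mult[OF A C])
qed

lemma Psi_jet:
  assumes A: "A \<in> SL2"
  shows "jet_source (Psi (A, x)) = cp1_act x (adj2 A)" "jet_map (Psi (A, x)) (cp1_act x (adj2 A)) = x"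
proof -
  have h: "holomorphic_near (\<lambda>y. cp1_act y A) (cp1_act x (adj2 A))"
    using holomorphic_near_act[OF A holomorphic_near_id] by simp
  show "jet_source (Psi (A, x)) = cp1_act x (adj2 A)" using jet_of_source(1)[OF h] by (simp add: Psi_eq[OF A])
  have "cp1_act (cp1_act x (adj2 A)) A = x"
    by (simp add: cp1_act_mult[OF adj2_SL2[OF A] A] adj2_mult[OF A] cp1_act_mat_1)
  then show "jet_map (Psi (A, x)) (cp1_act x (adj2 A)) = x"
    using jet_of_source(2)[OF h] by (simp add: Psi_eq[OF A])
qed

section \<open>The coordinate expression of \<open>Psi\<close>\<close>

lemma Psi_source_in:
  assumes A: "A \<in> SL2"
  shows "cp1_act (abs_cp1 (affine_vec k t)) (adj2 A) \<in> fst (affine_chart i) \<longleftrightarrow> psi_den i k A t \<noteq> 0"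
  using cp1_act_affine_in[OF adj2_SL2[OF A], of k t i] affine_vec_adj2(1)[of k t A i]
  by (simp add: affine_vec_mult eps_sq)

lemma Psi_in_jchart:
  assumes A: "A \<in> SL2"
  shows "Psi (A, abs_cp1 (affine_vec k t)) \<in> fst (jchart i k) \<longleftrightarrow> psi_den i k A t \<noteq> 0"
  by (simp add: jchart_in Psi_jet[OF A] Psi_source_in[OF A] abs_affine_in_chart)

text \<open>The numerator of the derivative of a Moebius map is a determinant, here the constant
  \<open>eps i k\<close>, so only a power of the denominator remains to be differentiated.\<close>

lemma mob_derivs:
  fixes i k :: 2
  assumes A: "A \<in> SL2"
  defines "D \<equiv> (\<lambda>z. A $ i $ k + z * A $ (i+1) $ k)"
  assumes z: "D z \<noteq> 0"
  shows "deriv (mob A i k) z = eps i k / (D z)\<^sup>2"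
    and "(deriv ^^ 2) (mob A i k) z = - 2 * eps i k * A $ (i+1) $ k / (D z) ^ 3"
proof -
  have m: "eps i k = A $ i $ k * A $ (i+1) $ (k+1) - A $ i $ (k+1) * A $ (i+1) $ k"
    using minor_det[of A i k] A by (simp add: SL2_def)
  have d: "deriv (mob A i k) w = eps i k / (D w)\<^sup>2" if "D w \<noteq> 0" for w
  proof (rule DERIV_imp_deriv)
    have "((\<lambda>t. (A $ i $ (k+1) + t * A $ (i+1) $ (k+1)) / D t) has_field_derivative
        (A $ (i+1) $ (k+1) * D w - (A $ i $ (k+1) + w * A $ (i+1) $ (k+1)) * A $ (i+1) $ k) / (D w * D w)) (at w)"
      using that unfolding D_def by (auto intro!: derivative_eq_intros)
    moreover have "A $ (i+1) $ (k+1) * D w - (A $ i $ (k+1) + w * A $ (i+1) $ (k+1)) * A $ (i+1) $ k = eps i k"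
      unfolding m D_def by (simp add: algebra_simps)
    ultimately show "(mob A i k has_field_derivative eps i k / (D w)\<^sup>2) (at w)"
      by (simp add: mob_def[abs_def] D_def power2_eq_square)
  qed
  show "deriv (mob A i k) z = eps i k / (D z)\<^sup>2" by (rule d[OF z])
  have "isCont D z" unfolding D_def by (intro continuous_intros)
  then have "\<forall>\<^sub>F w in nhds z. D w \<noteq> 0"
    using z by (intro tendsto_imp_eventually_ne[of D "D z"]) (simp_all add: isCont_def tendsto_at_iff_tendsto_nhds)
  then have "\<forall>\<^sub>F w in nhds z. deriv (mob A i k) w = eps i k / (D w)\<^sup>2" by eventually_elim (rule d)
  then have "(deriv ^^ 2) (mob A i k) z = deriv (\<lambda>w. eps i k / (D w)\<^sup>2) z" by (simp add: numeral_2_eq_2 deriv_cong_ev)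
  also have "\<dots> = - 2 * eps i k * A $ (i+1) $ k / (D z) ^ 3"
  proof (rule DERIV_imp_deriv)
    have "((\<lambda>w. eps i k / (D w)\<^sup>2) has_field_derivative - (eps i k * (2 * D z * A $ (i+1) $ k)) / ((D z)\<^sup>2 * (D z)\<^sup>2)) (at z)"
      using z unfolding D_def by (auto intro!: derivative_eq_intros)
    moreover have "- (eps i k * (2 * D z * A $ (i+1) $ k)) / ((D z)\<^sup>2 * (D z)\<^sup>2) = - 2 * eps i k * A $ (i+1) $ k / (D z) ^ 3"
      using z by (simp add: field_simps power2_eq_square power3_eq_cube)
    ultimately show "((\<lambda>w. eps i k / (D w)\<^sup>2) has_field_derivative - 2 * eps i k * A $ (i+1) $ k / (D z) ^ 3) (at z)"
      by simp
  qed
  finally show "(deriv ^^ 2) (mob A i k) z = - 2 * eps i k * A $ (i+1) $ k / (D z) ^ 3" .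
qed

lemma Psi_coords:
  assumes A: "A \<in> SL2" and nz: "psi_den i k A t \<noteq> 0"
  shows "snd (jchart i k) (Psi (A, abs_cp1 (affine_vec k t))) = psi_coords i k A t"
proof -
  let ?x = "abs_cp1 (affine_vec k t)" and ?n = "psi_num i k A t" and ?d = "psi_den i k A t"
  define y where "y = cp1_act ?x (adj2 A)"
  define z where "z = snd (affine_chart i) y"
  have y: "y \<in> fst (affine_chart i)" using Psi_source_in[OF A] nz by (simp add: y_def)
  have "y = abs_cp1 (affine_vec k t v* adj2 A)"
    unfolding y_def by (rule cp1_act_abs(1)[OF adj2_SL2[OF A] affine_vec_simps(3)])
  then have "z = eps i k * ?n / (eps i k * ?d)"
    by (simp only: z_def affine_chart_abs(2)[OF vector_matrix_mult_nonzero[OF adj2_SL2[OF A] affine_vec_simps(3)]]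
        affine_vec_adj2(2)) (simp only: affine_vec_adj2(1))
  then have z: "z = ?n / ?d" by (simp add: eps_sq)
  have yA: "cp1_act y A = ?x"
    by (simp add: y_def cp1_act_mult[OF adj2_SL2[OF A] A] adj2_mult[OF A] cp1_act_mat_1)
  have g: "germ_rep i k (\<lambda>y. cp1_act y A) y (mob A i k)"
    using germ_rep_act(2)[OF germ_rep_id[OF y] A, of k] by (simp add: yA abs_affine_in_chart)
  \<comment> \<open>At the source the denominator of the Moebius map is
    \<open>\<plusminus>1 / s\<close> with \<open>s = psi_den\<close>, by \<open>psi_den_num\<close>.
    Hence the derivatives, which have powers of this denominator below, become
    \<open>\<plusminus>s\<^sup>2\<close> and \<open>- 2 c s\<^sup>3\<close>.\<close>
  have D: "A $ i $ k + z * A $ (i+1) $ k = eps i k / ?d"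
  proof -
    have "A $ i $ k + z * A $ (i+1) $ k = (A $ i $ k * ?d + A $ (i+1) $ k * ?n) / ?d"
      using nz by (simp add: z field_simps)
    then show ?thesis by (simp add: psi_den_num[OF A])
  qed
  have Dz: "A $ i $ k + z * A $ (i+1) $ k \<noteq> 0" unfolding D using nz by (simp add: eps_sq)
  have t: "mob A i k z = t"
  proof -
    have "A $ i $ (k+1) + z * A $ (i+1) $ (k+1) = (A $ i $ (k+1) * ?d + A $ (i+1) $ (k+1) * ?n) / ?d"
      using nz by (simp add: z field_simps)
    then show ?thesis using nz by (simp add: mob_def D psi_den_num[OF A] eps_sq)
  qed
  have "deriv (mob A i k) z = eps i k * ?d\<^sup>2"
    unfolding mob_derivs(1)[OF A Dz] D using nz by (simp add: eps_def power_divide)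
  moreover have "(deriv ^^ 2) (mob A i k) z = - 2 * A $ (i+1) $ k * ?d ^ 3"
    unfolding mob_derivs(2)[OF A Dz] D using nz by (simp add: eps_def power_divide)
  ultimately show ?thesis
    using jet_of_coords(2)[OF g] by (simp add: Psi_eq[OF A] y_def[symmetric] z_def[symmetric] t) (simp add: psi_coords_def z)
qed

lemma Psi_immersion:
  assumes "A \<in> SL2" shows "Psi (A, x) \<in> immersion_jets"
proof -
  obtain k where k: "x \<in> fst (affine_chart k)" using cp1_in_some_chart .
  obtain i where i: "cp1_act x (adj2 A) \<in> fst (affine_chart i)" using cp1_in_some_chart .
  define t where "t = snd (affine_chart k) x"
  have x: "x = abs_cp1 (affine_vec k t)" using affine_chart_back[OF k] by (simp add: t_def)
  have d: "psi_den i k A t \<noteq> 0" using i Psi_source_in[OF assms] by (simp add: x)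
  show ?thesis
    using immersion_jets_iff[of "Psi (A, x)" i k] d Psi_in_jchart[OF assms] Psi_coords[OF assms d]
    by (simp add: x psi_coords_def vector_4_component eps_sq)
qed

lemma Psi_in_ichart:
  assumes A: "A \<in> SL2"
  shows "Psi (A, abs_cp1 (affine_vec l s)) \<in> fst (ichart i k) \<longleftrightarrow>
    (l = k \<or> s \<noteq> 0) \<and> psi_den i k A (flip l k s) \<noteq> 0"
proof (cases "l = k \<or> s \<noteq> 0")
  case True
  then show ?thesis
    using Psi_in_jchart[OF A, of k "flip l k s" i] by (simp add: abs_affine_flip ichart_def Psi_immersion[OF A])
next
  case False
  then have "abs_cp1 (affine_vec l s) \<notin> fst (affine_chart k)" by (simp add: abs_affine_in_chart)
  then show ?thesis using False by (simp add: ichart_def jchart_in Psi_jet[OF A])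
qed

definition psi_domain :: "bool \<Rightarrow> 2 \<Rightarrow> 2 \<Rightarrow> 2 \<Rightarrow> (complex^4) set" where
  "psi_domain c l i k = {u. pdom c u \<and> (l = k \<or> u $ 4 \<noteq> 0) \<and> psi_den i k (pmat c u) (flip l k (u $ 4)) \<noteq> 0}"

lemma psi_domain_eq: "snd (pchart c l) ` (fst (pchart c l) \<inter> Psi -` fst (ichart i k)) = psi_domain c l i k"
proof (intro set_eqI)
  fix u
  have "u \<in> snd (pchart c l) ` (fst (pchart c l) \<inter> Psi -` fst (ichart i k)) \<longleftrightarrow>
      pdom c u \<and> chart_inv (pchart c l) u \<in> Psi -` fst (ichart i k)"
    using chart_image_iff[OF inj_pchart, of u c l "Psi -` fst (ichart i k)"] by (simp add: pchart_image Int_commute)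
  also have "\<dots> \<longleftrightarrow> u \<in> psi_domain c l i k"
    by (auto simp: psi_domain_def chart_inv_pchart pinv_def Psi_in_ichart[OF pmat_in_SL2])
  finally show "u \<in> snd (pchart c l) ` (fst (pchart c l) \<inter> Psi -` fst (ichart i k)) \<longleftrightarrow> u \<in> psi_domain c l i k" .
qed

lemma Psi_local_rep:
  assumes "u \<in> psi_domain c l i k"
  shows "local_rep (pchart c l) (ichart i k) Psi u = psi_coords i k (pmat c u) (flip l k (u $ 4))"
proof -
  have u: "pdom c u" "l = k \<or> u $ 4 \<noteq> 0" "psi_den i k (pmat c u) (flip l k (u $ 4)) \<noteq> 0"
    using assms by (auto simp: psi_domain_def)
  then show ?thesis
    using Psi_coords[OF pmat_in_SL2[OF u(1)] u(3)]
    by (simp add: local_rep_def chart_inv_pchart pinv_def ichart_def abs_affine_flip)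
qed

lemma holomorphic_psi_den_num:
  assumes "\<And>u. u \<in> S \<Longrightarrow> pdom c u" "holomorphic_fun_on t S"
  shows "holomorphic_fun_on (\<lambda>u. psi_den i k (pmat c u) (t u)) S" "holomorphic_fun_on (\<lambda>u. psi_num i k (pmat c u) (t u)) S"
  unfolding psi_den_def psi_num_def by (intro holomorphic_fun_intros holomorphic_pmat assms; assumption)+

lemma holomorphic_affine_coord: "(\<And>u. u \<in> S \<Longrightarrow> l = k \<or> u $ 4 \<noteq> 0) \<Longrightarrow> holomorphic_fun_on (\<lambda>u. flip l k (u $ 4)) S"
  by (intro holomorphic_flip holomorphic_fun_on_nth)

lemma open_psi_domain: "open (psi_domain c l i k)"
proof -
  let ?S = "{u. pdom c u \<and> pdom c u \<and> (l = k \<or> u $ 4 \<noteq> 0)}"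
  have "continuous_on ?S (\<lambda>u. psi_den i k (pmat c u) (flip l k (u $ 4)))"
    by (intro holomorphic_fun_on_imp_continuous_on holomorphic_psi_den_num holomorphic_affine_coord) auto
  from open_inter_vimage[OF open_pchart_domain this, of "- {0}"]
  show ?thesis by (simp add: psi_domain_def open_Compl conj_ac)
qed

lemma holomorphic_psi_coords:
  "holomorphic_map_on (\<lambda>u. psi_coords i k (pmat c u) (flip l k (u $ 4))) (psi_domain c l i k)"
  unfolding psi_coords_def
  by (intro holomorphic_map_on_vector4 holomorphic_fun_intros holomorphic_psi_den_num holomorphic_affine_coord holomorphic_pmat)
    (auto simp: psi_domain_def)

lemma holomorphic_Psi_local_rep: "holomorphic_map_on (local_rep (pchart c l) (ichart i k) Psi) (psi_domain c l i k)"
  by (rule holomorphic_map_on_transform[OF holomorphic_psi_coords open_psi_domain]) (simp add: Psi_local_rep)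

section \<open>Local inverses of \<open>Psi\<close>\<close>

text \<open>On the coordinates \<open>(z, w, w\<^sub>z, w\<^sub>z\<^sub>z)\<close> the denominator \<open>psi_den\<close> is a square root of \<open>\<plusminus>w\<^sub>z\<close>,
  and the branch through \<open>s0\<close> determines the matrix.\<close>

definition root_branch :: "2 \<Rightarrow> 2 \<Rightarrow> complex \<Rightarrow> complex^4 \<Rightarrow> complex" where
  "root_branch i k s0 v = s0 * csqrt (eps i k * v $ 3 / s0\<^sup>2)"

text \<open>The coordinates solved for the entries: \<open>c\<close> comes from
  \<open>w\<^sub>z\<^sub>z = - 2 c s\<^sup>3\<close>, \<open>a\<close> from
  \<open>a s + c n = eps i k\<close> with \<open>n = z s\<close>, and the other two entries from
  \<open>n = t a - b\<close> and \<open>s = d - t c\<close>, where \<open>t = w\<close>.\<close>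

definition psi_matrix :: "2 \<Rightarrow> 2 \<Rightarrow> complex \<Rightarrow> complex^4 \<Rightarrow> complex^2^2" where
  "psi_matrix i k s0 v = (let s = root_branch i k s0 v; c = - v $ 4 / (2 * s ^ 3); a = eps i k / s - c * v $ 1
    in \<chi> r j. if r = i then if j = k then a else v $ 2 * a - v $ 1 * s else if j = k then c else s + v $ 2 * c)"

text \<open>Division by \<open>s0\<^sup>2\<close> moves the branch cut away from the chosen value:
  where \<open>eps i k * w\<^sub>z = s0\<^sup>2\<close> the argument of \<open>csqrt\<close> is
  \<open>1\<close>.\<close>

definition branch_domain :: "2 \<Rightarrow> 2 \<Rightarrow> complex \<Rightarrow> (complex^4) set" where
  "branch_domain i k s0 = {v. eps i k * v $ 3 / s0\<^sup>2 \<notin> \<real>\<^sub>\<le>\<^sub>0}"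

lemma open_branch_domain: "open (branch_domain i k s0)"
proof -
  have "open ((\<lambda>v :: complex^4. eps i k * v $ 3 / s0\<^sup>2) -` (- \<real>\<^sub>\<le>\<^sub>0))"
    unfolding divide_inverse by (intro open_vimage open_Compl closed_nonpos_Reals_complex continuous_intros)
  then show ?thesis by (simp add: branch_domain_def vimage_def)
qed

lemma branch_domain_nonzero: "v \<in> branch_domain i k s0 \<Longrightarrow> v $ 3 \<noteq> 0 \<and> s0 \<noteq> 0"
  by (auto simp: branch_domain_def)

lemma Re_csqrt_pos: "z \<notin> \<real>\<^sub>\<le>\<^sub>0 \<Longrightarrow> Re (csqrt z) > 0"
proof (rule ccontr)
  assume z: "z \<notin> \<real>\<^sub>\<le>\<^sub>0" and "\<not> Re (csqrt z) > 0"
  then have "Re (csqrt z) = 0" using csqrt_principal[of z] by auto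
  then have "Re ((csqrt z)\<^sup>2) \<le> 0" "Im ((csqrt z)\<^sup>2) = 0" by (simp_all add: power2_eq_square)
  then show False using z by (simp add: complex_nonpos_Reals_iff)
qed

lemma root_branch:
  assumes "v \<in> branch_domain i k s0"
  shows "(root_branch i k s0 v)\<^sup>2 = eps i k * v $ 3" "root_branch i k s0 v \<noteq> 0" "Re (root_branch i k s0 v / s0) > 0"
proof -
  have nz: "v $ 3 \<noteq> 0" "s0 \<noteq> 0" using branch_domain_nonzero[OF assms] by auto
  show sq: "(root_branch i k s0 v)\<^sup>2 = eps i k * v $ 3" using nz by (simp add: root_branch_def power_mult_distrib)
  show "root_branch i k s0 v \<noteq> 0" using nz by (simp add: root_branch_def eps_sq)
  have "eps i k * v $ 3 / s0\<^sup>2 \<notin> \<real>\<^sub>\<le>\<^sub>0" using assms by (simp add: branch_domain_def)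
  then have "Re (csqrt (eps i k * v $ 3 / s0\<^sup>2)) > 0"
    by (rule Re_csqrt_pos)
  then show "Re (root_branch i k s0 v / s0) > 0" using nz by (simp add: root_branch_def)
qed

lemma psi_matrix_entries:
  fixes v :: "complex^4" and i k :: 2 and s0 :: complex
  defines "s \<equiv> root_branch i k s0 v"
  shows "psi_matrix i k s0 v $ (i+1) $ k = - v $ 4 / (2 * s ^ 3)"
    "psi_matrix i k s0 v $ i $ k = eps i k / s + v $ 4 / (2 * s ^ 3) * v $ 1"
    "psi_matrix i k s0 v $ i $ (k+1) = v $ 2 * psi_matrix i k s0 v $ i $ k - v $ 1 * s"
    "psi_matrix i k s0 v $ (i+1) $ (k+1) = s + v $ 2 * psi_matrix i k s0 v $ (i+1) $ k"
  by (simp_all add: psi_matrix_def s_def Let_def index2_succ)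

lemma psi_matrix_den_num:
  "psi_den i k (psi_matrix i k s0 v) (v $ 2) = root_branch i k s0 v"
  "psi_num i k (psi_matrix i k s0 v) (v $ 2) = v $ 1 * root_branch i k s0 v"
  by (simp_all add: psi_den_def psi_num_def psi_matrix_entries)

text \<open>The determinant is \<open>a s + c n\<close> up to sign, and the entry \<open>a\<close>
  was chosen to make this \<open>eps i k\<close>.\<close>

lemma psi_matrix_SL2:
  assumes "v \<in> branch_domain i k s0" shows "psi_matrix i k s0 v \<in> SL2"
proof -
  let ?A = "psi_matrix i k s0 v" and ?s = "root_branch i k s0 v"
  have "eps i k * det ?A = ?A $ i $ k * psi_den i k ?A (v $ 2) + ?A $ (i+1) $ k * psi_num i k ?A (v $ 2)"
    unfolding minor_det[symmetric] psi_den_def psi_num_def by (simp add: algebra_simps)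
  also have "\<dots> = (?A $ i $ k + ?A $ (i+1) $ k * v $ 1) * ?s" by (simp add: psi_matrix_den_num algebra_simps)
  also have "\<dots> = eps i k" using root_branch(2)[OF assms] by (simp add: psi_matrix_entries)
  finally show ?thesis by (simp add: SL2_def eps_sq)
qed

lemma psi_coords_matrix:
  assumes "v \<in> branch_domain i k s0" shows "psi_coords i k (psi_matrix i k s0 v) (v $ 2) = v"
  using root_branch[OF assms]
  by (simp add: psi_coords_def psi_matrix_den_num vec_eq_iff forall_4 vector_4_component eps_sq psi_matrix_entries(1))

lemma Re_pos_square: "Re z > 0 \<Longrightarrow> z\<^sup>2 \<notin> \<real>\<^sub>\<le>\<^sub>0"
proof
  assume pos: "Re z > 0" and "z\<^sup>2 \<in> \<real>\<^sub>\<le>\<^sub>0"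
  then have "Re z * Re z \<le> Im z * Im z" "Im z = 0" by (auto simp: complex_nonpos_Reals_iff power2_eq_square)
  then show False using mult_pos_pos[OF pos pos] by simp
qed

text \<open>On the half-plane \<open>Re (s / s0) > 0\<close> the principal root of
  \<open>(s / s0)\<^sup>2\<close> is \<open>s / s0\<close>, so the branch returns \<open>s\<close>
  and not \<open>- s\<close>. The entries then follow by undoing the formulas for the
  coordinates.\<close>

lemma psi_coords_branch:
  assumes A: "A \<in> SL2" and pos: "Re (psi_den i k A t / s0) > 0"
  shows "psi_coords i k A t \<in> branch_domain i k s0" "psi_matrix i k s0 (psi_coords i k A t) = A"
proof -
  let ?s = "psi_den i k A t" and ?v = "psi_coords i k A t"
  have nz: "s0 \<noteq> 0" "?s \<noteq> 0" using pos by auto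
  have v: "?v $ 1 = psi_num i k A t / ?s" "?v $ 2 = t" "?v $ 3 = eps i k * ?s\<^sup>2" "?v $ 4 = - 2 * A $ (i+1) $ k * ?s ^ 3"
    by (simp_all add: psi_coords_def vector_4_component)
  have sq: "eps i k * ?v $ 3 / s0\<^sup>2 = (?s / s0)\<^sup>2" by (simp add: v eps_sq power_divide)
  show d: "?v \<in> branch_domain i k s0" using Re_pos_square[OF pos] by (simp add: branch_domain_def sq)
  have r: "root_branch i k s0 ?v = ?s"
    unfolding root_branch_def sq using csqrt_square[of "?s / s0"] pos nz by simp
  have c: "psi_matrix i k s0 ?v $ (i+1) $ k = A $ (i+1) $ k" using nz by (simp add: psi_matrix_entries r v)
  have a: "psi_matrix i k s0 ?v $ i $ k = A $ i $ k"
  proof -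
    have "psi_matrix i k s0 ?v $ i $ k = (eps i k - A $ (i+1) $ k * psi_num i k A t) / ?s"
      using nz by (simp add: psi_matrix_entries r v field_simps)
    also have "eps i k - A $ (i+1) $ k * psi_num i k A t = A $ i $ k * ?s"
      using psi_den_num(1)[OF A, of i k t] by (simp add: algebra_simps)
    finally show ?thesis using nz by simp
  qed
  have "psi_matrix i k s0 ?v $ i $ (k+1) = A $ i $ (k+1)"
    using nz by (simp add: psi_matrix_entries(3) a r v psi_num_def)
  moreover have "psi_matrix i k s0 ?v $ (i+1) $ (k+1) = A $ (i+1) $ (k+1)"
    by (simp add: psi_matrix_entries(4) c r v psi_den_def)
  ultimately have "psi_matrix i k s0 ?v $ r $ j = A $ r $ j" for r j
    using index2_cases[of r i] index2_cases[of j k] a c by (elim disjE) simp_all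
  then show "psi_matrix i k s0 ?v = A" by (simp add: vec_eq_iff)
qed

lemma holomorphic_psi_matrix: "holomorphic_fun_on (\<lambda>v. psi_matrix i k s0 v $ r $ j) (branch_domain i k s0)"
proof -
  let ?S = "branch_domain i k s0"
  have root: "holomorphic_fun_on (root_branch i k s0) ?S"
  proof (rule holomorphic_fun_onI)
    fix v assume v: "v \<in> ?S"
    have "has_cgradient (\<lambda>v. eps i k / s0\<^sup>2 * v $ 3) ((eps i k / s0\<^sup>2) *s axis 3 1) v"
      by (rule has_cgradient_scale[OF has_cgradient_nth])
    then have 1: "has_cgradient (\<lambda>v. eps i k * v $ 3 / s0\<^sup>2) ((eps i k / s0\<^sup>2) *s axis 3 1) v" by simp
    have "(csqrt has_field_derivative inverse (2 * csqrt (eps i k * v $ 3 / s0\<^sup>2))) (at (eps i k * v $ 3 / s0\<^sup>2))"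
      using v by (intro has_field_derivative_csqrt) (simp add: branch_domain_def)
    from has_cgradient_scale[OF has_cgradient_chain1[OF 1 this], of s0]
    show "\<exists>g. has_cgradient (root_branch i k s0) g v" unfolding root_branch_def[abs_def] by blast
  qed
  have c: "holomorphic_fun_on (\<lambda>v. - v $ 4 / (2 * root_branch i k s0 v ^ 3)) ?S"
    by (intro holomorphic_fun_intros root) (simp add: root_branch(2))
  have a: "holomorphic_fun_on (\<lambda>v. eps i k / root_branch i k s0 v - - v $ 4 / (2 * root_branch i k s0 v ^ 3) * v $ 1) ?S"
    by (intro holomorphic_fun_on_diff holomorphic_fun_on_mult holomorphic_fun_on_divide holomorphic_fun_on_const holomorphic_fun_on_nth root c)
      (simp add: root_branch(2))
  have "holomorphic_fun_on (\<lambda>v. v $ 2 * (eps i k / root_branch i k s0 v - - v $ 4 / (2 * root_branch i k s0 v ^ 3) * v $ 1) - v $ 1 * root_branch i k s0 v) ?S"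
    "holomorphic_fun_on (\<lambda>v. root_branch i k s0 v + v $ 2 * (- v $ 4 / (2 * root_branch i k s0 v ^ 3))) ?S"
    by (intro holomorphic_fun_on_diff holomorphic_fun_on_add holomorphic_fun_on_mult holomorphic_fun_on_nth root c a)+
  then show ?thesis
    using a c by (cases "r = i"; cases "j = k") (simp_all add: psi_matrix_def Let_def)
qed

definition psi_section :: "2 \<Rightarrow> 2 \<Rightarrow> complex \<Rightarrow> jet2 \<Rightarrow> (complex^2^2) \<times> cp1" where
  "psi_section i k s0 j = (let v = snd (ichart i k) j in (psi_matrix i k s0 v, abs_cp1 (affine_vec k (v $ 2))))"

text \<open>\<open>A\<close> and \<open>- A\<close> have the same jet, and \<open>psi_den\<close> is
  odd in \<open>A\<close>; the half-plane condition therefore admits at most one of them.\<close>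

definition psi_source :: "2 \<Rightarrow> 2 \<Rightarrow> complex \<Rightarrow> ((complex^2^2) \<times> cp1) set" where
  "psi_source i k s0 = {(A, x). A \<in> SL2 \<and> x \<in> fst (affine_chart k) \<and> Re (psi_den i k A (snd (affine_chart k) x) / s0) > 0}"

definition psi_target :: "2 \<Rightarrow> 2 \<Rightarrow> complex \<Rightarrow> jet2 set" where
  "psi_target i k s0 = {j \<in> fst (ichart i k). snd (ichart i k) j \<in> branch_domain i k s0}"

lemma psi_section_in:
  assumes "j \<in> psi_target i k s0"
  shows "psi_section i k s0 j \<in> psi_source i k s0" "Psi (psi_section i k s0 j) = j"
proof -
  define v where "v = snd (ichart i k) j"
  have j: "j \<in> fst (ichart i k)" "v \<in> branch_domain i k s0" using assms by (auto simp: psi_target_def v_def)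
  have s: "psi_section i k s0 j = (psi_matrix i k s0 v, abs_cp1 (affine_vec k (v $ 2)))" by (simp add: psi_section_def v_def Let_def)
  have A: "psi_matrix i k s0 v \<in> SL2" by (rule psi_matrix_SL2[OF j(2)])
  have d: "psi_den i k (psi_matrix i k s0 v) (v $ 2) \<noteq> 0" using root_branch(2)[OF j(2)] by (simp add: psi_matrix_den_num)
  show "psi_section i k s0 j \<in> psi_source i k s0"
    using A root_branch(3)[OF j(2)]
    by (simp add: s psi_source_def abs_affine_in_chart abs_affine_coord flip_def psi_matrix_den_num)
  have "Psi (psi_section i k s0 j) \<in> fst (ichart i k)" using d Psi_in_ichart[OF A, of k] by (simp add: s flip_def)
  moreover have "snd (ichart i k) (Psi (psi_section i k s0 j)) = snd (ichart i k) j"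
    using Psi_coords[OF A d] psi_coords_matrix[OF j(2)] by (simp add: s ichart_def v_def)
  ultimately show "Psi (psi_section i k s0 j) = j" using inj_onD[OF inj_ichart] j(1) by blast
qed

lemma Psi_source_target:
  assumes "m \<in> psi_source i k s0"
  shows "Psi m \<in> psi_target i k s0" "psi_section i k s0 (Psi m) = m"
proof -
  obtain A x where m: "m = (A, x)" by (cases m)
  define t where "t = snd (affine_chart k) x"
  have A: "A \<in> SL2" and k: "x \<in> fst (affine_chart k)" and pos: "Re (psi_den i k A t / s0) > 0"
    using assms by (auto simp: m psi_source_def t_def)
  have x: "x = abs_cp1 (affine_vec k t)" using affine_chart_back[OF k] by (simp add: t_def)
  have d: "psi_den i k A t \<noteq> 0" using pos by auto
  have c: "snd (ichart i k) (Psi m) = psi_coords i k A t" using Psi_coords[OF A d] by (simp add: ichart_def m x)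
  have "Psi m \<in> fst (ichart i k)" using d Psi_in_ichart[OF A, of k] by (simp add: m x flip_def)
  then show "Psi m \<in> psi_target i k s0" using psi_coords_branch(1)[OF A pos] by (simp add: psi_target_def c)
  have "psi_coords i k A t $ 2 = t" by (simp add: psi_coords_def vector_4_component)
  then show "psi_section i k s0 (Psi m) = m"
    using psi_coords_branch(2)[OF A pos] unfolding psi_section_def c Let_def by (simp add: m x)
qed

lemma bij_betw_Psi: "bij_betw Psi (psi_source i k s0) (psi_target i k s0)"
  by (rule bij_betw_byWitness[of _ "psi_section i k s0"]) (auto simp: psi_section_in Psi_source_target)

lemma open_in_psi_source: "open_in product_atlas (psi_source i k s0)"
  unfolding open_in_def
proof (intro conjI ballI)
  show "psi_source i k s0 \<subseteq> carrier_of product_atlas" by (auto simp: carrier_product_atlas psi_source_def)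
  fix \<kappa> :: "((complex^2^2) \<times> cp1, complex^4) chart" assume "\<kappa> \<in> product_atlas"
  then obtain c l where k: "\<kappa> = pchart c l" by (elim product_atlas_cases)
  let ?S = "{u. pdom c u \<and> pdom c u \<and> (l = k \<or> u $ 4 \<noteq> 0)}"
  have cont: "continuous_on ?S (\<lambda>u. psi_den i k (pmat c u) (flip l k (u $ 4)))"
    by (intro holomorphic_fun_on_imp_continuous_on holomorphic_psi_den_num holomorphic_affine_coord) auto
  have "open ((\<lambda>w. Re (w / s0)) -` {0<..})"
    \<comment> \<open>For \<open>s0 = 0\<close> the quotient is \<open>0\<close> by default and the
      set is empty.\<close>
    by (cases "s0 = 0") (auto intro!: open_vimage continuous_intros)
  from open_inter_vimage[OF open_pchart_domain cont this]
  have "open {u. pdom c u \<and> (l = k \<or> u $ 4 \<noteq> 0) \<and> Re (psi_den i k (pmat c u) (flip l k (u $ 4)) / s0) > 0}"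
    by (simp add: conj_ac)
  moreover have "snd (pchart c l) ` (psi_source i k s0 \<inter> fst (pchart c l)) =
      {u. pdom c u \<and> (l = k \<or> u $ 4 \<noteq> 0) \<and> Re (psi_den i k (pmat c u) (flip l k (u $ 4)) / s0) > 0}"
  proof (intro set_eqI)
    fix u
    show "u \<in> snd (pchart c l) ` (psi_source i k s0 \<inter> fst (pchart c l)) \<longleftrightarrow>
      u \<in> {u. pdom c u \<and> (l = k \<or> u $ 4 \<noteq> 0) \<and> Re (psi_den i k (pmat c u) (flip l k (u $ 4)) / s0) > 0}"
      unfolding chart_image_iff[OF inj_pchart] pchart_image
      by (auto simp: chart_inv_pchart pinv_def psi_source_def pmat_in_SL2 abs_affine_in_chart abs_affine_coord)
  qed
  ultimately show "open (snd \<kappa> ` (psi_source i k s0 \<inter> fst \<kappa>))" by (simp add: k)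
qed

lemma psi_target_image: "snd (ichart i k) ` psi_target i k s0 = branch_domain i k s0"
proof (intro set_eqI iffI)
  fix v assume v: "v \<in> branch_domain i k s0"
  then have "v \<in> snd (ichart i k) ` fst (ichart i k)" using branch_domain_nonzero[OF v] by (simp add: ichart_image)
  then show "v \<in> snd (ichart i k) ` psi_target i k s0" using v by (auto simp: psi_target_def)
qed (auto simp: psi_target_def)

lemma open_in_psi_target: "open_in immersion_atlas (psi_target i k s0)"
proof (rule open_in_chart[OF complex_manifold_immersion_atlas ichart_in_atlas])
  show "psi_target i k s0 \<subseteq> fst (ichart i k)" by (auto simp: psi_target_def)
  show "open (snd (ichart i k) ` psi_target i k s0)" unfolding psi_target_image by (rule open_branch_domain)
qed

lemma manifold_holomorphic_Psi: "manifold_holomorphic_on product_atlas immersion_atlas Psi (psi_source i k s0)"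
proof (rule manifold_holomorphic_onI[OF complex_manifold_product_atlas complex_manifold_immersion_atlas])
  fix m assume m: "m \<in> psi_source i k s0"
  have "m \<in> carrier_of product_atlas" using m by (auto simp: carrier_product_atlas psi_source_def)
  then obtain \<kappa> where "\<kappa> \<in> product_atlas" "m \<in> fst \<kappa>" by (auto simp: carrier_of_def)
  then obtain c l where cl: "m \<in> fst (pchart c l)" by (metis product_atlas_cases)
  have "Psi m \<in> fst (ichart i k)" using Psi_source_target(1)[OF m] by (simp add: psi_target_def)
  then have um: "snd (pchart c l) m \<in> psi_domain c l i k" using cl by (auto simp flip: psi_domain_eq)
  show "\<exists>\<kappa>\<in>product_atlas. \<exists>\<kappa>'\<in>immersion_atlas. \<exists>V. m \<in> fst \<kappa> \<and> open V \<and> snd \<kappa> m \<in> V \<and> V \<subseteq> snd \<kappa> ` fst \<kappa> \<and>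
      (\<forall>u\<in>V. Psi (chart_inv \<kappa> u) \<in> fst \<kappa>') \<and> holomorphic_map_on (local_rep \<kappa> \<kappa>' Psi) V"
  proof (intro bexI[OF _ pchart_in_atlas[of c l]] bexI[OF _ ichart_in_atlas[of i k]] exI[of _ "psi_domain c l i k"] conjI ballI)
    show "psi_domain c l i k \<subseteq> snd (pchart c l) ` fst (pchart c l)" by (auto simp flip: psi_domain_eq)
    show "Psi (chart_inv (pchart c l) u) \<in> fst (ichart i k)" if "u \<in> psi_domain c l i k" for u
      using that chart_inv_left[OF inj_pchart] by (auto simp flip: psi_domain_eq)
  qed (use cl um open_psi_domain holomorphic_Psi_local_rep in auto)
qed

lemma manifold_holomorphic_psi_section:
  "manifold_holomorphic_on immersion_atlas product_atlas (psi_section i k s0) (psi_target i k s0)"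
proof (rule manifold_holomorphic_onI[OF complex_manifold_immersion_atlas complex_manifold_product_atlas])
  fix j assume j: "j \<in> psi_target i k s0"
  define v where "v = snd (ichart i k) j"
  have jv: "j \<in> fst (ichart i k)" "v \<in> branch_domain i k s0" using j by (auto simp: psi_target_def v_def)
  let ?A = "psi_matrix i k s0"
  have "det (?A v) = 1" using psi_matrix_SL2[OF jv(2)] by (simp add: SL2_def)
  then have "?A v $ 1 $ 1 \<noteq> 0 \<or> ?A v $ 1 $ 2 \<noteq> 0" by (auto simp: det_2)
  then obtain c :: bool where c: "?A v $ 1 $ (if c then 1 else 2) \<noteq> 0" by (metis (full_types))
  define V where "V = {v \<in> branch_domain i k s0. ?A v $ 1 $ (if c then 1 else 2) \<in> - {0}}"
  have V: "open V" unfolding V_def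
    by (rule open_inter_vimage[OF open_branch_domain holomorphic_fun_on_imp_continuous_on[OF holomorphic_psi_matrix]]) (simp add: open_Compl)
  have inv: "psi_section i k s0 (chart_inv (ichart i k) w) = (?A w, abs_cp1 (affine_vec k (w $ 2)))" if "w \<in> V" for w
  proof -
    have "w $ 3 \<noteq> 0" using that branch_domain_nonzero by (auto simp: V_def)
    then have "snd (ichart i k) (chart_inv (ichart i k) w) = w" by (intro chart_inv_right) (simp add: ichart_image)
    then show ?thesis by (simp add: psi_section_def)
  qed
  show "\<exists>\<kappa>\<in>immersion_atlas. \<exists>\<kappa>'\<in>product_atlas. \<exists>V. j \<in> fst \<kappa> \<and> open V \<and> snd \<kappa> j \<in> V \<and> V \<subseteq> snd \<kappa> ` fst \<kappa> \<and>
      (\<forall>u\<in>V. psi_section i k s0 (chart_inv \<kappa> u) \<in> fst \<kappa>') \<and> holomorphic_map_on (local_rep \<kappa> \<kappa>' (psi_section i k s0)) V"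
  proof (intro bexI[OF _ pchart_in_atlas[of c k]] bexI[OF _ ichart_in_atlas[of i k]] exI[of _ V] conjI ballI)
    show "snd (ichart i k) j \<in> V" using jv c by (simp add: V_def v_def)
    show "V \<subseteq> snd (ichart i k) ` fst (ichart i k)" using branch_domain_nonzero by (auto simp: ichart_image V_def)
    show "psi_section i k s0 (chart_inv (ichart i k) w) \<in> fst (pchart c k)" if "w \<in> V" for w
      using that psi_matrix_SL2 by (cases c) (auto simp: inv[OF that] fst_pchart abs_affine_in_chart V_def)
    have "holomorphic_map_on (\<lambda>w. vector [?A w $ 1 $ 1, ?A w $ 1 $ 2, ?A w $ 2 $ (if c then 1 else 2), w $ 2] :: complex^4) V"
      by (intro holomorphic_map_on_vector4 holomorphic_fun_on_nth holomorphic_fun_on_subset[OF holomorphic_psi_matrix])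
        (auto simp: V_def)
    then show "holomorphic_map_on (local_rep (ichart i k) (pchart c k) (psi_section i k s0)) V"
      by (rule holomorphic_map_on_transform[OF _ V])
        (cases c, simp_all add: local_rep_def inv snd_pchart abs_affine_coord flip_def)
  qed (use jv V in auto)
qed

text \<open>The chart neighbourhoods in the definition of holomorphy may leave \<open>M\<close>, so
  they are first intersected with the open set \<open>M\<close>. This serves to replace
  \<open>psi_section\<close> by \<open>inv_into\<close>, which is known to agree with it on the
  target set only.\<close>

lemma manifold_holomorphic_on_cong:
  assumes A: "complex_manifold \<A>" and M: "open_in \<A> M" and F: "manifold_holomorphic_on \<A> \<B> F M"
    and eq: "\<And>x. x \<in> M \<Longrightarrow> F x = G x"
  shows "manifold_holomorphic_on \<A> \<B> G M"
  unfolding manifold_holomorphic_on_def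
proof (intro ballI impI)
  fix x \<kappa> \<kappa>' assume x: "x \<in> M" and k: "\<kappa> \<in> \<A>" "\<kappa>' \<in> \<B>" and xk: "x \<in> fst \<kappa> \<and> G x \<in> fst \<kappa>'"
  obtain V where V: "open V" "snd \<kappa> x \<in> V" "V \<subseteq> snd \<kappa> ` fst \<kappa>"
    "\<And>u. u \<in> V \<Longrightarrow> F (chart_inv \<kappa> u) \<in> fst \<kappa>'" "holomorphic_map_on (local_rep \<kappa> \<kappa>' F) V"
    using F x k xk eq[OF x] unfolding manifold_holomorphic_on_def by metis
  let ?W = "V \<inter> snd \<kappa> ` (M \<inter> fst \<kappa>)"
  have W: "open ?W" using V(1) M k(1) by (auto simp: open_in_def)
  have e: "F (chart_inv \<kappa> u) = G (chart_inv \<kappa> u)" if "u \<in> ?W" for u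
    using that chart_image_iff[OF complex_manifoldD(1)[OF A k(1)], of u M] eq by blast
  have "holomorphic_map_on (local_rep \<kappa> \<kappa>' G) ?W"
    by (rule holomorphic_map_on_transform[OF holomorphic_map_on_subset[OF V(5)] W]) (use e in \<open>auto simp: local_rep_def\<close>)
  moreover have "G (chart_inv \<kappa> u) \<in> fst \<kappa>'" if "u \<in> ?W" for u using V(4)[of u] e[OF that] that by simp
  ultimately show "\<exists>V. open V \<and> snd \<kappa> x \<in> V \<and> V \<subseteq> snd \<kappa> ` fst \<kappa> \<and>
      (\<forall>u\<in>V. G (chart_inv \<kappa> u) \<in> fst \<kappa>') \<and> holomorphic_map_on (local_rep \<kappa> \<kappa>' G) V"
    using W V(2,3) x xk by (intro exI[of _ ?W]) auto
qed

lemma local_biholomorphism_Psi: "local_biholomorphism product_atlas immersion_atlas Psi"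
  unfolding local_biholomorphism_def
proof (intro conjI ballI)
  show "Psi ` carrier_of product_atlas \<subseteq> carrier_of immersion_atlas"
    by (auto simp: carrier_product_atlas carrier_immersion_atlas Psi_immersion)
  fix m assume "m \<in> carrier_of product_atlas"
  then obtain A x where m: "m = (A, x)" and A: "A \<in> SL2" by (auto simp: carrier_product_atlas)
  obtain k where k: "x \<in> fst (affine_chart k)" using cp1_in_some_chart .
  obtain i where i: "cp1_act x (adj2 A) \<in> fst (affine_chart i)" using cp1_in_some_chart .
  \<comment> \<open>With \<open>s0\<close> the denominator at the point itself, the quotient in
    \<open>psi_source\<close> equals \<open>1\<close> there.\<close>
  define s0 where "s0 = psi_den i k A (snd (affine_chart k) x)"
  have "s0 \<noteq> 0" using i Psi_source_in[OF A, of k "snd (affine_chart k) x" i] affine_chart_back[OF k] by (simp add: s0_def)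
  then have "m \<in> psi_source i k s0" using A k by (simp add: m psi_source_def s0_def[symmetric])
  moreover have "manifold_holomorphic_on immersion_atlas product_atlas (inv_into (psi_source i k s0) Psi) (psi_target i k s0)"
  proof (rule manifold_holomorphic_on_cong[OF complex_manifold_immersion_atlas open_in_psi_target manifold_holomorphic_psi_section])
    fix j assume j: "j \<in> psi_target i k s0"
    show "psi_section i k s0 j = inv_into (psi_source i k s0) Psi j"
      using inv_into_f_f[OF bij_betw_imp_inj_on[OF bij_betw_Psi] psi_section_in(1)[OF j]] psi_section_in(2)[OF j] by simp
  qed
  ultimately show "\<exists>M N. open_in product_atlas M \<and> open_in immersion_atlas N \<and> m \<in> M \<and> bij_betw Psi M N \<and>
      manifold_holomorphic_on product_atlas immersion_atlas Psi M \<and>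
      manifold_holomorphic_on immersion_atlas product_atlas (inv_into M Psi) N"
    using open_in_psi_source open_in_psi_target bij_betw_Psi manifold_holomorphic_Psi by blast
qed

lemma Psi_surj: "Psi ` carrier_of product_atlas = carrier_of immersion_atlas"
proof
  show "Psi ` carrier_of product_atlas \<subseteq> carrier_of immersion_atlas"
    by (auto simp: carrier_product_atlas carrier_immersion_atlas Psi_immersion)
  show "carrier_of immersion_atlas \<subseteq> Psi ` carrier_of product_atlas"
  proof
    fix j assume "j \<in> carrier_of immersion_atlas"
    then obtain \<kappa> where "\<kappa> \<in> immersion_atlas" "j \<in> fst \<kappa>" by (auto simp: carrier_of_def)
    then obtain i k where j: "j \<in> fst (ichart i k)" by (metis immersion_atlas_cases)
    define v where "v = snd (ichart i k) j"
    \<comment> \<open>Either square root works, the two giving preimages \<open>A\<close> and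
      \<open>- A\<close>; the argument of the branch is then \<open>1\<close>, off the cut.\<close>
    define s0 where "s0 = csqrt (eps i k * v $ 3)"
    have "v $ 3 \<noteq> 0" using j ichart_image[of i k] by (auto simp: v_def)
    then have "eps i k * v $ 3 / s0\<^sup>2 = 1" by (simp add: s0_def eps_sq)
    then have "j \<in> psi_target i k s0" using j by (simp add: psi_target_def branch_domain_def v_def)
    from psi_section_in[OF this]
    have "Psi (psi_section i k s0 j) = j" "psi_section i k s0 j \<in> carrier_of product_atlas"
      by (auto simp: carrier_product_atlas psi_source_def)
    then show "j \<in> Psi ` carrier_of product_atlas" by (metis imageI)
  qed
qed

section \<open>The pull-back of the contact system\<close>

text \<open>The differentiated determinant condition of \<open>pgrad_trace\<close>, with entries
  permuted by the charts; the overall sign does not matter as the right side is zero.\<close>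

lemma pgrad_minor:
  assumes "pdom c u"
  defines "A \<equiv> pmat c u"
  shows "A $ (i+1) $ (k+1) *s pgrad c u i k + A $ i $ k *s pgrad c u (i+1) (k+1)
    - A $ i $ (k+1) *s pgrad c u (i+1) k - A $ (i+1) $ k *s pgrad c u i (k+1) = 0"
proof -
  have three: "pgrad c u 3 j = pgrad c u 1 j" "pgrad c u j 3 = pgrad c u j 1" for j
  proof -
    have "(3::2) = 1" by simp
    from arg_cong[OF this, of "\<lambda>l. pgrad c u l j"] arg_cong[OF this, of "pgrad c u j"]
    show "pgrad c u 3 j = pgrad c u 1 j" "pgrad c u j 3 = pgrad c u j 1" .
  qed
  show ?thesis
    using pgrad_trace[OF assms(1)] exhaust_2[of i] exhaust_2[of k]
    by (auto simp: A_def nth_three three algebra_simps)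
qed

lemma hform_affine:
  "hform c u (affine_vec k t) j = eps i k *s (psi_den i k (pmat c u) t *s pgrad c u i j + psi_num i k (pmat c u) t *s pgrad c u (i+1) j)"
proof -
  have "hform c u (affine_vec k t) j = (affine_vec k t v* adj2 (pmat c u)) $ i *s pgrad c u i j
      + (affine_vec k t v* adj2 (pmat c u)) $ (i+1) *s pgrad c u (i+1) j"
    unfolding hform_def UNIV_index2[of i] by (simp add: index2_succ index2_succ(1)[symmetric])
  then show ?thesis unfolding affine_vec_adj2(2) unfolding affine_vec_adj2(1) by (simp add: vec.scale_right_distrib)
qed

text \<open>The two identities behind \<open>Psi\<^sup>* (dw - w\<^sub>z dz)\<close> and \<open>Psi\<^sup>* (dw\<^sub>z - w\<^sub>z\<^sub>z dz)\<close>. Here \<open>a, b, c, d\<close> are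
  the entries of the matrix, permuted according to the charts, \<open>e = a d - b c\<close> is \<open>\<plusminus>1\<close>, and primes
  denote one component of the differentials.\<close>

lemma contact_identities:
  fixes a b c d t e a' b' c' d' t' :: complex
  defines "s \<equiv> d - t * c" and "n \<equiv> t * a - b"
  assumes e: "a * d - b * c = e" "e * e = 1" and s: "s \<noteq> 0"
    and tr: "d * a' + a * d' - b * c' - c * b' = 0"
  defines "s' \<equiv> d' - (t * c' + t' * c)" and "n' \<equiv> (t * a' + t' * a) - b'"
  shows "t' - e * s\<^sup>2 * (n' / s - n * s' / s\<^sup>2) = e * (s * b' + n * d') - t * (e * (s * a' + n * c'))"
    and "e * (2 * s * s') - (- 2 * c * s ^ 3) * (n' / s - n * s' / s\<^sup>2) = - 2 * e * s\<^sup>2 * (e * (s * a' + n * c'))"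
proof -
  have det: "a * s + c * n = e" unfolding s_def n_def e(1)[symmetric] by (simp add: algebra_simps)
  have q: "s\<^sup>2 * (n' / s - n * s' / s\<^sup>2) = s * n' - n * s'" using s by (simp add: field_simps power2_eq_square)
  \<comment> \<open>Writing \<open>t'\<close> as \<open>e (a s + c n) t'\<close>, by
    \<open>e * e = 1\<close> and \<open>det\<close>, makes all terms with \<open>t'\<close>
    cancel.\<close>
  have "t' - e * s\<^sup>2 * (n' / s - n * s' / s\<^sup>2) = e * e * t' - e * (s * n' - n * s')" by (simp add: e(2) q mult.assoc)
  also have "\<dots> = e * ((a * s + c * n) * t' - (s * n' - n * s'))" by (simp add: det algebra_simps)
  also have "\<dots> = e * (s * b' + n * d') - t * (e * (s * a' + n * c'))" by (simp add: s'_def n'_def algebra_simps)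
  finally show "t' - e * s\<^sup>2 * (n' / s - n * s' / s\<^sup>2) = e * (s * b' + n * d') - t * (e * (s * a' + n * c'))" .
  have "e * (2 * s * s') - (- 2 * c * s ^ 3) * (n' / s - n * s' / s\<^sup>2) = 2 * s * (e * s' + c * (s\<^sup>2 * (n' / s - n * s' / s\<^sup>2)))"
    by (simp add: algebra_simps power2_eq_square power3_eq_cube)
  also have "\<dots> = 2 * s * ((a * s + c * n) * s' + c * (s * n' - n * s'))" by (simp add: q det)
  also have "\<dots> = 2 * s\<^sup>2 * (a * s' + c * n')" by (simp add: algebra_simps power2_eq_square)
  \<comment> \<open>The derivative of \<open>a s + c n\<close> is the expression in
    \<open>tr\<close>, with the contributions of \<open>t'\<close> cancelling. Since
    \<open>tr\<close> is zero, only the differentials of the column \<open>(a, c)\<close>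
    remain.\<close>
  also have "a * s' + c * n' = (d * a' + a * d' - b * c' - c * b') - (s * a' + n * c')"
    by (simp add: s'_def n'_def s_def n_def algebra_simps)
  also have "2 * s\<^sup>2 * \<dots> = - 2 * (e * e) * s\<^sup>2 * (s * a' + n * c')" by (simp only: tr e(2)) (simp add: algebra_simps)
  finally show "e * (2 * s * s') - (- 2 * c * s ^ 3) * (n' / s - n * s' / s\<^sup>2) = - 2 * e * s\<^sup>2 * (e * (s * a' + n * c'))"
    by (simp add: mult_ac)
qed

text \<open>In each coordinate direction \<open>m\<close> the claims are
  \<open>contact_identities\<close>, with the \<open>m\<close>-th partial derivatives in place of
  the primes.\<close>

lemma contact_pullback:
  fixes c :: bool and l i k :: 2 and u :: "complex^4"
  assumes u: "u \<in> psi_domain c l i k"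
  defines "t \<equiv> flip l k (u $ 4)" and "J \<equiv> cjacobian (local_rep (pchart c l) (ichart i k) Psi) u"
    and "v \<equiv> local_rep (pchart c l) (ichart i k) Psi u"
  shows "contact_form1 v v* J = hform c u (affine_vec k t) (k+1) - t *s hform c u (affine_vec k t) k"
    and "contact_form2 v v* J = (- 2 * v $ 3) *s hform c u (affine_vec k t) k"
proof -
  define A where "A = pmat c u"
  define T where "T = (\<lambda>u::complex^4. flip l k (u $ 4))"
  have ud: "pdom c u" "l = k \<or> u $ 4 \<noteq> 0" and d: "psi_den i k A t \<noteq> 0"
    using u by (auto simp: psi_domain_def A_def t_def)
  have v: "v = psi_coords i k A t" using Psi_local_rep[OF u] by (simp add: v_def A_def t_def)
  obtain gt where gt: "has_cgradient T gt u"
    using holomorphic_fun_onD[OF holomorphic_affine_coord[of "{u}" l k]] ud(2) by (auto simp: T_def)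
  have Tu: "T u = t" by (simp add: T_def t_def)
  note pg = has_cgradient_pmat[OF ud(1)]
  define gs where "gs = pgrad c u (i+1) (k+1) - (t *s pgrad c u (i+1) k + A $ (i+1) $ k *s gt)"
  define gn where "gn = (t *s pgrad c u i k + A $ i $ k *s gt) - pgrad c u i (k+1)"
  have den: "has_cgradient (\<lambda>u. psi_den i k (pmat c u) (T u)) gs u"
    unfolding psi_den_def gs_def A_def Tu[symmetric] by (intro has_cgradient_diff has_cgradient_mult pg gt)
  have num: "has_cgradient (\<lambda>u. psi_num i k (pmat c u) (T u)) gn u"
    unfolding psi_num_def gn_def A_def Tu[symmetric] by (intro has_cgradient_diff has_cgradient_mult pg gt)
  let ?s = "psi_den i k A t" and ?n = "psi_num i k A t"
  have J: "has_cgradient (\<lambda>u. local_rep (pchart c l) (ichart i k) Psi u $ m) (J $ m) u" for m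
    unfolding J_def by (rule holomorphic_map_on_cjacobian[OF holomorphic_Psi_local_rep u])
  \<comment> \<open>The Jacobian is that of \<open>local_rep\<close>, which agrees with the explicit
    formula only on the open set \<open>psi_domain\<close>; locality of the gradient bridges the
    two.\<close>
  have J': "cgradient (\<lambda>u. psi_coords i k (pmat c u) (T u) $ m) u = J $ m" for m
    by (rule cgradient_eq[OF has_cgradient_transform[OF J open_psi_domain u]]) (simp add: Psi_local_rep T_def)
  have "has_cgradient (\<lambda>u. psi_num i k (pmat c u) (T u) / psi_den i k (pmat c u) (T u)) ((1 / ?s) *s gn - (?n / ?s\<^sup>2) *s gs) u"
    using has_cgradient_divide[OF num den] d by (simp add: Tu A_def)
  from cgradient_eq[OF this] have J1: "J $ 1 = (1 / ?s) *s gn - (?n / ?s\<^sup>2) *s gs"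
    using J'[of 1] by (simp add: psi_coords_def vector_4_component)
  have J2: "J $ 2 = gt" using J'[of 2] cgradient_eq[OF gt] by (simp add: psi_coords_def vector_4_component)
  have "has_cgradient (\<lambda>u. eps i k * (psi_den i k (pmat c u) (T u))\<^sup>2) (eps i k *s ((2 * ?s) *s gs)) u"
    using has_cgradient_scale[OF has_cgradient_power[OF den, of 2]] by (simp add: Tu A_def)
  from cgradient_eq[OF this] have J3: "J $ 3 = eps i k *s ((2 * ?s) *s gs)"
    using J'[of 3] by (simp add: psi_coords_def vector_4_component)
  have det: "A $ i $ k * A $ (i+1) $ (k+1) - A $ i $ (k+1) * A $ (i+1) $ k = eps i k"
    using minor_det[of A i k] det_pmat[OF ud(1)] by (simp add: A_def)
  have tr: "A $ (i+1) $ (k+1) * pgrad c u i k $ m + A $ i $ k * pgrad c u (i+1) (k+1) $ m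
    - A $ i $ (k+1) * pgrad c u (i+1) k $ m - A $ (i+1) $ k * pgrad c u i (k+1) $ m = 0" for m
    using arg_cong[OF pgrad_minor[OF ud(1), of i k], of "\<lambda>x. x $ m"] by (simp add: A_def)
  have gs_nth: "gs $ m = pgrad c u (i+1) (k+1) $ m - (t * pgrad c u (i+1) k $ m + gt $ m * A $ (i+1) $ k)"
    and gn_nth: "gn $ m = t * pgrad c u i k $ m + gt $ m * A $ i $ k - pgrad c u i (k+1) $ m" for m
    by (simp_all add: gs_def gn_def mult.commute)
  have v34: "v $ 3 = eps i k * ?s\<^sup>2" "v $ 4 = - 2 * A $ (i+1) $ k * ?s ^ 3" by (simp_all add: v psi_coords_def vector_4_component)
  show "contact_form1 v v* J = hform c u (affine_vec k t) (k+1) - t *s hform c u (affine_vec k t) k"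
    unfolding contact_form_pullback vec_eq_iff
  proof
    fix m
    show "(J $ 2 - v $ 3 *s J $ 1) $ m = (hform c u (affine_vec k t) (k+1) - t *s hform c u (affine_vec k t) k) $ m"
      using d contact_identities(1)[OF det eps_sq(1) d[unfolded psi_den_def] tr[of m], of "gt $ m",
          folded psi_den_def psi_num_def gs_nth gn_nth]
      by (simp add: J1 J2 v34 hform_affine[of c u k t _ i, folded A_def] algebra_simps)
  qed
  show "contact_form2 v v* J = (- 2 * v $ 3) *s hform c u (affine_vec k t) k"
    unfolding contact_form_pullback vec_eq_iff
  proof
    fix m
    show "(J $ 3 - v $ 4 *s J $ 1) $ m = ((- 2 * v $ 3) *s hform c u (affine_vec k t) k) $ m"
      using d contact_identities(2)[OF det eps_sq(1) d[unfolded psi_den_def] tr[of m], of "gt $ m",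
          folded psi_den_def psi_num_def gs_nth gn_nth]
      by (simp add: J1 J3 v34 hform_affine[of c u k t _ i, folded A_def] algebra_simps)
  qed
qed

lemma pullback_Psi: "pullback_equals product_atlas immersion_atlas Psi contact_bundle H_bundle"
  unfolding pullback_equals_def
proof (intro ballI allI impI)
  fix \<kappa> :: "((complex^2^2) \<times> cp1, complex^4) chart" and \<kappa>' :: "(jet2, complex^4) chart" and V :: "(complex^4) set"
  assume "\<kappa> \<in> product_atlas" "\<kappa>' \<in> immersion_atlas" and V0: "open V \<and> V \<subseteq> snd \<kappa> ` (fst \<kappa> \<inter> Psi -` fst \<kappa>')"
  then obtain c l i k where k: "\<kappa> = pchart c l" "\<kappa>' = ichart i k" by (elim product_atlas_cases immersion_atlas_cases) blast
  have V: "open V" "V \<subseteq> psi_domain c l i k" using V0 by (simp_all add: k psi_domain_eq)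
  define R J T where "R = local_rep \<kappa> \<kappa>' Psi" and "J = cjacobian R" and "T = (\<lambda>u::complex^4. flip l k (u $ 4))"
  define a b where "a = (\<lambda>u. hform c u (affine_vec k (T u)) k)" and "b = (\<lambda>u. hform c u (affine_vec k (T u)) (k+1))"
  have dom: "pdom c u" "l = k \<or> u $ 4 \<noteq> 0" "u \<in> psi_domain c l i k" if "u \<in> V" for u
    using that V(2) by (auto simp: psi_domain_def)
  have T: "holomorphic_fun_on T V" unfolding T_def using dom(2) by (rule holomorphic_affine_coord)
  have ab: "holomorphic_map_on a V" "holomorphic_map_on b V"
    unfolding a_def b_def using dom(1) T by (auto intro: holomorphic_hform)
  have R: "holomorphic_map_on R V"
    unfolding R_def k by (rule holomorphic_map_on_subset[OF holomorphic_Psi_local_rep V(2)])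
  have pull: "contact_form1 (R u) v* J u = b u - T u *s a u" "contact_form2 (R u) v* J u = (- 2 * R u $ 3) *s a u" if "u \<in> V" for u
    using contact_pullback[OF dom(3)[OF that]] by (simp_all add: R_def J_def a_def b_def T_def k)
  have R3: "R u $ 3 \<noteq> 0" if "u \<in> V" for u
    using dom(3)[OF that] Psi_local_rep[OF dom(3)[OF that]]
    by (simp add: R_def k psi_coords_def vector_4_component eps_sq psi_domain_def)
  have H: "H_bundle \<kappa> (chart_inv \<kappa> u) = vec.span {a u, b u}" if "u \<in> V" for u
  proof -
    have "H_bundle (pchart c l) (pinv c l u) = vec.span {hform c u (affine_vec k (T u)) 1, hform c u (affine_vec k (T u)) 2}"
      using dom[OF that] abs_affine_flip[of l k "u $ 4"] affine_vec_simps(3)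
      by (intro H_bundle_pchart) (simp_all add: T_def)
    then show ?thesis
      using dom(1)[OF that] by (simp add: k chart_inv_pchart hform_span_index[of c u _ k] a_def b_def)
  qed
  let ?G = "{one_form V (\<lambda>u. \<theta> (R u) v* J u) | \<theta> W. open W \<and> W \<subseteq> snd \<kappa>' ` fst \<kappa>' \<and> R ` V \<subseteq> W \<and> \<theta> \<in> sections contact_bundle \<kappa>' W}"
  let ?S = "one_form V ` sections H_bundle \<kappa> V"
  have "?G \<subseteq> ?S"
  proof
    fix \<omega> assume "\<omega> \<in> ?G"
    then obtain \<theta> W where \<omega>: "\<omega> = one_form V (\<lambda>u. \<theta> (R u) v* J u)" and W: "W \<subseteq> snd \<kappa>' ` fst \<kappa>'" "R ` V \<subseteq> W"
      and \<theta>: "holomorphic_map_on \<theta> W" "\<And>w. w \<in> W \<Longrightarrow> \<theta> w \<in> contact_bundle \<kappa>' (chart_inv \<kappa>' w)"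
      by (auto simp: sections_def)
    define f where "f = (\<lambda>m u. \<theta> (R u) $ m)"
    have f: "holomorphic_fun_on (f m) V" for m
      using holomorphic_map_on_compose[OF R \<theta>(1) W(2)] by (simp add: holomorphic_map_on_def f_def)
    \<comment> \<open>In the contact frame the coefficients of a section are its components along
      \<open>dw\<close> and \<open>dw\<^sub>z\<close>, hence holomorphic; this makes the pulled-back
      section a section of the system.\<close>
    define \<eta> where "\<eta> = (\<lambda>u. f 2 u *s (b u - T u *s a u) + (f 3 u * (- 2 * R u $ 3)) *s a u)"
    have eq: "\<theta> (R u) v* J u = \<eta> u" if u: "u \<in> V" for u
    proof -
      have w: "R u \<in> W" using W(2) u by blast
      then have "\<theta> (R u) \<in> vec.span {contact_form1 (R u), contact_form2 (R u)}"
        using \<theta>(2)[OF w] W(1) chart_inv_right[of "R u" \<kappa>'] by (auto simp: contact_bundle_eq)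
      then obtain x y where xy: "\<theta> (R u) = x *s contact_form1 (R u) + y *s contact_form2 (R u)" by (auto simp: span_pair)
      then have "x = f 2 u" "y = f 3 u" by (simp_all add: f_def contact_form1_def contact_form2_def axis_def)
      then show ?thesis
        by (simp add: xy vector_matrix_left_distrib scalar_vector_matrix_assoc pull[OF u] \<eta>_def)
    qed
    have "holomorphic_map_on \<eta> V"
    proof -
      have abm: "holomorphic_fun_on (\<lambda>u. a u $ m) V" "holomorphic_fun_on (\<lambda>u. b u $ m) V" "holomorphic_fun_on (\<lambda>u. R u $ m) V" for m
        using ab R by (simp_all add: holomorphic_map_on_def)
      have "holomorphic_fun_on (\<lambda>u. f 2 u * (b u $ m - T u * a u $ m) + (f 3 u * (- 2 * R u $ 3)) * a u $ m) V" for m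
        by (intro holomorphic_fun_intros f abm T)
      then show ?thesis by (simp add: holomorphic_map_on_def \<eta>_def algebra_simps)
    qed
    moreover have "\<eta> u \<in> H_bundle \<kappa> (chart_inv \<kappa> u)" if "u \<in> V" for u
      unfolding H[OF that] \<eta>_def by (intro vec.span_add vec.span_scale vec.span_diff vec.span_base) auto
    ultimately have "\<eta> \<in> sections H_bundle \<kappa> V" by (simp add: sections_def)
    moreover have "\<omega> = one_form V \<eta>" unfolding \<omega> by (rule one_form_cong) (rule eq)
    ultimately show "\<omega> \<in> ?S" by blast
  qed
  then have 1: "differential_ideal V ?G \<subseteq> differential_ideal V ?S"
    by (intro differential_ideal_subset subsetI) (rule differential_ideal.gen, rule subsetD)
  \<comment> \<open>Both contact forms are defined on the whole chart, so they may be pulled back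
    with \<open>W\<close> the full coordinate image. All coefficients needed below are functions on
    \<open>V\<close> itself and need not descend along \<open>Psi\<close>, even where it identifies
    points of \<open>V\<close>.\<close>
  have RV: "R ` V \<subseteq> snd \<kappa>' ` fst \<kappa>'" using R3 by (auto simp: k ichart_image)
  have W: "open (snd \<kappa>' ` fst \<kappa>')" unfolding k ichart_image by (rule open_nth_nonzero)
  have gen: "one_form V (\<lambda>u. \<theta> (R u) v* J u) \<in> differential_ideal V ?G"
    if "\<theta> \<in> {contact_form1, contact_form2}" for \<theta>
  proof -
    have "\<theta> \<in> sections contact_bundle \<kappa>' (snd \<kappa>' ` fst \<kappa>')"
      using that holomorphic_contact_forms by (auto simp: sections_def contact_bundle_eq chart_inv_right vec.span_base)
    then show ?thesis using W RV by (intro differential_ideal.gen) blast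
  qed
  have gen1: "one_form V (\<lambda>u. b u - T u *s a u) \<in> differential_ideal V ?G"
    using gen[of contact_form1] one_form_cong[of V "\<lambda>u. contact_form1 (R u) v* J u", OF pull(1)] by simp
  have gen2: "one_form V (\<lambda>u. (- 2 * R u $ 3) *s a u) \<in> differential_ideal V ?G"
    using gen[of contact_form2] one_form_cong[of V "\<lambda>u. contact_form2 (R u) v* J u", OF pull(2)] by simp
  have "?S \<subseteq> differential_ideal V ?G"
  proof
    fix \<omega> assume "\<omega> \<in> ?S"
    then obtain \<eta> where \<omega>: "\<omega> = one_form V \<eta>" and \<eta>: "holomorphic_map_on \<eta> V"
      and \<eta>H: "\<And>u. u \<in> V \<Longrightarrow> \<eta> u \<in> vec.span {a u, b u}" using H by (auto simp: sections_def)
    \<comment> \<open>Membership in the fibres only gives numbers at each point; the dual tangent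
      vectors turn them into holomorphic functions on \<open>V\<close>.\<close>
    define x y where "x = (\<lambda>u. hcoef1 c u k (T u) (\<eta> u))" and "y = (\<lambda>u. hcoef2 c u k (\<eta> u))"
    have xy: "holomorphic_fun_on x V" "holomorphic_fun_on y V"
      unfolding x_def y_def using holomorphic_hcoef[OF dom(1) T \<eta>] by auto
    have R3h: "holomorphic_fun_on (\<lambda>u. R u $ 3) V" using R by (simp add: holomorphic_map_on_def)
    \<comment> \<open>This solves \<open>x a + y b = y (b - T a) + g (- 2 w\<^sub>z a)\<close> for
      \<open>g\<close>; here the absence of zeros of \<open>w\<^sub>z\<close> enters.\<close>
    define g where "g = (\<lambda>u. (x u + T u * y u) / (- 2 * R u $ 3))"
    have g: "holomorphic_fun_on g V"
      unfolding g_def by (intro holomorphic_fun_intros xy T R3h) (use R3 in auto)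
    have "\<eta> u = y u *s (b u - T u *s a u) + g u *s ((- 2 * R u $ 3) *s a u)" if u: "u \<in> V" for u
    proof -
      have "\<eta> u = x u *s a u + y u *s b u"
        using in_span_hform[OF dom(1)[OF u], of "\<eta> u" k "T u"] \<eta>H[OF u] hform_span_index[of c u _ k]
        by (simp add: a_def b_def x_def y_def)
      moreover have "g u * (- 2 * R u $ 3) = x u + T u * y u" using R3[OF u] by (simp add: g_def)
      ultimately show ?thesis by (simp only: vector_smult_assoc) (simp add: vec_eq_iff algebra_simps)
    qed
    then have "\<omega> = form_add (one_form V (\<lambda>u. y u *s (b u - T u *s a u))) (one_form V (\<lambda>u. g u *s ((- 2 * R u $ 3) *s a u)))"
      unfolding \<omega> one_form_add[symmetric] by (rule one_form_cong)
    then show "\<omega> \<in> differential_ideal V ?G"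
      using one_form_scale_in_ideal[OF gen1 xy(2) V(1)] one_form_scale_in_ideal[OF gen2 g V(1)]
      by (simp add: differential_ideal.add)
  qed
  then have 2: "differential_ideal V ?S \<subseteq> differential_ideal V ?G" by (rule differential_ideal_subset)
  show "pullback_system Psi contact_bundle \<kappa> \<kappa>' V = pfaffian_system H_bundle \<kappa> V"
    unfolding pullback_system_def pfaffian_system_def using 1 2 by (simp add: R_def J_def)
qed

lemma equivariant_Psi: "equivariant_on SL2 (SL2 \<times> UNIV) diagonal_act prolonged_act Psi"
  by (auto simp: equivariant_on_def Psi_equivariant)

theorem theorem5p1:
  "complex_manifold product_atlas \<and> carrier_of product_atlas = SL2 \<times> UNIV \<and>
   holomorphic_subbundle product_atlas 2 H_bundle \<and>
   complex_manifold immersion_atlas \<and> carrier_of immersion_atlas = immersion_jets \<and>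
   holomorphic_subbundle immersion_atlas 2 contact_bundle \<and>
   equivariantly_equivalent SL2
     product_atlas diagonal_act H_bundle immersion_atlas prolonged_act contact_bundle \<and>
   local_biholomorphism product_atlas immersion_atlas Psi \<and>
   equivariant_on SL2 (SL2 \<times> UNIV) diagonal_act prolonged_act Psi \<and>
   pullback_equals product_atlas immersion_atlas Psi contact_bundle H_bundle"
proof -
  have "equivariantly_equivalent SL2
     product_atlas diagonal_act H_bundle immersion_atlas prolonged_act contact_bundle"
    unfolding equivariantly_equivalent_def carrier_product_atlas
    using local_biholomorphism_Psi Psi_surj equivariant_Psi pullback_Psi carrier_product_atlas by metis
  then show ?thesis
    using complex_manifold_product_atlas carrier_product_atlas holomorphic_subbundle_H
      complex_manifold_immersion_atlas carrier_immersion_atlas holomorphic_subbundle_contact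
      local_biholomorphism_Psi equivariant_Psi pullback_Psi by simp
qed

end
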